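(* Consider the matrix-valued Allen–Cahn equation with periodic boundary condition, written as $$U_t+\kappa U=\varepsilon^2\Delta U+\mathcal N[U],\qquad t>0,\ \mathbf x\in\Omega,\qquad U|_{t=0}=U_0.$$ If $\kappa\ge 3m-1$, then both the ETD1 scheme $$U^{n+1}=e^{-\tau L}U^n+(\mathcal I-e^{-\tau L})L^{-1}\mathcal N[U^n]$$ and the ETDRK2 scheme $$\widetilde U^{n+1}=e^{-\tau L}U^n+(\mathcal I-e^{-\tau L})L^{-1}\mathcal N[U^n],$$ $$U^{n+1}=\widetilde U^{n+1}-\frac1\tau\big(e^{-\tau L}-\mathcal I+\tau L\big)L^{-2}\big(\mathcal N[U^n]-\mathcal N[\widetilde U^{n+1}]\big),$$ each with time step size $\tau>0$ and $U^0=U_0$, satisfy the energy dissipation law, i.e., $$E(U^{n+1})\le E(U^n)\qquad\text{for all } n\ge0,$$ where $E$ is the original energy of the matrix-valued Allen–Cahn equation.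
   Context: Let $m\ge2$ be an integer, $\Omega=[-\frac12,\frac12]^m$, and let $\varepsilon>0$ and $\kappa>0$ be constants. The unknown $U(t,\mathbf x)\in\mathbb R^{m\times m}$ is a real matrix-valued field with periodic boundary condition on $\Omega$ and initial condition $U_0$. $\|\cdot\|_F$ and $\langle\cdot,\cdot\rangle_F$ are the Frobenius norm and Frobenius inner product on $\mathbb R^{m\times m}$, $I$ is the $m\times m$ identity matrix and $\mathcal I$ is the identity operator. The nonlinear operator is $\mathcal N=\kappa\mathcal I+f$ with $f(U)=U-UU^{\mathrm T}U$ (acting pointwise), so that the equation is equivalent to $U_t=\varepsilon^2\Delta U+f(U)$. The linear operator is $L=\kappa\mathcal I-\varepsilon^2\Delta$ with periodic boundary condition, where $\Delta$ acts entrywise; $e^{-\tau L}$ is the solution operator at time $\tau$ of $W_s=-LW$, and the functions of $L$ in the schemes have the integral forms $(\mathcal I-e^{-\tau L})L^{-1}=\int_0^\tau e^{-(\tau-s)L}\,ds$ and $\frac1\tau(e^{-\tau L}-\mathcal I+\tau L)L^{-2}=\int_0^\tau\frac s\tau e^{-(\tau-s)L}\,ds$. $U^n$ is the numerical approximation at time $t_n=n\tau$. The energy is $$E(U)=\int_\Omega\Big(\frac{\varepsilon^2}2\|\nabla U\|_F^2+\langle F(U),I\rangle_F\Big)d\mathbf x,\qquad \|\nabla U\|_F^2=\sum_{i,j=1}^m|\nabla U_{ij}|^2,\qquad F(U)=\tfrac14(U^{\mathrm T}U-I)^2.$$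
   Formalization: The initial condition U_0 is assumed periodic, continuously differentiable, and bounded by ‖U_0(x)‖_F ≤ √m for all x; without such a bound the claim fails, e.g. for ETD1 with U_0 = cI and c large. *)

theory Defs
  imports "HOL-Analysis.Analysis"
begin

text \<open>
  A field on \<open>\<Omega> = [-1/2,1/2]^m\<close> with periodic boundary condition is represented by its periodic
  extension to the whole space; \<open>m\<close> is \<open>CARD('m)\<close>, for the spatial dimension and for the size
  of the matrices alike. On \<open>real^'m^'m\<close> the library's \<open>norm\<close> and \<open>\<bullet>\<close> are the Frobenius norm and
  the Frobenius inner product.
\<close>

type_synonym 'm field = "real^'m \<Rightarrow> real^'m^'m"

definition Omega :: "(real^'m) set" where
  "Omega = cbox (\<chi> i. - 1/2) (\<chi> i. 1/2)"

definition periodic :: "'m::finite field \<Rightarrow> bool" where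
  "periodic U \<longleftrightarrow> (\<forall>x k. U (x + axis k 1) = U x)"

definition partial :: "'m::finite \<Rightarrow> (real^'m \<Rightarrow> real) \<Rightarrow> real^'m \<Rightarrow> real" where
  "partial k u x = deriv (\<lambda>h. u (x + h *\<^sub>R axis k 1)) 0"

definition grad :: "(real^'m::finite \<Rightarrow> real) \<Rightarrow> real^'m \<Rightarrow> real^'m" where
  "grad u x = (\<chi> k. partial k u x)"

definition laplacian :: "(real^'m::finite \<Rightarrow> real) \<Rightarrow> real^'m \<Rightarrow> real" where
  "laplacian u x = (\<Sum>k\<in>UNIV. partial k (partial k u) x)"

definition C1 :: "(real^'m::finite \<Rightarrow> real) \<Rightarrow> bool" where
  "C1 u \<longleftrightarrow> (\<forall>x. u differentiable (at x)) \<and> (\<forall>k. continuous_on UNIV (partial k u))"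

definition C2 :: "(real^'m::finite \<Rightarrow> real) \<Rightarrow> bool" where
  "C2 u \<longleftrightarrow> C1 u \<and> (\<forall>k. C1 (partial k u))"

definition C1_field :: "'m::finite field \<Rightarrow> bool" where
  "C1_field U \<longleftrightarrow> (\<forall>i j. C1 (\<lambda>x. U x $ i $ j))"

definition C2_field :: "'m::finite field \<Rightarrow> bool" where
  "C2_field U \<longleftrightarrow> (\<forall>i j. C2 (\<lambda>x. U x $ i $ j))"

definition Laplacian :: "'m::finite field \<Rightarrow> 'm field" where
  "Laplacian U x = (\<chi> i j. laplacian (\<lambda>y. U y $ i $ j) x)"

definition lin_op :: "real \<Rightarrow> real \<Rightarrow> 'm::finite field \<Rightarrow> 'm field" where
  "lin_op \<epsilon> \<kappa> U x = \<kappa> *\<^sub>R U x - \<epsilon>\<^sup>2 *\<^sub>R Laplacian U x"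

definition ac_f :: "real^'m^'m \<Rightarrow> real^'m::finite^'m" where
  "ac_f A = A - A ** transpose A ** A"

definition nonlin :: "real \<Rightarrow> 'm::finite field \<Rightarrow> 'm field" where
  "nonlin \<kappa> U x = \<kappa> *\<^sub>R U x + ac_f (U x)"

text \<open>\<open>W\<close> is a classical solution of \<open>W\<^sub>s = - L W\<close> for \<open>s > 0\<close>, continuous up to \<open>s = 0\<close>.\<close>

definition linear_solution ::
  "real \<Rightarrow> real \<Rightarrow> 'm::finite field \<Rightarrow> (real \<Rightarrow> 'm field) \<Rightarrow> bool" where
  "linear_solution \<epsilon> \<kappa> V W \<longleftrightarrow>
     W 0 = V \<and>
     continuous_on ({0..} \<times> UNIV) (\<lambda>(s, x). W s x) \<and>
     (\<forall>s\<ge>0. periodic (W s)) \<and>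
     (\<forall>s>0. C2_field (W s)) \<and>
     (\<forall>s>0. \<forall>x. ((\<lambda>r. W r x) has_vector_derivative - lin_op \<epsilon> \<kappa> (W s) x) (at s))"

text \<open>
  The solution operator \<open>e\<^bsup>-\<tau>L\<^esup>\<close>, for \<open>\<tau> \<ge> 0\<close> and continuous periodic \<open>V\<close>. The description is on
  the value at time \<open>\<tau>\<close>, because \<open>linear_solution\<close> leaves \<open>W\<close> arbitrary at negative times.
\<close>

definition exp_L :: "real \<Rightarrow> real \<Rightarrow> real \<Rightarrow> 'm::finite field \<Rightarrow> 'm field" where
  "exp_L \<epsilon> \<kappa> \<tau> V = (THE Z. \<exists>W. linear_solution \<epsilon> \<kappa> V W \<and> Z = W \<tau>)"

text \<open>\<open>(\<I> - e\<^bsup>-\<tau>L\<^esup>) L\<^bsup>-1\<^esup>\<close> and \<open>(1/\<tau>) (e\<^bsup>-\<tau>L\<^esup> - \<I> + \<tau> L) L\<^bsup>-2\<^esup>\<close>, in integral form.\<close>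

definition phi1 :: "real \<Rightarrow> real \<Rightarrow> real \<Rightarrow> 'm::finite field \<Rightarrow> 'm field" where
  "phi1 \<epsilon> \<kappa> \<tau> V x = integral {0..\<tau>} (\<lambda>s. exp_L \<epsilon> \<kappa> (\<tau> - s) V x)"

definition phi2 :: "real \<Rightarrow> real \<Rightarrow> real \<Rightarrow> 'm::finite field \<Rightarrow> 'm field" where
  "phi2 \<epsilon> \<kappa> \<tau> V x = integral {0..\<tau>} (\<lambda>s. (s / \<tau>) *\<^sub>R exp_L \<epsilon> \<kappa> (\<tau> - s) V x)"

definition ETD1 :: "real \<Rightarrow> real \<Rightarrow> real \<Rightarrow> 'm::finite field \<Rightarrow> 'm field" where
  "ETD1 \<epsilon> \<kappa> \<tau> U x = exp_L \<epsilon> \<kappa> \<tau> U x + phi1 \<epsilon> \<kappa> \<tau> (nonlin \<kappa> U) x"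

definition ETDRK2 :: "real \<Rightarrow> real \<Rightarrow> real \<Rightarrow> 'm::finite field \<Rightarrow> 'm field" where
  "ETDRK2 \<epsilon> \<kappa> \<tau> U x =
     (let V = ETD1 \<epsilon> \<kappa> \<tau> U
      in V x - phi2 \<epsilon> \<kappa> \<tau> (\<lambda>y. nonlin \<kappa> U y - nonlin \<kappa> V y) x)"

definition ac_F :: "real^'m^'m \<Rightarrow> real^'m::finite^'m" where
  "ac_F A = (1/4) *\<^sub>R ((transpose A ** A - mat 1) ** (transpose A ** A - mat 1))"

definition energy :: "real \<Rightarrow> 'm::finite field \<Rightarrow> real" where
  "energy \<epsilon> U = integral Omega (\<lambda>x.
     \<epsilon>\<^sup>2 / 2 * (\<Sum>i\<in>UNIV. \<Sum>j\<in>UNIV. (norm (grad (\<lambda>y. U y $ i $ j) x))\<^sup>2) + ac_F (U x) \<bullet> mat 1)"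

end

theory Submission
  imports Defs "HOL-Probability.Distributions"
begin

text \<open>
  Write \<open>S t = e\<^bsup>-tL\<^esup>\<close>. The argument has three ingredients.

  \<^item> The semigroup is an average: with \<open>Z\<close> distributed with density proportional to
  \<open>exp (-\<bar>z\<bar>\<^sup>2/4)\<close>, the value \<open>S t u x\<close> is \<open>e\<^bsup>-\<kappa>t\<^esup>\<close> times the mean of \<open>u (x + \<epsilon> \<surd>t Z)\<close>.
  Differentiating the Gaussian kernel shows that this solves the linear equation, and the maximum
  principle that nothing else does (\<open>exp_L_eq_heat\<close>). Hence \<open>S t\<close> shrinks the sup norm by
  \<open>e\<^bsup>-\<kappa>t\<^esup>\<close>, commutes with derivatives, is symmetric for the \<open>L\<^sup>2\<close> pairing, and
  \<open>a \<mapsto> \<langle>S a p, p\<rangle>\<close> is nonnegative and decreasing. The matrix estimate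
  \<open>\<bar>\<kappa>A + f(A)\<bar> \<le> \<kappa>\<surd>m\<close> on the ball of radius \<open>\<surd>m\<close> then keeps all iterates in that ball.

  \<^item> On this ball the second derivative of the potential is at most \<open>3m - 1 \<le> \<kappa>\<close>. For a step from
  \<open>u\<close> to \<open>v\<close> this gives \<open>E(v) - E(u) \<le> Q(v) - Q(u)\<close> with the quadratic functional
  \<open>Q(w) = \<langle>Lw,w\<rangle>/2 - \<langle>N,w\<rangle>\<close> and \<open>N = \<kappa>u + f(u)\<close> (\<open>potential_step\<close>).

  \<^item> ETD1 follows the path \<open>W(s) = S s u + \<integral>\<^sub>0\<^sup>s S r N dr\<close>, which is the gradient flow
  \<open>W' = -LW + N\<close> of \<open>Q\<close>; so \<open>Q\<close> decreases along it. Fields are only continuously differentiable,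
  so \<open>LW\<close> is never formed. Instead \<open>L\<close> is replaced by \<open>(1 - S t)/t\<close> with \<open>t = \<tau>/n\<close>: with
  \<open>p = (W(t) - u)/t\<close> one has \<open>W(a+t) - W(a) = t S a p\<close> exactly, everything reduces to the
  monotonicity of \<open>\<langle>S a p, p\<rangle>\<close> (\<open>etd_discrete_inequality\<close>), and \<open>n \<rightarrow> \<infinity>\<close> recovers \<open>Q\<close>, because
  \<open>\<langle>u - S t u, u\<rangle>/t\<close> tends to \<open>\<epsilon>\<^sup>2 \<integral>\<bar>\<nabla>u\<bar>\<^sup>2 + \<kappa> \<integral>\<bar>u\<bar>\<^sup>2\<close>
  (\<open>torus_ip_heat_dirichlet_limit\<close>).

  ETDRK2 adds to the ETD1 value \<open>w\<close> the correction \<open>e = \<integral>\<^sub>0\<^sup>\<tau> (1 - r/\<tau>) S r h dr\<close> with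
  \<open>h = N(w) - N(u)\<close>. Relative to the functional of the second stage it contributes
  \<open>-\<langle>S \<tau> p, e\<rangle> + \<langle>Le,e\<rangle>/2 - \<langle>h,e\<rangle>\<close>. The first term is absorbed by the dissipation
  \<open>\<tau> \<bar>S \<tau> p\<bar>\<^sup>2\<close> of the first stage and \<open>\<bar>e\<bar>\<^sup>2/(4\<tau>)\<close>, and \<open>\<bar>e\<bar>\<^sup>2 \<le> \<tau> \<langle>h,e\<rangle>\<close>,
  \<open>\<langle>Le,e\<rangle> \<le> \<langle>h,e\<rangle>\<close>, so that the total is at most \<open>-\<langle>h,e\<rangle>/4 \<le> 0\<close>.
\<close>

text \<open>
  The gauge integral \<open>integral S f\<close> serves for \<open>Omega\<close> and for time intervals, the Lebesgue integral
  for Gaussian weights on the whole space; their rules share the same base names.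
\<close>

lemmas hk_integral_cong = Henstock_Kurzweil_Integration.integral_cong
lemmas hk_integral_diff = Henstock_Kurzweil_Integration.integral_diff
lemmas hk_integral_nonneg = Henstock_Kurzweil_Integration.integral_nonneg
lemmas lb_integrable_bound = Bochner_Integration.integrable_bound
lemmas lb_integral_cong = Bochner_Integration.integral_cong

section \<open>Frobenius norm estimates for the nonlinearity\<close>

lemma bounded_bilinear_matrix_mult:
  "bounded_bilinear ((**) :: real^'n::finite^'l::finite \<Rightarrow> real^'k::finite^'n \<Rightarrow> real^'k^'l)"
  unfolding bilinear_conv_bounded_bilinear[symmetric] bilinear_def
  by (auto intro!: linearI simp: matrix_matrix_mult_def vec_eq_iff sum.distrib distrib_left distrib_right
      sum_distrib_left mult.assoc mult.left_commute)

lemmas matrix_mult_simps =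
  bounded_bilinear.add_left[OF bounded_bilinear_matrix_mult]
  bounded_bilinear.add_right[OF bounded_bilinear_matrix_mult]
  bounded_bilinear.diff_left[OF bounded_bilinear_matrix_mult]
  bounded_bilinear.diff_right[OF bounded_bilinear_matrix_mult]
  bounded_bilinear.scaleR_left[OF bounded_bilinear_matrix_mult]
  bounded_bilinear.scaleR_right[OF bounded_bilinear_matrix_mult]

lemma bounded_linear_transpose: "bounded_linear (transpose :: real^'n::finite^'k::finite \<Rightarrow> real^'k^'n)"
  by (auto intro!: linear_conv_bounded_linear[THEN iffD1] linearI simp: transpose_def vec_eq_iff)

lemma frob_inner: "A \<bullet> B = (\<Sum>i\<in>UNIV. \<Sum>j\<in>UNIV. A $ i $ j * B $ i $ j)"
  for A B :: "real^'n::finite^'k::finite"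
  by (simp add: inner_vec_def)

lemma frob_norm2: "(norm A)\<^sup>2 = (\<Sum>i\<in>UNIV. \<Sum>j\<in>UNIV. (A $ i $ j)\<^sup>2)"
  for A :: "real^'n::finite^'k::finite"
  unfolding power2_norm_eq_inner frob_inner by (simp add: power2_eq_square)

lemma norm_transpose [simp]: "norm (transpose A) = norm A" for A :: "real^'n::finite^'k::finite"
proof -
  have "(norm (transpose A))\<^sup>2 = (norm A)\<^sup>2"
    unfolding frob_norm2 by (subst sum.swap) (simp add: transpose_def)
  then show ?thesis by simp
qed

lemma inner_transpose: "transpose A \<bullet> transpose B = A \<bullet> B" for A B :: "real^'n::finite^'k::finite"
  unfolding frob_inner by (subst sum.swap) (simp add: transpose_def)

text \<open>
  Left multiplication by the transpose is the adjoint; this turns all traces below into Frobenius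
  inner products.
\<close>

lemma inner_matrix_mult_left: "(A ** B) \<bullet> C = B \<bullet> (transpose A ** C)"
  for A :: "real^'n::finite^'k::finite" and B :: "real^'l::finite^'n"
proof -
  have "(A ** B) \<bullet> C = (\<Sum>i\<in>UNIV. \<Sum>j\<in>UNIV. \<Sum>k\<in>UNIV. A$i$k * B$k$j * C$i$j)"
    by (simp add: frob_inner matrix_matrix_mult_def sum_distrib_right)
  also have "\<dots> = (\<Sum>k\<in>UNIV. \<Sum>j\<in>UNIV. \<Sum>i\<in>UNIV. A$i$k * B$k$j * C$i$j)"
    by (subst (2) sum.swap, subst sum.swap, subst (2) sum.swap) simp
  also have "\<dots> = B \<bullet> (transpose A ** C)"
    by (simp add: frob_inner matrix_matrix_mult_def transpose_def sum_distrib_left mult_ac)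
  finally show ?thesis .
qed

lemma norm_matrix_mult_le: "norm (A ** B) \<le> norm A * norm B"
  for A :: "real^'n::finite^'k::finite" and B :: "real^'l::finite^'n"
proof -
  have "(norm (A ** B))\<^sup>2 = (\<Sum>i\<in>UNIV. \<Sum>j\<in>UNIV. (A$i \<bullet> column j B)\<^sup>2)"
    by (simp add: frob_norm2 matrix_matrix_mult_def inner_vec_def column_def)
  also have "\<dots> \<le> (\<Sum>i\<in>UNIV. \<Sum>j\<in>UNIV. (norm (A$i))\<^sup>2 * (norm (column j B))\<^sup>2)"
    by (intro sum_mono) (metis Cauchy_Schwarz_ineq power2_norm_eq_inner)
  also have "\<dots> = (\<Sum>i\<in>UNIV. (norm (A$i))\<^sup>2) * (\<Sum>j\<in>UNIV. (norm (column j B))\<^sup>2)"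
    by (simp add: sum_product)
  also have "(\<Sum>i\<in>UNIV. (norm (A$i))\<^sup>2) = (norm A)\<^sup>2"
    by (simp add: power2_norm_eq_inner inner_vec_def)
  also have "(\<Sum>j\<in>UNIV. (norm (column j B))\<^sup>2) = (norm B)\<^sup>2"
    unfolding frob_norm2 power2_norm_eq_inner by (subst sum.swap) (simp add: inner_vec_def column_def power2_eq_square)
  finally have "(norm (A ** B))\<^sup>2 \<le> (norm A * norm B)\<^sup>2" by (simp add: power_mult_distrib)
  then show ?thesis by (meson mult_nonneg_nonneg norm_ge_zero power2_le_imp_le)
qed

lemma norm_mat_1: "(norm (mat 1 :: real^'m::finite^'m))\<^sup>2 = real CARD('m)"
proof -
  have "(norm (mat 1 :: real^'m^'m))\<^sup>2 = (\<Sum>i\<in>(UNIV::'m set). \<Sum>j\<in>(UNIV::'m set). if i = j then 1 else (0::real))"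
    unfolding frob_norm2 by (intro sum.cong refl) (auto simp: mat_def)
  then show ?thesis by simp
qed

lemma gram_inner: "A \<bullet> (A ** (transpose A ** A)) = (norm (transpose A ** A))\<^sup>2"
  for A :: "real^'n::finite^'k::finite"
  by (metis inner_commute inner_matrix_mult_left power2_norm_eq_inner)

lemma gram_inner_1: "(transpose A ** A) \<bullet> mat 1 = (norm A)\<^sup>2" for A :: "real^'n::finite^'k::finite"
  by (metis inner_matrix_mult_left matrix_mul_rid power2_norm_eq_inner transpose_transpose)

lemma ac_f_gram: "ac_f A = A - A ** (transpose A ** A)"
  by (simp add: ac_f_def matrix_mul_assoc)

text \<open>
  With \<open>P = A\<^sup>T A\<close> and \<open>c = \<kappa> + 1\<close> the squared norm is the trace of \<open>P (c - P)\<^sup>2\<close>. For a number \<open>x\<close> the cubic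
  \<open>x (c - x)\<^sup>2\<close> differs from its tangent at \<open>x = 1\<close> by \<open>(x - 1)\<^sup>2 (x + 2 - 2c)\<close>. The matrix version of this identity
  leaves \<open>\<bar>A (P - 1)\<bar>\<^sup>2 - (2c - 2) \<bar>P - 1\<bar>\<^sup>2\<close>, which is nonpositive because \<open>\<bar>A\<bar>\<^sup>2 \<le> m\<close>, and a
  tangent term of sign \<open>\<bar>A\<bar>\<^sup>2 - m\<close>.
\<close>

lemma norm_nonlin_le:
  fixes A :: "real^'m::finite^'m"
  assumes A: "norm A \<le> sqrt (real CARD('m))" and k: "3 * real CARD('m) - 1 \<le> \<kappa>"
  shows "norm (\<kappa> *\<^sub>R A + ac_f A) \<le> \<kappa> * sqrt (real CARD('m))"
proof -
  define P where "P = transpose A ** A"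
  define m where "m = real CARD('m)"
  define c where "c = \<kappa> + 1"
  have m1: "1 \<le> m" by (simp add: m_def Suc_le_eq)
  have c3: "3 * m \<le> c" using k by (simp add: c_def m_def)
  have A2: "(norm A)\<^sup>2 \<le> m"
    using A by (metis m_def norm_ge_zero of_nat_0_le_iff power_mono real_sqrt_pow2)
  have P1: "A \<bullet> (A ** P) = (norm P)\<^sup>2" "P \<bullet> mat 1 = (norm A)\<^sup>2"
    by (simp_all add: P_def gram_inner gram_inner_1)
  have e1: "(norm (A ** (P - mat 1)))\<^sup>2 = (norm (A ** P))\<^sup>2 - 2 * (norm P)\<^sup>2 + (norm A)\<^sup>2"
    using P1 by (simp add: matrix_mult_simps power2_norm_eq_inner inner_diff inner_commute)
  have e2: "(norm (P - mat 1))\<^sup>2 = (norm P)\<^sup>2 - 2 * (norm A)\<^sup>2 + m"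
    using P1 norm_mat_1[where 'm='m] by (simp add: power2_norm_eq_inner inner_diff inner_commute m_def)
  have "norm (A ** (P - mat 1)) \<le> norm A * norm (P - mat 1)" by (rule norm_matrix_mult_le)
  then have "(norm (A ** (P - mat 1)))\<^sup>2 \<le> (norm A)\<^sup>2 * (norm (P - mat 1))\<^sup>2"
    by (metis norm_ge_zero power_mono power_mult_distrib)
  also have "\<dots> \<le> (2 * c - 2) * (norm (P - mat 1))\<^sup>2"
    using A2 c3 m1 by (intro mult_right_mono) auto
  finally have e3: "(norm (A ** (P - mat 1)))\<^sup>2 - (2 * c - 2) * (norm (P - mat 1))\<^sup>2 \<le> 0" by simp
  have e4: "(3 - c) * (1 - c) * ((norm A)\<^sup>2 - m) \<le> 0"
    using c3 m1 A2 by (intro mult_nonneg_nonpos mult_nonpos_nonpos) auto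
  have "\<kappa> *\<^sub>R A + ac_f A = c *\<^sub>R A - A ** P"
    by (simp add: ac_f_gram P_def c_def algebra_simps)
  then have "(norm (\<kappa> *\<^sub>R A + ac_f A))\<^sup>2 = c\<^sup>2 * (norm A)\<^sup>2 - 2 * c * (norm P)\<^sup>2 + (norm (A ** P))\<^sup>2"
    using P1 by (simp add: power2_norm_eq_inner inner_diff inner_commute) (simp add: power2_eq_square algebra_simps)
  also have "\<dots> = ((norm (A ** (P - mat 1)))\<^sup>2 - (2 * c - 2) * (norm (P - mat 1))\<^sup>2)
      + \<kappa>\<^sup>2 * m + (3 - c) * (1 - c) * ((norm A)\<^sup>2 - m)"
  proof -
    \<comment> \<open>The tangent identity, with \<open>x\<close>, \<open>y\<close>, \<open>z\<close> for the squared norms of \<open>A\<close>, \<open>P\<close> and \<open>AP\<close>.\<close>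
    have "c\<^sup>2 * x - 2 * c * y + z = ((z - 2 * y + x) - (2 * c - 2) * (y - 2 * x + m))
        + \<kappa>\<^sup>2 * m + (3 - c) * (1 - c) * (x - m)" for x y z
      by (simp add: c_def algebra_simps power2_eq_square)
    then show ?thesis unfolding e1 e2 .
  qed
  also have "\<dots> \<le> \<kappa>\<^sup>2 * m" using e3 e4 by simp
  also have "\<dots> = (\<kappa> * sqrt m)\<^sup>2" using m1 by (simp add: power_mult_distrib)
  finally have "(norm (\<kappa> *\<^sub>R A + ac_f A))\<^sup>2 \<le> (\<kappa> * sqrt m)\<^sup>2" .
  moreover have "0 \<le> \<kappa> * sqrt m"
    using c3 m1 by (intro mult_nonneg_nonneg) (simp_all add: c_def)
  ultimately show ?thesis unfolding m_def by (rule power2_le_imp_le)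
qed

lemma ac_F_trace: "ac_F A \<bullet> mat 1 = (norm (transpose A ** A))\<^sup>2 / 4 - (norm A)\<^sup>2 / 2 + real CARD('m) / 4"
  for A :: "real^'m::finite^'m"
proof -
  let ?Q = "transpose A ** A - mat 1"
  have "transpose ?Q = ?Q"
    by (metis (no_types, lifting) bounded_linear.linear bounded_linear_transpose linear_diff
        matrix_transpose_mul transpose_mat transpose_transpose)
  then have "(?Q ** ?Q) \<bullet> mat 1 = ?Q \<bullet> ?Q"
    by (metis inner_matrix_mult_left matrix_mul_rid)
  then show ?thesis
    using gram_inner_1[of A] norm_mat_1[where 'm='m]
    by (simp add: ac_F_def power2_norm_eq_inner inner_diff inner_commute)
qed

text \<open>
  Along the segment from \<open>A\<close> to \<open>B\<close>, with \<open>d = B - A\<close>, the quartic part of the potential has second derivative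
  at most \<open>3 m \<bar>d\<bar>\<^sup>2\<close>, and the quadratic part contributes exactly \<open>- \<bar>d\<bar>\<^sup>2\<close>. So
  \<open>\<kappa> \<ge> 3 m - 1\<close> dominates the second-order remainder.
\<close>

lemma ac_F_taylor:
  fixes A B :: "real^'m::finite^'m"
  assumes A: "norm A \<le> sqrt (real CARD('m))" and B: "norm B \<le> sqrt (real CARD('m))"
    and k: "3 * real CARD('m) - 1 \<le> \<kappa>"
  shows "ac_F B \<bullet> mat 1 \<le> ac_F A \<bullet> mat 1 - ac_f A \<bullet> (B - A) + \<kappa> / 2 * (norm (B - A))\<^sup>2"
proof -
  define m where "m = real CARD('m)"
  define d where "d = B - A"
  define P where "P = transpose A ** A"
  define Q where "Q = transpose A ** d + transpose d ** A"
  define R where "R = transpose d ** d"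
  define w where "w s = A + s *\<^sub>R d" for s
  define a where "a = m * (norm d)\<^sup>2"
  have tr: "transpose (w s) = transpose A + s *\<^sub>R transpose d" for s
    by (simp add: w_def transpose_def vec_eq_iff)
  have gw: "transpose (w s) ** w s = P + s *\<^sub>R Q + s\<^sup>2 *\<^sub>R R" for s
    unfolding tr unfolding w_def P_def Q_def R_def matrix_mult_simps power2_eq_square
    by (simp add: scaleR_add_right)
  \<comment> \<open>Subtracting the quartic part, restricted to the segment, from its bounding parabola must leave a
    convex function of \<open>s\<close>.\<close>
  define \<phi> where "\<phi> s = 3/2 * a * s^2 - ((P + s *\<^sub>R Q + s^2 *\<^sub>R R) \<bullet> (P + s *\<^sub>R Q + s^2 *\<^sub>R R)) / 4" for s
  define \<phi>1 where "\<phi>1 s = 3 * a * s - ((P + s *\<^sub>R Q + s^2 *\<^sub>R R) \<bullet> (Q + (2 * s) *\<^sub>R R)) / 2" for s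
  define \<phi>2 where "\<phi>2 s = 3 * a - ((Q + (2 * s) *\<^sub>R R) \<bullet> (Q + (2 * s) *\<^sub>R R)) / 2 - (P + s *\<^sub>R Q + s^2 *\<^sub>R R) \<bullet> R" for s
  have D1: "DERIV \<phi> s :> \<phi>1 s" for s
    unfolding \<phi>_def \<phi>1_def inner_add inner_scaleR_left inner_scaleR_right
    by (rule derivative_eq_intros refl | simp)+ (simp add: algebra_simps power2_eq_square power3_eq_cube inner_commute)
  have D2: "DERIV \<phi>1 s :> \<phi>2 s" for s
    unfolding \<phi>1_def \<phi>2_def inner_add inner_scaleR_left inner_scaleR_right
    by (rule derivative_eq_intros refl | simp)+ (simp add: algebra_simps power2_eq_square inner_commute)
  have D3: "0 \<le> \<phi>2 s" if s: "s \<in> {0..1}" for s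
  proof -
    have "w s = (1 - s) *\<^sub>R A + s *\<^sub>R B" by (simp add: w_def d_def algebra_simps)
    then have "norm (w s) \<le> (1 - s) * norm A + s * norm B"
      using s by (metis (no_types, lifting) abs_of_nonneg atLeastAtMost_iff diff_ge_0_iff_ge norm_scaleR norm_triangle_ineq)
    also have "\<dots> \<le> (1 - s) * sqrt m + s * sqrt m"
      using A B s by (intro add_mono mult_left_mono) (auto simp: m_def)
    finally have "norm (w s) \<le> sqrt m" by (simp add: algebra_simps)
    then have "(norm (w s))\<^sup>2 \<le> (sqrt m)\<^sup>2" by (intro power_mono) auto
    then have wm: "(norm (w s))\<^sup>2 \<le> m" by (simp add: m_def)
    have Q: "Q + (2 * s) *\<^sub>R R = transpose (w s) ** d + transpose d ** w s"
      unfolding tr unfolding w_def Q_def R_def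
      unfolding matrix_mult_simps by (simp add: scaleR_2 flip: scaleR_scaleR)
    have "norm (Q + (2 * s) *\<^sub>R R) \<le> norm (w s) * norm d + norm d * norm (w s)"
      unfolding Q
      using norm_matrix_mult_le[of "transpose (w s)" d] norm_matrix_mult_le[of "transpose d" "w s"]
      by (intro order_trans[OF norm_triangle_ineq] add_mono) simp_all
    then have "(norm (Q + (2 * s) *\<^sub>R R))\<^sup>2 \<le> (2 * (norm (w s) * norm d))\<^sup>2"
      by (intro power_mono) (auto simp: mult.commute)
    also have "\<dots> = 4 * ((norm (w s))\<^sup>2 * (norm d)\<^sup>2)" by (simp add: power_mult_distrib)
    also have "\<dots> \<le> 4 * a" unfolding a_def using wm by (simp add: mult_right_mono)
    finally have b1: "(Q + (2 * s) *\<^sub>R R) \<bullet> (Q + (2 * s) *\<^sub>R R) \<le> 4 * a" by (simp add: power2_norm_eq_inner)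
    have "(P + s *\<^sub>R Q + s^2 *\<^sub>R R) \<bullet> R \<le> norm (transpose (w s) ** w s) * norm R"
      unfolding gw by (rule norm_cauchy_schwarz)
    also have "\<dots> \<le> (norm (w s) * norm (w s)) * (norm d * norm d)"
      unfolding R_def using norm_matrix_mult_le[of "transpose (w s)" "w s"] norm_matrix_mult_le[of "transpose d" d]
      by (intro mult_mono) auto
    also have "\<dots> \<le> a" using wm by (simp add: a_def power2_eq_square mult_right_mono)
    finally show ?thesis using b1 by (simp add: \<phi>2_def)
  qed
  \<comment> \<open>A convex function lies above its tangent at \<open>0\<close>.\<close>
  have main: "\<phi>1 0 * (1 - 0) \<le> \<phi> 1 - \<phi> 0"
    by (rule f''_imp_f'[of "{0..1}" \<phi> \<phi>1 \<phi>2]) (auto intro: D1 D2 D3)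
  have PQ: "P \<bullet> Q = 2 * ((A ** P) \<bullet> d)"
  proof -
    have tP: "transpose P = P" by (simp add: P_def matrix_transpose_mul)
    have "P \<bullet> (transpose d ** A) = P \<bullet> (transpose A ** d)"
      using inner_transpose[of P "transpose A ** d"] tP by (simp add: matrix_transpose_mul)
    then have "P \<bullet> Q = 2 * (P \<bullet> (transpose A ** d))" by (simp add: Q_def inner_add)
    then show ?thesis by (simp add: inner_matrix_mult_left)
  qed
  have wB: "w 1 = B" by (simp add: w_def d_def)
  have "(norm (transpose B ** B))\<^sup>2 / 4 - (norm P)\<^sup>2 / 4 \<le> (A ** P) \<bullet> d + 3/2 * a"
    using main gw[of 1] PQ unfolding wB by (simp add: \<phi>_def \<phi>1_def power2_norm_eq_inner)
  moreover have "(norm B)\<^sup>2 = (norm A)\<^sup>2 + 2 * (A \<bullet> d) + (norm d)\<^sup>2"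
    by (simp add: d_def power2_norm_eq_inner inner_diff inner_commute)
  moreover have "3/2 * a \<le> (\<kappa> + 1) / 2 * (norm d)\<^sup>2"
    using k unfolding a_def m_def by (simp add: mult_right_mono divide_right_mono flip: mult.assoc)
  ultimately show ?thesis
    unfolding ac_F_trace ac_f_gram P_def[symmetric] d_def[symmetric] inner_diff_left
    by (simp add: field_simps)
qed

section \<open>Integrals depending on a parameter\<close>

lemma tendsto_integral_dominated:
  fixes f :: "'p::first_countable_topology \<Rightarrow> 'y \<Rightarrow> 'b::{banach, second_countable_topology}"
  assumes meas: "\<And>p. p \<in> S \<Longrightarrow> p \<noteq> p0 \<Longrightarrow> f p \<in> borel_measurable M" "g \<in> borel_measurable M"
    and B: "integrable M B"
    and lim: "\<And>y. y \<in> space M \<Longrightarrow> ((\<lambda>p. f p y) \<longlongrightarrow> g y) (at p0 within S)"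
    and bound: "\<And>p y. p \<in> S \<Longrightarrow> p \<noteq> p0 \<Longrightarrow> y \<in> space M \<Longrightarrow> norm (f p y) \<le> B y"
  shows "((\<lambda>p. LINT y|M. f p y) \<longlongrightarrow> (LINT y|M. g y)) (at p0 within S)"
  unfolding tendsto_at_iff_sequentially comp_def
proof (intro allI impI)
  fix X :: "nat \<Rightarrow> 'p" assume X: "\<forall>i. X i \<in> S - {p0}" "X \<longlonglongrightarrow> p0"
  show "(\<lambda>i. LINT y|M. f (X i) y) \<longlonglongrightarrow> (LINT y|M. g y)"
  proof (rule integral_dominated_convergence[where w = B])
    show "AE y in M. (\<lambda>i. f (X i) y) \<longlonglongrightarrow> g y"
      using lim X unfolding tendsto_at_iff_sequentially comp_def by (intro AE_I2) blast
    show "AE y in M. norm (f (X i) y) \<le> B y" for i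
      using bound X by (intro AE_I2) auto
  qed (use meas B X in auto)
qed

lemma continuous_on_integral_dominated:
  fixes f :: "'p::first_countable_topology \<Rightarrow> 'y \<Rightarrow> 'b::{banach, second_countable_topology}"
  assumes meas: "\<And>p. p \<in> S \<Longrightarrow> f p \<in> borel_measurable M"
    and B: "integrable M B"
    and cont: "\<And>y. y \<in> space M \<Longrightarrow> continuous_on S (\<lambda>p. f p y)"
    and bound: "\<And>p y. p \<in> S \<Longrightarrow> y \<in> space M \<Longrightarrow> norm (f p y) \<le> B y"
  shows "continuous_on S (\<lambda>p. LINT y|M. f p y)"
  unfolding continuous_on_def
proof
  fix p0 assume "p0 \<in> S"
  then show "((\<lambda>p. LINT y|M. f p y) \<longlongrightarrow> (LINT y|M. f p0 y)) (at p0 within S)"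
    using assms by (intro tendsto_integral_dominated[where B = B]) (auto simp: continuous_on_def)
qed

text \<open>
  The mean value theorem bounds the difference quotients by \<open>B\<close> and the linear part by \<open>B\<close> as well, so the remainder
  of first order, divided by the increment, is dominated by \<open>2 B\<close> and converges pointwise to zero.
\<close>

lemma has_derivative_integral_dominated:
  fixes f :: "'p::real_normed_vector \<Rightarrow> 'y \<Rightarrow> 'b::{banach, second_countable_topology}"
  assumes r: "0 < r"
    and int: "\<And>p. p \<in> ball p0 r \<Longrightarrow> integrable M (f p)"
    and der: "\<And>p y. p \<in> ball p0 r \<Longrightarrow> y \<in> space M \<Longrightarrow> ((\<lambda>p. f p y) has_derivative f' p y) (at p)"
    and meas: "\<And>h. (\<lambda>y. f' p0 y h) \<in> borel_measurable M"
    and B: "integrable M B"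
    and bound: "\<And>p y h. p \<in> ball p0 r \<Longrightarrow> y \<in> space M \<Longrightarrow> norm (f' p y h) \<le> B y * norm h"
  shows "((\<lambda>p. LINT y|M. f p y) has_derivative (\<lambda>h. LINT y|M. f' p0 y h)) (at p0)"
proof -
  have p0: "p0 \<in> ball p0 r" using r by simp
  have int': "integrable M (\<lambda>y. f' p0 y h)" for h
    using B[THEN integrable_mult_left, of "norm h"]
    by (rule lb_integrable_bound) (use meas bound[OF p0] in \<open>auto intro!: AE_I2 order_trans[OF _ abs_ge_self]\<close>)
  have lin: "linear (f' p0 y)" if "y \<in> space M" for y
    using der[OF p0 that] by (rule has_derivative_linear)
  have B0: "0 \<le> B y" if "y \<in> space M" "(h::'p) \<noteq> 0" for y h
    using order_trans[OF norm_ge_zero bound[OF p0 that(1), of h]] that(2) by (simp add: zero_le_mult_iff)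
  show ?thesis unfolding has_derivative_at_within
  proof (intro conjI)
    show "bounded_linear (\<lambda>h. LINT y|M. f' p0 y h)"
    proof (rule bounded_linear_intro)
      show "(LINT y|M. f' p0 y (a + b)) = (LINT y|M. f' p0 y a) + (LINT y|M. f' p0 y b)" for a b
      proof -
        have "(LINT y|M. f' p0 y (a + b)) = (LINT y|M. f' p0 y a + f' p0 y b)"
          by (rule lb_integral_cong[OF refl]) (rule linear_add[OF lin])
        then show ?thesis by (simp add: int')
      qed
      show "(LINT y|M. f' p0 y (c *\<^sub>R a)) = c *\<^sub>R (LINT y|M. f' p0 y a)" for a c
      proof -
        have "(LINT y|M. f' p0 y (c *\<^sub>R a)) = (LINT y|M. c *\<^sub>R f' p0 y a)"
          by (rule lb_integral_cong[OF refl]) (rule linear_scale[OF lin])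
        then show ?thesis by simp
      qed
      show "norm (LINT y|M. f' p0 y a) \<le> norm a * (LINT y|M. B y)" for a
      proof -
        have "norm (LINT y|M. f' p0 y a) \<le> (LINT y|M. B y * norm a)"
          by (intro order_trans[OF Bochner_Integration.integral_norm_bound] Bochner_Integration.integral_mono)
            (use int' B bound[OF p0] in auto)
        then show ?thesis by (simp add: mult.commute)
      qed
    qed
    have "((\<lambda>p. LINT y|M. (f p y - f p0 y - f' p0 y (p - p0)) /\<^sub>R norm (p - p0)) \<longlongrightarrow> (LINT y|M. 0))
        (at p0 within ball p0 r)"
    proof (rule tendsto_integral_dominated[where B = "\<lambda>y. 2 * B y"])
      fix y assume y: "y \<in> space M"
      show "((\<lambda>p. (f p y - f p0 y - f' p0 y (p - p0)) /\<^sub>R norm (p - p0)) \<longlongrightarrow> 0) (at p0 within ball p0 r)"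
        using has_derivative_at_withinI[OF der[OF p0 y]] unfolding has_derivative_at_within by auto
    next
      fix p y assume p: "p \<in> ball p0 r" "p \<noteq> p0" and y: "y \<in> space M"
      have "norm (f p y - f p0 y) \<le> B y * norm (p - p0)"
      proof (rule differentiable_bound[where S = "ball p0 r" and f' = "\<lambda>p. f' p y"])
        show "onorm (f' q y) \<le> B y" if "q \<in> ball p0 r" for q
          using bound[OF that y] that p y B0[OF y, of "p - p0"]
          by (intro onorm_bound) (auto simp: mult.commute)
      qed (use p p0 y der in \<open>auto intro: has_derivative_at_withinI\<close>)
      moreover have "norm (f' p0 y (p - p0)) \<le> B y * norm (p - p0)"
        using bound[OF p0 y] .
      ultimately have "norm (f p y - f p0 y - f' p0 y (p - p0)) \<le> 2 * B y * norm (p - p0)"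
        using norm_triangle_ineq4[of "f p y - f p0 y" "f' p0 y (p - p0)"] by linarith
      then show "norm ((f p y - f p0 y - f' p0 y (p - p0)) /\<^sub>R norm (p - p0)) \<le> 2 * B y"
        using p unfolding norm_scaleR by (simp add: divide_simps)
    next
      fix p assume p: "p \<in> ball p0 r"
      have [measurable]: "f p \<in> borel_measurable M" "f p0 \<in> borel_measurable M"
          "(\<lambda>y. f' p0 y (p - p0)) \<in> borel_measurable M"
        using int[OF p] int[OF p0] meas by (auto dest: borel_measurable_integrable)
      show "(\<lambda>y. (f p y - f p0 y - f' p0 y (p - p0)) /\<^sub>R norm (p - p0)) \<in> borel_measurable M"
        by measurable
    next
      show "integrable M (\<lambda>y. 2 * B y)" by (rule integrable_mult_right[OF B])
      show "(\<lambda>y. 0) \<in> borel_measurable M" by (rule borel_measurable_const)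
    qed
    moreover have "at p0 within ball p0 r = at p0" by (rule at_within_open[OF p0]) simp
    ultimately have lim: "((\<lambda>p. LINT y|M. (f p y - f p0 y - f' p0 y (p - p0)) /\<^sub>R norm (p - p0)) \<longlongrightarrow> 0) (at p0)"
      by simp
    have "\<forall>\<^sub>F p in at p0. p \<in> ball p0 r"
      using r by (intro eventually_at_in_open') auto
    then have "\<forall>\<^sub>F p in at p0. (LINT y|M. (f p y - f p0 y - f' p0 y (p - p0)) /\<^sub>R norm (p - p0))
        = ((LINT y|M. f p y) - (LINT y|M. f p0 y) - (LINT y|M. f' p0 y (p - p0))) /\<^sub>R norm (p - p0)"
      by eventually_elim (use int int' p0 in simp)
    with lim show "((\<lambda>p. ((LINT y|M. f p y) - (LINT y|M. f p0 y) - (LINT y|M. f' p0 y (p - p0))) /\<^sub>R norm (p - p0))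
        \<longlongrightarrow> 0) (at p0)"
      by (rule Lim_transform_eventually)
  qed
qed

section \<open>Continuous periodic fields\<close>

text \<open>
  Periodicity is restated for arbitrary value types, since it is also needed for entries, directional derivatives and
  pairings.
\<close>

definition torus_cont :: "(real^'m::finite \<Rightarrow> 'b::topological_space) \<Rightarrow> bool" where
  "torus_cont u \<longleftrightarrow> continuous_on UNIV u \<and> (\<forall>x k. u (x + axis k 1) = u x)"

lemma torus_contD: "torus_cont u \<Longrightarrow> continuous_on S u" "torus_cont u \<Longrightarrow> u (x + axis k 1) = u x"
  unfolding torus_cont_def by (auto intro: continuous_on_subset)

lemma torus_cont_compose:
  "torus_cont u \<Longrightarrow> continuous_on UNIV g \<Longrightarrow> torus_cont (\<lambda>x. g (u x))"
  unfolding torus_cont_def by (auto intro: continuous_on_compose2)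

lemma torus_cont_intros:
  fixes u v :: "real^'m::finite \<Rightarrow> 'b::real_normed_vector"
  shows "torus_cont (\<lambda>x. c :: 'b)"
    and "torus_cont u \<Longrightarrow> torus_cont v \<Longrightarrow> torus_cont (\<lambda>x. u x + v x)"
    and "torus_cont u \<Longrightarrow> torus_cont v \<Longrightarrow> torus_cont (\<lambda>x. u x - v x)"
    and "torus_cont u \<Longrightarrow> torus_cont (\<lambda>x. r *\<^sub>R u x)"
  unfolding torus_cont_def by (auto intro!: continuous_intros)

lemma torus_cont_inner:
  fixes u v :: "real^'m::finite \<Rightarrow> 'b::real_inner"
  shows "torus_cont u \<Longrightarrow> torus_cont v \<Longrightarrow> torus_cont (\<lambda>x. u x \<bullet> v x)"
  unfolding torus_cont_def by (auto intro!: continuous_intros)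

lemma torus_cont_shift:
  fixes u :: "real^'m::finite \<Rightarrow> 'b::topological_space"
  assumes "torus_cont u" shows "torus_cont (\<lambda>x. u (x + z))"
proof -
  have "continuous_on UNIV (\<lambda>x. u (x + z))"
    by (rule continuous_on_compose2[OF torus_contD(1)[OF assms, of UNIV]]) (auto intro!: continuous_intros)
  moreover have "u (x + axis k 1 + z) = u (x + z)" for x k
    using torus_contD(2)[OF assms, of "x + z" k] by (simp add: add_ac)
  ultimately show ?thesis by (simp add: torus_cont_def)
qed

lemma periodic_int_shift:
  fixes u :: "real^'m::finite \<Rightarrow> 'b"
  assumes per: "\<And>x k. u (x + axis k 1) = u x"
  shows "u (x + of_int n *\<^sub>R axis k 1) = u x"
proof (induction n arbitrary: x rule: int_induct[of _ 0])
  case (step1 i)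
  then show ?case using per[of "x + of_int i *\<^sub>R axis k 1" k] by (simp add: algebra_simps)
next
  case (step2 i)
  then show ?case using per[of "x + of_int (i - 1) *\<^sub>R axis k 1" k] by (simp add: algebra_simps)
qed simp

text \<open>
  The representative \<open>y\<close> depends on \<open>x\<close> only and serves all periodic functions at once, as the maximum
  principle requires for a family indexed by time.
\<close>

lemma periodic_representative:
  fixes x :: "real^'m::finite"
  obtains y where "y \<in> Omega"
    "\<And>u::real^'m \<Rightarrow> 'b. (\<And>x k. u (x + axis k 1) = u x) \<Longrightarrow> u x = u y"
proof -
  define n where "n k = \<lfloor>x $ k + 1/2\<rfloor>" for k
  define y where "y = x + (\<Sum>k\<in>UNIV. of_int (- n k) *\<^sub>R axis k 1)"
  have y: "y $ i = x $ i - of_int (n i)" for i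
  proof -
    have "(\<Sum>k\<in>UNIV. of_int (- n k) *\<^sub>R axis k 1) $ i = (\<Sum>k\<in>UNIV. if k = i then - of_int (n k) else (0::real))"
      unfolding sum_component by (intro sum.cong refl) (auto simp: axis_def)
    then show ?thesis by (simp add: y_def)
  qed
  have "y \<in> Omega"
    unfolding Omega_def mem_box_cart y n_def by (auto; linarith)
  moreover have "u x = u y" if "\<And>x k. u (x + axis k 1) = u x" for u :: "real^'m \<Rightarrow> 'b"
  proof -
    have "u (x + (\<Sum>k\<in>K. of_int (- n k) *\<^sub>R axis k 1)) = u x" if "finite K" for K
      using that
    proof (induction K rule: finite_induct)
      case (insert k K)
      have "u (x + (\<Sum>k\<in>K. of_int (- n k) *\<^sub>R axis k 1) + of_int (- n k) *\<^sub>R axis k 1)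
          = u (x + (\<Sum>k\<in>K. of_int (- n k) *\<^sub>R axis k 1))"
        by (rule periodic_int_shift[OF \<open>\<And>x k. u (x + axis k 1) = u x\<close>])
      then show ?case using insert by (simp add: add_ac)
    qed simp
    then show ?thesis by (simp add: y_def)
  qed
  ultimately show thesis using that by blast
qed

lemma torus_cont_bounded:
  fixes u :: "real^'m::finite \<Rightarrow> 'b::real_normed_vector"
  assumes "torus_cont u"
  obtains C where "0 \<le> C" "\<And>x. norm (u x) \<le> C"
proof -
  have "compact (u ` Omega)"
    using torus_contD(1)[OF assms] by (intro compact_continuous_image) (auto simp: Omega_def)
  then obtain C where C: "\<And>y. y \<in> Omega \<Longrightarrow> norm (u y) \<le> C"
    by (meson compact_imp_bounded bounded_iff imageI)
  have "norm (u x) \<le> max 0 C" for x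
  proof (rule periodic_representative[of x])
    fix y :: "real^'m" assume y: "y \<in> Omega" "\<And>u::real^'m \<Rightarrow> 'b. (\<And>x k. u (x + axis k 1) = u x) \<Longrightarrow> u x = u y"
    have "u x = u y" by (rule y) (rule torus_contD(2)[OF assms])
    then show ?thesis using C[OF y(1)] by simp
  qed
  then show thesis using that[of "max 0 C"] by auto
qed

lemma Omega_integrable:
  fixes w :: "real^'m::finite \<Rightarrow> 'b::banach"
  shows "torus_cont w \<Longrightarrow> w integrable_on Omega"
  unfolding Omega_def by (rule integrable_continuous, rule torus_contD)

text \<open>
  The hyperplane \<open>x\<^sub>k = 1/2\<close> cuts the shifted cube into a part inside \<open>Omega\<close> and a part outside; translating the
  latter by one period gives precisely the slab of \<open>Omega\<close> that the shift has left.
\<close>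

lemma integral_Omega_shift_axis:
  fixes w :: "real^'m::finite \<Rightarrow> 'b::banach"
  assumes w: "torus_cont w" and h: "0 \<le> h" "h \<le> 1"
  shows "integral Omega (\<lambda>x. w (x + h *\<^sub>R axis k 1)) = integral Omega w"
proof -
  let ?e = "axis k 1 :: real^'m"
  define a :: "real^'m" where "a = (\<chi> i. - 1/2)"
  define b :: "real^'m" where "b = (\<chi> i. 1/2)"
  define b' :: "real^'m" where "b' = (\<chi> i. if i = k then h - 1/2 else 1/2)"
  define a' :: "real^'m" where "a' = (\<chi> i. if i = k then h - 1/2 else - 1/2)"
  have O: "Omega = cbox a b" by (simp add: Omega_def a_def b_def)
  have ek: "?e \<in> Basis" by (rule axis_in_Basis_iff[THEN iffD2]) simp
  have int: "w integrable_on cbox c d" for c d by (rule integrable_continuous, rule torus_contD[OF w])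
  have nth: "?e $ i = (if i = k then 1 else 0)" for i by (simp add: axis_def)
  have ik: "x \<bullet> ?e = x $ k" for x :: "real^'m" by (simp add: inner_axis)
  have mb: "x \<in> cbox c d \<longleftrightarrow> (c $ k \<le> x $ k \<and> x $ k \<le> d $ k) \<and> (\<forall>i. i \<noteq> k \<longrightarrow> c $ i \<le> x $ i \<and> x $ i \<le> d $ i)"
    for x c d :: "real^'m" unfolding mem_box_cart by (metis (full_types))
  have s1: "integral (cbox a b) w = integral (cbox a b') w + integral (cbox a' b) w"
  proof -
    have "cbox a b \<inter> {x. x \<bullet> ?e \<le> h - 1/2} = cbox a b'"
      using h by (auto simp: mb ik a_def b_def b'_def)
    moreover have "cbox a b \<inter> {x. x \<bullet> ?e \<ge> h - 1/2} = cbox a' b"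
      using h by (auto simp: mb ik a_def b_def a'_def)
    ultimately show ?thesis using integral_split[OF int ek, of a b "h - 1/2"] by simp
  qed
  have s2: "integral (cbox (a + h *\<^sub>R ?e) (b + h *\<^sub>R ?e)) w = integral (cbox a' b) w + integral (cbox (a + ?e) (b' + ?e)) w"
  proof -
    have "cbox (a + h *\<^sub>R ?e) (b + h *\<^sub>R ?e) \<inter> {x. x \<bullet> ?e \<le> 1/2} = cbox a' b"
      using h by (auto simp: mb ik a_def b_def a'_def nth)
    moreover have "cbox (a + h *\<^sub>R ?e) (b + h *\<^sub>R ?e) \<inter> {x. x \<bullet> ?e \<ge> 1/2} = cbox (a + ?e) (b' + ?e)"
      using h by (auto simp: mb ik a_def b_def b'_def nth)
    ultimately show ?thesis using integral_split[OF int ek, of "a + h *\<^sub>R ?e" "b + h *\<^sub>R ?e" "1/2"] by simp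
  qed
  have "integral (cbox (a + ?e) (b' + ?e)) w = integral (cbox a b') (\<lambda>x. w (x + ?e))"
    using integral_shift_cbox[of "a + ?e" ?e "b' + ?e" w] by simp
  also have "\<dots> = integral (cbox a b') w" using torus_contD(2)[OF w] by simp
  finally have s3: "integral (cbox (a + ?e) (b' + ?e)) w = integral (cbox a b') w" .
  have "integral Omega (\<lambda>x. w (x + h *\<^sub>R ?e)) = integral (cbox (a + h *\<^sub>R ?e) (b + h *\<^sub>R ?e)) w"
    using integral_shift_cbox[of "a + h *\<^sub>R ?e" "h *\<^sub>R ?e" "b + h *\<^sub>R ?e" w] by (simp add: O)
  then show ?thesis using s1 s2 s3 by (simp add: O add.commute)
qed

lemma integral_Omega_shift:
  fixes w :: "real^'m::finite \<Rightarrow> 'b::banach"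
  assumes w: "torus_cont w"
  shows "integral Omega (\<lambda>x. w (x + z)) = integral Omega w"
proof -
  have one: "integral Omega (\<lambda>x. v (x + t *\<^sub>R axis k 1)) = integral Omega v"
    if v: "torus_cont v" for v :: "real^'m \<Rightarrow> 'b" and t k
  proof -
    have "v (x + t *\<^sub>R axis k 1) = v (x + frac t *\<^sub>R axis k 1)" for x
      using periodic_int_shift[of v "x + frac t *\<^sub>R axis k 1" "\<lfloor>t\<rfloor>" k, OF torus_contD(2)[OF v]]
      by (simp add: frac_def algebra_simps)
    then show ?thesis
      using integral_Omega_shift_axis[OF v, of "frac t" k] by (simp add: frac_lt_1 less_imp_le)
  qed
  have "integral Omega (\<lambda>x. w (x + (\<Sum>k\<in>K. z $ k *\<^sub>R axis k 1))) = integral Omega w" if "finite K" for K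
    using that
  proof (induction K rule: finite_induct)
    case (insert k K)
    have "integral Omega (\<lambda>x. w (x + z $ k *\<^sub>R axis k 1 + (\<Sum>k\<in>K. z $ k *\<^sub>R axis k 1)))
        = integral Omega (\<lambda>x. w (x + (\<Sum>k\<in>K. z $ k *\<^sub>R axis k 1)))"
      by (rule one[OF torus_cont_shift[OF w]])
    then show ?case using insert by (simp add: add_ac)
  qed simp
  moreover have "(\<Sum>k\<in>UNIV. z $ k *\<^sub>R axis k 1) = z"
    using basis_expansion[of z] by (simp add: scalar_mult_eq_scaleR)
  ultimately show ?thesis by (metis finite)
qed

section \<open>Convolution with Gaussian kernels\<close>

text \<open>
  Abbreviations, so that the exponentials stay visible to the simplifier.
\<close>

abbreviation gauss :: "real \<Rightarrow> 'a::real_normed_vector \<Rightarrow> real" where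
  "gauss a z \<equiv> exp (- a * (norm z)\<^sup>2)"

abbreviation weight_gauss :: "real \<Rightarrow> 'a::real_normed_vector \<Rightarrow> real" where
  "weight_gauss a z \<equiv> (1 + (norm z)\<^sup>2) * gauss a z"

lemma integrable_gauss_real: "integrable lborel (\<lambda>x::real. exp (- a * x\<^sup>2))" if a: "0 < a"
proof -
  define s where "s = sqrt (1 / (2 * a))"
  have s: "0 < s" "s\<^sup>2 = 1 / (2 * a)" using a by (auto simp: s_def)
  have "integrable lborel (\<lambda>x. sqrt (2 * pi * s\<^sup>2) * normal_density 0 s x)"
    by (intro integrable_mult_right integrable_normal_density s)
  moreover have "sqrt (2 * pi * s\<^sup>2) * normal_density 0 s x = exp (- a * x\<^sup>2)" for x
    using a s by (simp add: normal_density_def real_sqrt_eq_zero_cancel_iff)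
  ultimately show ?thesis by simp
qed

lemma integrable_gauss:
  "integrable lborel (\<lambda>z::'a::euclidean_space. gauss a z)" if a: "0 < a"
proof -
  interpret product_sigma_finite "\<lambda>_::'a. lborel :: real measure" by standard
  have "integrable (Pi\<^sub>M Basis (\<lambda>_::'a. lborel)) (\<lambda>x. \<Prod>b\<in>Basis. exp (- a * (x b)\<^sup>2))"
    by (rule product_integrable_prod) (use integrable_gauss_real[OF a] in auto)
  moreover have "(\<Prod>b\<in>Basis. exp (- a * (x b)\<^sup>2)) = gauss a (\<Sum>b\<in>Basis. x b *\<^sub>R b :: 'a)" for x
  proof -
    have "(norm (\<Sum>b\<in>Basis. x b *\<^sub>R b :: 'a))\<^sup>2 = (\<Sum>b\<in>Basis. (x b)\<^sup>2)"
      unfolding power2_norm_eq_inner by (subst euclidean_inner) (simp add: power2_eq_square)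
    then show ?thesis by (simp add: exp_sum[symmetric] sum_distrib_left)
  qed
  ultimately show ?thesis
    by (subst lborel_eq) (simp add: integrable_distr_eq)
qed

lemma integrable_lborel_shift:
  fixes f :: "'a::euclidean_space \<Rightarrow> 'b::{banach, second_countable_topology}"
  assumes f: "integrable lborel f" shows "integrable lborel (\<lambda>y. f (y - x))"
proof -
  have "integrable (distr lborel borel ((+) (- x))) f" using f by (simp add: lborel_distr_plus)
  then have "integrable lborel (\<lambda>y. f (- x + y))"
    by (subst (asm) integrable_distr_eq) (use borel_measurable_integrable[OF f] in auto)
  then show ?thesis by simp
qed

lemma lborel_integral_shift:
  fixes f :: "'a::euclidean_space \<Rightarrow> 'b::{banach, second_countable_topology}"
  assumes f: "f \<in> borel_measurable borel" shows "(LINT y|lborel. f (y - x)) = (LINT y|lborel. f y)"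
proof -
  have "(LINT y|lborel. f y) = (LINT y|distr lborel borel ((+) (- x)). f y)" by (simp add: lborel_distr_plus)
  also have "\<dots> = (LINT y|lborel. f (- x + y))" using f by (subst integral_distr) auto
  finally show ?thesis by simp
qed

lemma lborel_integral_affine:
  fixes f :: "'a::euclidean_space \<Rightarrow> 'b::{banach, second_countable_topology}"
  assumes [measurable]: "f \<in> borel_measurable borel" and c: "c \<noteq> 0"
  shows "(LINT y|lborel. f y) = \<bar>c\<bar> ^ DIM('a) *\<^sub>R (LINT z|lborel. f (t + c *\<^sub>R z))"
  by (subst lborel_affine[OF c, of t]) (simp add: integral_density integral_distr)

lemma lborel_integral_minus:
  fixes f :: "'a::euclidean_space \<Rightarrow> 'b::{banach, second_countable_topology}"
  assumes "f \<in> borel_measurable borel"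
  shows "(LINT y|lborel. f (- y)) = (LINT y|lborel. f y)"
  using lborel_integral_affine[OF assms, of "-1" 0] by simp

text \<open>
  Half of the exponent pays for the quadratic weight, by \<open>s \<le> exp s\<close>.
\<close>

lemma weight_gauss_le:
  assumes a: "0 < a"
  shows "weight_gauss a z \<le> (1 + 2 / a) * gauss (a / 2) z"
proof -
  let ?u = "a / 2 * (norm z)\<^sup>2"
  have "?u \<le> exp ?u" using exp_ge_add_one_self[of ?u] by linarith
  then have "(norm z)\<^sup>2 \<le> 2 / a * exp ?u" using a by (simp add: field_simps)
  moreover have "1 \<le> exp ?u" using a by simp
  ultimately have "1 + (norm z)\<^sup>2 \<le> (1 + 2 / a) * exp ?u" unfolding distrib_right mult_1 by linarith
  then have "weight_gauss a z \<le> ((1 + 2 / a) * exp ?u) * gauss a z"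
    by (rule mult_right_mono) simp
  also have "\<dots> = (1 + 2 / a) * gauss (a / 2) z"
    by (simp add: mult.assoc flip: exp_add)
  finally show ?thesis .
qed

lemma integrable_weight_gauss:
  "integrable lborel (\<lambda>z::'a::euclidean_space. weight_gauss a z)" if a: "0 < a"
proof (rule lb_integrable_bound)
  show "integrable lborel (\<lambda>z::'a. (1 + 2 / a) * gauss (a / 2) z)"
    using a by (intro integrable_mult_right integrable_gauss) simp
  show "AE z::'a in lborel. norm (weight_gauss a z)
      \<le> norm ((1 + 2 / a) * gauss (a / 2) z)"
  proof (rule AE_I2)
    fix z :: 'a
    have "0 \<le> weight_gauss a z" by simp
    then show "norm (weight_gauss a z)
      \<le> norm ((1 + 2 / a) * gauss (a / 2) z)"
      using weight_gauss_le[OF a, of z] unfolding real_norm_def by linarith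
  qed
qed simp

text \<open>
  Since \<open>\<bar>y - x0\<bar>\<^sup>2 \<le> 2 \<bar>y - x\<bar>\<^sup>2 + 2\<close> for \<open>\<bar>x - x0\<bar> < 1\<close>, one integrable function of \<open>y\<close>
  dominates the kernels centred at all these points \<open>x\<close>.
\<close>

lemma weight_gauss_translate_le:
  assumes a: "0 < a" and x: "dist x0 x < 1"
  shows "weight_gauss a (y - x)
    \<le> (1 + 2 / a) * exp (a / 2) * gauss (a / 4) (y - x0)"
proof -
  have "norm (y - x0) \<le> norm (y - x) + 1"
    using x dist_triangle_less_add[of y x "norm (y - x) + 0" x0 1] dist_triangle[of y x0 x]
    by (simp add: dist_norm norm_minus_commute)
  then have "(norm (y - x0))\<^sup>2 \<le> (norm (y - x) + 1)\<^sup>2" by (intro power_mono) auto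
  also have "\<dots> \<le> 2 * (norm (y - x))\<^sup>2 + 2"
    using zero_le_power2[of "norm (y - x) - 1"] by (simp add: power2_eq_square algebra_simps)
  finally have "a / 4 * (norm (y - x0))\<^sup>2 \<le> a / 4 * (2 * (norm (y - x))\<^sup>2 + 2)"
    using a by (intro mult_left_mono) auto
  then have "- (a / 2) * (norm (y - x))\<^sup>2 \<le> a / 2 + - (a / 4) * (norm (y - x0))\<^sup>2"
    by (simp add: algebra_simps)
  then have "gauss (a / 2) (y - x) \<le> exp (a / 2) * gauss (a / 4) (y - x0)"
    unfolding exp_add[symmetric] by (simp only: exp_le_cancel_iff)
  then have "(1 + 2 / a) * gauss (a / 2) (y - x)
      \<le> (1 + 2 / a) * (exp (a / 2) * gauss (a / 4) (y - x0))"
    using a by (intro mult_left_mono) auto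
  then show ?thesis using weight_gauss_le[OF a, of "y - x"] by (simp only: mult.assoc)
qed

text \<open>
  This decay class contains the Gaussian and its products with polynomials of degree at most two, hence all
  kernels that occur when the heat equation is verified.
\<close>

definition gauss_dominated :: "real \<Rightarrow> real \<Rightarrow> ('a::euclidean_space \<Rightarrow> real) \<Rightarrow> bool" where
  "gauss_dominated a C K \<longleftrightarrow> continuous_on UNIV K \<and>
     (\<forall>z. \<bar>K z\<bar> \<le> C * (weight_gauss a z))"

lemma gauss_dominated_integrable:
  fixes K :: "'a::euclidean_space \<Rightarrow> real"
  assumes K: "gauss_dominated a C K" and a: "0 < a"
    and v: "continuous_on UNIV v" "\<And>y. \<bar>v y\<bar> \<le> B"
  shows "integrable lborel (\<lambda>y. K (y - x) * v y)"
proof (rule lb_integrable_bound)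
  show "integrable lborel (\<lambda>y. C * (weight_gauss a (y - x)) * B)"
    using integrable_lborel_shift[OF integrable_weight_gauss[OF a], of x]
    by (intro integrable_mult_left integrable_mult_right) auto
  have "continuous_on UNIV (\<lambda>y. K (y - x) * v y)"
    using K v by (auto simp: gauss_dominated_def intro!: continuous_intros continuous_on_compose2[of UNIV K])
  then show "(\<lambda>y. K (y - x) * v y) \<in> borel_measurable lborel"
    by (simp add: borel_measurable_continuous_onI)
  show "AE y in lborel. norm (K (y - x) * v y) \<le> norm (C * (weight_gauss a (y - x)) * B)"
  proof (rule AE_I2)
    fix y
    have "\<bar>K (y - x)\<bar> * \<bar>v y\<bar> \<le> C * (weight_gauss a (y - x)) * B"
      using K v(2)[of y] unfolding gauss_dominated_def
      by (intro mult_mono) (auto intro: order_trans[OF abs_ge_zero])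
    then show "norm (K (y - x) * v y) \<le> norm (C * (weight_gauss a (y - x)) * B)"
      unfolding real_norm_def abs_mult[of "K (y - x)"] by (rule order_trans[OF _ abs_ge_self])
  qed
qed

lemma gauss_dominated_nonneg: "gauss_dominated a C K \<Longrightarrow> 0 \<le> C"
proof -
  assume "gauss_dominated a C K"
  then have "\<bar>K 0\<bar> \<le> C * 1" unfolding gauss_dominated_def by (metis (no_types, lifting) add.right_neutral exp_zero mult.right_neutral mult_zero_right norm_zero power2_eq_square)
  then show ?thesis by simp
qed

lemma gauss_convolution_continuous:
  fixes K :: "'a::euclidean_space \<Rightarrow> real"
  assumes K: "gauss_dominated a C K" and a: "0 < a"
    and v: "continuous_on UNIV v" "\<And>y. \<bar>v y\<bar> \<le> B"
  shows "continuous_on UNIV (\<lambda>x. LINT y|lborel. K (y - x) * v y)"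
proof -
  have "isCont (\<lambda>x. LINT y|lborel. K (y - x) * v y) x0" for x0
  proof -
    have "continuous_on (ball x0 1) (\<lambda>x. LINT y|lborel. K (y - x) * v y)"
    proof (rule continuous_on_integral_dominated)
      show "integrable lborel (\<lambda>y. C * ((1 + 2 / a) * exp (a / 2) * gauss (a / 4) (y - x0)) * B)"
        using integrable_lborel_shift[OF integrable_gauss[of "a / 4"], of x0] a
        by (intro integrable_mult_left integrable_mult_right) auto
      show "continuous_on (ball x0 1) (\<lambda>x. K (y - x) * v y)" for y
      proof -
        have Kc: "continuous_on UNIV K" using K by (simp add: gauss_dominated_def)
        have "continuous_on (ball x0 1) (\<lambda>x. K (y - x))"
          by (rule continuous_on_compose2[OF Kc]) (auto intro!: continuous_intros)
        then show ?thesis by (intro continuous_on_mult continuous_on_const)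
      qed
      fix x y assume x: "x \<in> ball x0 1"
      have "\<bar>K (y - x)\<bar> \<le> C * (weight_gauss a (y - x))"
        using K unfolding gauss_dominated_def by blast
      also have "\<dots> \<le> C * ((1 + 2 / a) * exp (a / 2) * gauss (a / 4) (y - x0))"
        using x gauss_dominated_nonneg[OF K] by (intro mult_left_mono weight_gauss_translate_le a) auto
      finally show "norm (K (y - x) * v y) \<le> C * ((1 + 2 / a) * exp (a / 2) * gauss (a / 4) (y - x0)) * B"
        unfolding real_norm_def abs_mult by (intro mult_mono) (use v in auto)
    qed (rule borel_measurable_integrable[OF gauss_dominated_integrable[OF K a v]])
    then show ?thesis by (simp add: continuous_on_eq_continuous_at)
  qed
  then show ?thesis by (simp add: continuous_at_imp_continuous_on)
qed

lemma gauss_convolution_has_derivative: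
  fixes K :: "'a::euclidean_space \<Rightarrow> real"
  assumes K: "gauss_dominated a C K" and a: "0 < a"
    and der: "\<And>z. (K has_derivative K' z) (at z)"
    and cont: "\<And>h. continuous_on UNIV (\<lambda>z. K' z h)"
    and K': "\<And>z h. \<bar>K' z h\<bar> \<le> C' * (weight_gauss a z) * norm h"
    and v: "continuous_on UNIV v" "\<And>y. \<bar>v y\<bar> \<le> B"
  shows "((\<lambda>x. LINT y|lborel. K (y - x) * v y) has_derivative (\<lambda>h. LINT y|lborel. K' (y - x0) (- h) * v y)) (at x0)"
proof (rule has_derivative_integral_dominated[where r = 1 and f' = "\<lambda>x y h. K' (y - x) (- h) * v y"])
  show "integrable lborel (\<lambda>y. K (y - x) * v y)" for x by (rule gauss_dominated_integrable[OF K a v])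
  show "((\<lambda>x. K (y - x) * v y) has_derivative (\<lambda>h. K' (y - x) (- h) * v y)) (at x)" for x y
  proof (intro has_derivative_mult_left)
    show "((\<lambda>x. K (y - x)) has_derivative (\<lambda>h. K' (y - x) (- h))) (at x)"
      by (rule has_derivative_compose[of "\<lambda>x. y - x" _ x UNIV K]) (auto intro!: derivative_eq_intros der)
  qed
  have "continuous_on UNIV (\<lambda>y. K' (y - x0) (- h) * v y)" for h
    by (intro continuous_intros v continuous_on_compose2[OF cont]) auto
  then show "(\<lambda>y. K' (y - x0) (- h) * v y) \<in> borel_measurable lborel" for h
    by (simp add: borel_measurable_continuous_onI)
  show "integrable lborel (\<lambda>y. \<bar>C'\<bar> * ((1 + 2 / a) * exp (a / 2) * gauss (a / 4) (y - x0)) * B)"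
    using integrable_lborel_shift[OF integrable_gauss[of "a / 4"], of x0] a
    by (intro integrable_mult_left integrable_mult_right) auto
  fix x y h :: 'a assume x: "x \<in> ball x0 1"
  have "\<bar>K' (y - x) (- h)\<bar> \<le> C' * (weight_gauss a (y - x)) * norm h"
    using K'[of "y - x" "- h"] by simp
  also have "\<dots> \<le> \<bar>C'\<bar> * (weight_gauss a (y - x)) * norm h"
    by (intro mult_right_mono) auto
  also have "\<dots> \<le> \<bar>C'\<bar> * ((1 + 2 / a) * exp (a / 2) * gauss (a / 4) (y - x0)) * norm h"
    using x by (intro mult_right_mono mult_left_mono weight_gauss_translate_le a) auto
  finally have "\<bar>K' (y - x) (- h)\<bar> * \<bar>v y\<bar> \<le> (\<bar>C'\<bar> * ((1 + 2 / a) * exp (a / 2) * gauss (a / 4) (y - x0)) * norm h) * B"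
    using v(2)[of y] by (intro mult_mono) auto
  then show "norm (K' (y - x) (- h) * v y) \<le> (\<bar>C'\<bar> * ((1 + 2 / a) * exp (a / 2) * gauss (a / 4) (y - x0)) * B) * norm h"
    unfolding real_norm_def abs_mult by (simp only: mult_ac)
qed simp

lemma norm_le_weight: "norm z \<le> 1 + (norm z)\<^sup>2"
  using zero_le_power2[of "norm z - 1/2"] by (simp add: power2_eq_square algebra_simps)

lemma gauss_dominated_gauss: "gauss_dominated a 1 (\<lambda>z. gauss a z)"
  by (auto simp: gauss_dominated_def intro!: continuous_intros)

lemma gauss_dominated_mult:
  assumes "continuous_on UNIV p" "\<And>z. \<bar>p z\<bar> \<le> C * (1 + (norm z)\<^sup>2)"
  shows "gauss_dominated a C (\<lambda>z. p z * gauss a z)"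
proof -
  have "\<bar>p z * gauss a z\<bar> \<le> C * (weight_gauss a z)" for z
    using mult_right_mono[OF assms(2)[of z], of "gauss a z"] by (simp add: abs_mult mult.assoc)
  then show ?thesis using assms(1) by (auto simp: gauss_dominated_def intro!: continuous_intros)
qed

lemma has_derivative_gauss:
  "((\<lambda>z. gauss a z) has_derivative (\<lambda>h. - 2 * a * (z \<bullet> h) * gauss a z)) (at z)"
  unfolding power2_norm_eq_inner by (rule derivative_eq_intros refl)+ (auto simp: inner_commute algebra_simps)

lemma gauss_convolution_D1:
  fixes v :: "'a::euclidean_space \<Rightarrow> real"
  assumes a: "0 < a" and v: "continuous_on UNIV v" "\<And>y. \<bar>v y\<bar> \<le> B"
  shows "((\<lambda>x. LINT y|lborel. gauss a (y - x) * v y) has_derivative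
      (\<lambda>h. 2 * a * (LINT y|lborel. ((y - x0) \<bullet> h) * gauss a (y - x0) * v y))) (at x0)"
proof -
  have "((\<lambda>x. LINT y|lborel. gauss a (y - x) * v y) has_derivative
      (\<lambda>h. LINT y|lborel. (- 2 * a * ((y - x0) \<bullet> (- h)) * gauss a (y - x0)) * v y)) (at x0)"
  proof (rule gauss_convolution_has_derivative[OF gauss_dominated_gauss a has_derivative_gauss _ _ v, where C' = "2 * a"])
    fix z h :: 'a
    have "\<bar>z \<bullet> h\<bar> \<le> (1 + (norm z)\<^sup>2) * norm h"
      by (rule order_trans[OF Cauchy_Schwarz_ineq2 mult_right_mono[OF norm_le_weight]]) simp
    then have "2 * a * \<bar>z \<bullet> h\<bar> * gauss a z \<le> 2 * a * ((1 + (norm z)\<^sup>2) * norm h) * gauss a z"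
      using a by (intro mult_right_mono mult_left_mono) auto
    moreover have "\<bar>- 2 * a * (z \<bullet> h) * gauss a z\<bar> = 2 * a * \<bar>z \<bullet> h\<bar> * gauss a z"
      using a by (simp add: abs_mult)
    ultimately show "\<bar>- 2 * a * (z \<bullet> h) * gauss a z\<bar> \<le> 2 * a * (weight_gauss a z) * norm h"
      by (simp only: mult_ac)
  qed (auto intro!: continuous_intros)
  then show ?thesis by (simp flip: integral_mult_right_zero add: mult.assoc)
qed

lemma gauss_convolution_D2:
  fixes v :: "'a::euclidean_space \<Rightarrow> real"
  assumes a: "0 < a" and e: "norm e = 1" and v: "continuous_on UNIV v" "\<And>y. \<bar>v y\<bar> \<le> B"
  shows "((\<lambda>x. LINT y|lborel. ((y - x) \<bullet> e) * gauss a (y - x) * v y) has_derivative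
      (\<lambda>h. LINT y|lborel. (2 * a * ((y - x0) \<bullet> h) * ((y - x0) \<bullet> e) - h \<bullet> e) * gauss a (y - x0) * v y)) (at x0)"
    (is ?D)
  and "continuous_on UNIV (\<lambda>x. LINT y|lborel. (2 * a * ((y - x) \<bullet> h) * ((y - x) \<bullet> e) - h \<bullet> e) * gauss a (y - x) * v y)"
    (is ?C)
proof -
  have ie: "\<bar>z \<bullet> e\<bar> \<le> norm z" for z using Cauchy_Schwarz_ineq2[of z e] e by simp
  have bd: "\<bar>2 * a * (z \<bullet> h) * (z \<bullet> e) - h \<bullet> e\<bar> \<le> (1 + 2 * a) * (1 + (norm z)\<^sup>2) * norm h" for z h
  proof -
    have "\<bar>z \<bullet> h\<bar> * \<bar>z \<bullet> e\<bar> \<le> (norm z * norm h) * norm z"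
      by (intro mult_mono Cauchy_Schwarz_ineq2 ie) auto
    then have "2 * a * (\<bar>z \<bullet> h\<bar> * \<bar>z \<bullet> e\<bar>) \<le> 2 * a * ((norm z * norm h) * norm z)"
      using a by (intro mult_left_mono) auto
    moreover have "\<bar>2 * a * (z \<bullet> h) * (z \<bullet> e) - h \<bullet> e\<bar> \<le> 2 * a * (\<bar>z \<bullet> h\<bar> * \<bar>z \<bullet> e\<bar>) + norm h"
      using a ie[of h] by (intro order_trans[OF abs_triangle_ineq4]) (simp add: abs_mult mult.assoc)
    ultimately have "\<bar>2 * a * (z \<bullet> h) * (z \<bullet> e) - h \<bullet> e\<bar> \<le> 2 * a * ((norm z * norm h) * norm z) + norm h" by linarith
    also have "\<dots> \<le> (1 + 2 * a) * (1 + (norm z)\<^sup>2) * norm h"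
      using a by (simp add: power2_eq_square algebra_simps)
    finally show ?thesis .
  qed
  have K: "gauss_dominated a 1 (\<lambda>z::'a. (z \<bullet> e) * gauss a z)"
    by (rule gauss_dominated_mult) (auto intro!: continuous_intros order_trans[OF ie norm_le_weight])
  have "((\<lambda>x. LINT y|lborel. (((y - x) \<bullet> e) * gauss a (y - x)) * v y) has_derivative
      (\<lambda>h. LINT y|lborel. (- (2 * a * ((y - x0) \<bullet> (- h)) * ((y - x0) \<bullet> e) - (- h) \<bullet> e) * gauss a (y - x0)) * v y)) (at x0)"
  proof (rule gauss_convolution_has_derivative[OF K a _ _ _ v, where C' = "1 + 2 * a"
      and K' = "\<lambda>z h. - (2 * a * (z \<bullet> h) * (z \<bullet> e) - h \<bullet> e) * gauss a z"])
    fix z h :: 'a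
    show "((\<lambda>z. (z \<bullet> e) * gauss a z) has_derivative (\<lambda>h. - (2 * a * (z \<bullet> h) * (z \<bullet> e) - h \<bullet> e) * gauss a z)) (at z)"
      by (rule derivative_eq_intros has_derivative_gauss refl)+ (auto simp: algebra_simps)
    show "\<bar>- (2 * a * (z \<bullet> h) * (z \<bullet> e) - h \<bullet> e) * gauss a z\<bar> \<le> (1 + 2 * a) * (weight_gauss a z) * norm h"
      using mult_right_mono[OF bd[of z h] exp_ge_zero[of "- a * (norm z)\<^sup>2"]]
      by (simp only: abs_mult abs_minus_cancel abs_exp_cancel mult_ac)
  qed (auto intro!: continuous_intros)
  then show ?D by (simp add: algebra_simps)
  have "gauss_dominated a ((1 + 2 * a) * norm h) (\<lambda>z::'a. (2 * a * (z \<bullet> h) * (z \<bullet> e) - h \<bullet> e) * gauss a z)"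
    using bd[of _ h] by (intro gauss_dominated_mult) (auto intro!: continuous_intros simp: mult_ac)
  from gauss_convolution_continuous[OF this a v] show ?C by simp
qed

text \<open>
  The convolution of \<open>(z \<bullet> e) exp (-a \<bar>z\<bar>\<^sup>2)\<close> with the constant function \<open>1\<close> does not depend on the point, so
  its derivative, given by \<open>gauss_convolution_D2\<close>, vanishes. This is the moment identity.
\<close>

lemma gauss_second_moment:
  fixes h e :: "'a::euclidean_space"
  assumes a: "0 < a" and e: "norm e = 1"
  shows "(LINT z|lborel. (z \<bullet> h) * (z \<bullet> e) * gauss a z) = (h \<bullet> e) / (2 * a) * (LINT z::'a|lborel. gauss a z)"
    and "integrable lborel (\<lambda>z. (z \<bullet> h) * (z \<bullet> e) * gauss a z)"
proof -
  have ie: "\<bar>z \<bullet> e\<bar> \<le> norm z" for z using Cauchy_Schwarz_ineq2[of z e] e by simp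
  show int: "integrable lborel (\<lambda>z. (z \<bullet> h) * (z \<bullet> e) * gauss a z)"
  proof -
    have "\<bar>(z \<bullet> h) * (z \<bullet> e)\<bar> \<le> norm h * (1 + (norm z)\<^sup>2)" for z
    proof -
      have "\<bar>z \<bullet> h\<bar> * \<bar>z \<bullet> e\<bar> \<le> (norm z * norm h) * norm z"
        by (intro mult_mono Cauchy_Schwarz_ineq2 ie) auto
      also have "\<dots> \<le> norm h * (1 + (norm z)\<^sup>2)" by (simp add: power2_eq_square algebra_simps)
      finally show ?thesis by (simp add: abs_mult)
    qed
    then have "gauss_dominated a (norm h) (\<lambda>z. ((z \<bullet> h) * (z \<bullet> e)) * gauss a z)"
      by (intro gauss_dominated_mult) (auto intro!: continuous_intros)
    from gauss_dominated_integrable[OF this a, of "\<lambda>_. 1" 1 0] show ?thesis by simp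
  qed
  have "(\<lambda>z::'a. (z \<bullet> e) * gauss a z) \<in> borel_measurable borel" by simp
  from lborel_integral_shift[OF this]
  have "((\<lambda>x. LINT y|lborel. ((y - x) \<bullet> e) * gauss a (y - x) * 1) has_derivative (\<lambda>h. 0)) (at 0)"
    by simp
  moreover note gauss_convolution_D2(1)[OF a e, of "\<lambda>_. 1" 1 0]
  ultimately have "(\<lambda>h. 0) = (\<lambda>h. LINT y|lborel. (2 * a * (y \<bullet> h) * (y \<bullet> e) - h \<bullet> e) * gauss a y * 1)"
    by (intro has_derivative_unique) auto
  then have "0 = (LINT y|lborel. (2 * a * (y \<bullet> h) * (y \<bullet> e) - h \<bullet> e) * gauss a y * 1)"
    by (rule fun_cong)
  also have "\<dots> = (LINT y|lborel. 2 * a * ((y \<bullet> h) * (y \<bullet> e) * gauss a y) - (h \<bullet> e) * gauss a y)"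
    by (rule lb_integral_cong) (auto simp: algebra_simps)
  also have "\<dots> = 2 * a * (LINT y|lborel. (y \<bullet> h) * (y \<bullet> e) * gauss a y) - (h \<bullet> e) * (LINT y::'a|lborel. gauss a y)"
    using int integrable_gauss[OF a, where 'a='a] by (subst Bochner_Integration.integral_diff) simp_all
  finally show "(LINT z|lborel. (z \<bullet> h) * (z \<bullet> e) * gauss a z) = (h \<bullet> e) / (2 * a) * (LINT z::'a|lborel. gauss a z)"
    using a by (simp add: field_simps)
qed

lemma gauss_convolution_Da:
  fixes v :: "'a::euclidean_space \<Rightarrow> real"
  assumes a: "0 < a" and v: "continuous_on UNIV v" "\<And>y. \<bar>v y\<bar> \<le> B"
  shows "((\<lambda>a. LINT y|lborel. gauss a (y - x) * v y) has_real_derivative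
      - (LINT y|lborel. (norm (y - x))\<^sup>2 * gauss a (y - x) * v y)) (at a)"
proof -
  have "((\<lambda>a. LINT y|lborel. gauss a (y - x) * v y) has_derivative
      (\<lambda>h. LINT y|lborel. h * (- ((norm (y - x))\<^sup>2 * gauss a (y - x) * v y)))) (at a)"
  proof (rule has_derivative_integral_dominated[where r = "a / 2"
        and f' = "\<lambda>a y h. h * (- ((norm (y - x))\<^sup>2 * gauss a (y - x) * v y))"])
    have vm: "v \<in> borel_measurable borel" using v(1) by (rule borel_measurable_continuous_onI)
    show "integrable lborel (\<lambda>y. gauss b (y - x) * v y)" if "b \<in> ball a (a / 2)" for b
    proof -
      have "0 < b" using that a by (auto simp: dist_real_def abs_if split: if_splits)
      then show ?thesis using gauss_dominated_integrable[OF gauss_dominated_gauss _ v, of b x] by simp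
    qed
    show "((\<lambda>b. gauss b (y - x) * v y) has_derivative (\<lambda>h. h * (- ((norm (y - x))\<^sup>2 * gauss b (y - x) * v y)))) (at b)" for b y
      by (rule derivative_eq_intros refl)+ (auto simp: algebra_simps)
    show "(\<lambda>y. h * (- ((norm (y - x))\<^sup>2 * gauss a (y - x) * v y))) \<in> borel_measurable lborel" for h
      using vm by simp
    show "integrable lborel (\<lambda>y. weight_gauss (a / 2) (y - x) * B)"
      using integrable_lborel_shift[OF integrable_weight_gauss[of "a / 2"], of x] a by (intro integrable_mult_left) auto
    fix b y h assume b: "b \<in> ball a (a / 2)"
    have "a / 2 \<le> b" using b by (auto simp: dist_real_def abs_if split: if_splits)
    then have "gauss b (y - x) \<le> gauss (a / 2) (y - x)"
      using mult_right_mono[of "a / 2" b "(norm (y - x))\<^sup>2"] by simp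
    then have "(norm (y - x))\<^sup>2 * gauss b (y - x) * \<bar>v y\<bar>
        \<le> weight_gauss (a / 2) (y - x) * B"
      using v(2)[of y] by (intro mult_mono) auto
    then have "((norm (y - x))\<^sup>2 * gauss b (y - x) * \<bar>v y\<bar>) * \<bar>h\<bar>
        \<le> (weight_gauss (a / 2) (y - x) * B) * \<bar>h\<bar>"
      by (rule mult_right_mono) simp
    then show "norm (h * (- ((norm (y - x))\<^sup>2 * gauss b (y - x) * v y)))
        \<le> (weight_gauss (a / 2) (y - x) * B) * norm h"
      by (simp add: abs_mult mult_ac)
  qed (use a in simp)
  then show ?thesis unfolding has_field_derivative_def
    by (rule has_derivative_eq_rhs) (simp add: fun_eq_iff)
qed

section \<open>Gaussian averages\<close>

text \<open>
  The variance is \<open>2\<close> in each direction, which makes \<open>gauss_avg (sqrt t)\<close> the solution operator of \<open>u\<^sub>t = \<Delta>u\<close>.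
\<close>

definition std_gauss :: "'a::euclidean_space \<Rightarrow> real" where
  "std_gauss z = gauss (1/4) z / (LINT y::'a|lborel. gauss (1/4) y)"

lemma gauss_mass_pos: "0 < (LINT y::'a::euclidean_space|lborel. gauss (1/4) y)"
proof -
  have int: "integrable lborel (\<lambda>y::'a. gauss (1/4) y)" by (rule integrable_gauss) simp
  have "(LINT y::'a|lborel. gauss (1/4) y) \<noteq> 0"
  proof
    assume "(LINT y::'a|lborel. gauss (1/4) y) = 0"
    then have "AE y::'a in lborel. gauss (1/4) y = 0"
      by (subst (asm) integral_nonneg_eq_0_iff_AE[OF int]) auto
    then have "AE y::'a in lborel. False" by simp
    moreover have "(AE y::'a in lborel. False) \<longleftrightarrow> {y \<in> space lborel. \<not> False} \<in> null_sets (lborel :: 'a measure)"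
      by (rule AE_iff_null) simp
    ultimately have "emeasure lborel (UNIV :: 'a set) = 0" by (simp add: null_sets_def)
    then show False by (simp add: emeasure_lborel_UNIV)
  qed
  moreover have "0 \<le> (LINT y::'a|lborel. gauss (1/4) y)" by simp
  ultimately show ?thesis by linarith
qed

lemma std_gauss_nonneg [simp]: "0 \<le> std_gauss z"
  using gauss_mass_pos by (simp add: std_gauss_def less_imp_le)

lemma std_gauss_minus [simp]: "std_gauss (- z) = std_gauss z" by (simp add: std_gauss_def)

lemma std_gauss_continuous [continuous_intros]: "continuous_on S std_gauss"
  unfolding std_gauss_def using gauss_mass_pos[where 'a='a] by (intro continuous_intros) auto

lemma std_gauss_measurable [measurable]: "std_gauss \<in> borel_measurable borel"
  by (rule borel_measurable_continuous_onI[OF std_gauss_continuous])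

lemma std_gauss_integrable: "integrable lborel std_gauss"
  unfolding std_gauss_def by (intro integrable_divide integrable_gauss) simp

lemma std_gauss_integral: "(LINT z|lborel. std_gauss (z::'a::euclidean_space)) = 1"
  unfolding std_gauss_def using gauss_mass_pos[where 'a='a] by simp

lemma std_gauss_second_moment:
  fixes h e :: "'a::euclidean_space"
  assumes "norm e = 1"
  shows "(LINT z|lborel. std_gauss z * ((z \<bullet> h) * (z \<bullet> e))) = 2 * (h \<bullet> e)"
    and "integrable lborel (\<lambda>z. std_gauss z * ((z \<bullet> h) * (z \<bullet> e)))"
proof -
  let ?Z = "LINT y::'a|lborel. gauss (1/4) y"
  have eq: "std_gauss z * ((z \<bullet> h) * (z \<bullet> e)) = ((z \<bullet> h) * (z \<bullet> e) * gauss (1/4) z) / ?Z" for z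
    by (simp add: std_gauss_def)
  show "(LINT z|lborel. std_gauss z * ((z \<bullet> h) * (z \<bullet> e))) = 2 * (h \<bullet> e)"
    unfolding eq using gauss_second_moment(1)[of "1/4" e h] gauss_mass_pos[where 'a='a] assms by simp
  show "integrable lborel (\<lambda>z. std_gauss z * ((z \<bullet> h) * (z \<bullet> e)))"
    unfolding eq using gauss_second_moment(2)[of "1/4" e h] assms by (intro integrable_divide) auto
qed

lemma std_gauss_weight_integrable: "integrable lborel (\<lambda>z::'a::euclidean_space. std_gauss z * (norm z)\<^sup>2)"
proof (rule lb_integrable_bound)
  let ?Z = "LINT y::'a|lborel. gauss (1/4) y"
  show "integrable lborel (\<lambda>z::'a. (weight_gauss (1/4) z) / ?Z)"
    by (intro integrable_divide integrable_weight_gauss) simp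
  show "AE z::'a in lborel. norm (std_gauss z * (norm z)\<^sup>2) \<le> norm ((weight_gauss (1/4) z) / ?Z)"
    using gauss_mass_pos[where 'a='a] by (intro AE_I2) (simp add: std_gauss_def abs_mult divide_right_mono distrib_right)
qed simp

definition gauss_avg :: "real \<Rightarrow> (real^'m::finite \<Rightarrow> 'b::euclidean_space) \<Rightarrow> real^'m \<Rightarrow> 'b" where
  "gauss_avg \<sigma> u x = (LINT z|lborel. std_gauss z *\<^sub>R u (x + \<sigma> *\<^sub>R z))"

lemma std_gauss_scale_integrable:
  fixes g :: "'a::euclidean_space \<Rightarrow> 'b::euclidean_space"
  assumes g: "continuous_on UNIV g" and B: "\<And>z. norm (g z) \<le> B"
  shows "integrable lborel (\<lambda>z. std_gauss z *\<^sub>R g z)"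
proof (rule lb_integrable_bound)
  show "integrable lborel (\<lambda>z::'a. std_gauss z * B)" by (intro integrable_mult_left std_gauss_integrable)
  show "(\<lambda>z. std_gauss z *\<^sub>R g z) \<in> borel_measurable lborel"
    using borel_measurable_continuous_onI[OF g] by simp
  show "AE z in lborel. norm (std_gauss z *\<^sub>R g z) \<le> norm (std_gauss z * B)"
    using B by (intro AE_I2) (auto simp: abs_mult intro!: mult_left_mono order_trans[OF B abs_ge_self])
qed

lemma gauss_avg_integrable:
  fixes u :: "real^'m::finite \<Rightarrow> 'b::euclidean_space"
  assumes u: "torus_cont u" shows "integrable lborel (\<lambda>z. std_gauss z *\<^sub>R u (x + \<sigma> *\<^sub>R z))"
proof -
  obtain C where C: "\<And>x. norm (u x) \<le> C" using torus_cont_bounded[OF u] by blast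
  show ?thesis
    by (rule std_gauss_scale_integrable[where B = C], rule continuous_on_compose2[OF torus_contD(1)[OF u, of UNIV]])
      (auto intro!: continuous_intros C)
qed

lemma norm_gauss_avg_le:
  fixes u :: "real^'m::finite \<Rightarrow> 'b::euclidean_space"
  assumes u: "torus_cont u" and C: "\<And>x. norm (u x) \<le> C"
  shows "norm (gauss_avg \<sigma> u x) \<le> C"
proof -
  have "norm (gauss_avg \<sigma> u x) \<le> (LINT z|lborel. norm (std_gauss z *\<^sub>R u (x + \<sigma> *\<^sub>R z)))"
    unfolding gauss_avg_def by (rule Bochner_Integration.integral_norm_bound)
  also have "\<dots> \<le> (LINT z|lborel. std_gauss (z::real^'m) * C)"
    using C gauss_avg_integrable[OF u]
    by (intro Bochner_Integration.integral_mono integrable_norm integrable_mult_left std_gauss_integrable)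
      (auto intro!: mult_left_mono)
  also have "\<dots> = C" by (simp add: std_gauss_integral)
  finally show ?thesis .
qed

lemma gauss_avg_continuous:
  fixes u :: "real^'m::finite \<Rightarrow> 'b::euclidean_space"
  assumes u: "torus_cont u"
  shows "continuous_on UNIV (\<lambda>(\<sigma>, x). gauss_avg \<sigma> u x)"
proof -
  obtain C where C: "\<And>x. norm (u x) \<le> C" using torus_cont_bounded[OF u] by blast
  have "continuous_on UNIV (\<lambda>p. LINT z|lborel. std_gauss z *\<^sub>R u (snd p + fst p *\<^sub>R z))"
  proof (rule continuous_on_integral_dominated[where B = "\<lambda>z::real^'m. std_gauss z * C"])
    show "integrable lborel (\<lambda>z::real^'m. std_gauss z * C)" by (intro integrable_mult_left std_gauss_integrable)
    show "(\<lambda>z. std_gauss z *\<^sub>R u (snd p + fst p *\<^sub>R z)) \<in> borel_measurable lborel" for p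
      by (rule borel_measurable_integrable[OF gauss_avg_integrable[OF u]])
    have "continuous_on UNIV (\<lambda>p. u (snd p + fst p *\<^sub>R z))" for z
      by (rule continuous_on_compose2[OF torus_contD(1)[OF u, of UNIV]]) (auto intro!: continuous_intros)
    then show "continuous_on UNIV (\<lambda>p. std_gauss z *\<^sub>R u (snd p + fst p *\<^sub>R z))" for z
      by (intro continuous_intros)
    show "norm (std_gauss z *\<^sub>R u (snd p + fst p *\<^sub>R z)) \<le> std_gauss z * C" for p z
      using C by (auto intro!: mult_left_mono)
  qed
  then show ?thesis by (simp add: gauss_avg_def case_prod_unfold)
qed

lemma gauss_avg_torus_cont:
  fixes u :: "real^'m::finite \<Rightarrow> 'b::euclidean_space"
  assumes u: "torus_cont u" shows "torus_cont (gauss_avg \<sigma> u)"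
proof -
  have "continuous_on UNIV (\<lambda>x. case (\<sigma>, x) of (\<sigma>, x) \<Rightarrow> gauss_avg \<sigma> u x)"
    by (rule continuous_on_compose2[OF gauss_avg_continuous[OF u]]) (auto intro!: continuous_intros)
  moreover have "gauss_avg \<sigma> u (x + axis k 1) = gauss_avg \<sigma> u x" for x k
  proof -
    have "u (x + axis k 1 + \<sigma> *\<^sub>R z) = u (x + \<sigma> *\<^sub>R z)" for z
      using torus_contD(2)[OF u, of "x + \<sigma> *\<^sub>R z" k] by (simp add: add_ac)
    then show ?thesis by (simp add: gauss_avg_def)
  qed
  ultimately show ?thesis by (simp add: torus_cont_def)
qed

lemma gauss_avg_0: "gauss_avg 0 u x = u x"
  unfolding gauss_avg_def by (simp add: integral_scaleR_left[OF std_gauss_integrable] std_gauss_integral)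

lemma gauss_avg_linear:
  fixes u :: "real^'m::finite \<Rightarrow> 'b::euclidean_space" and T :: "'b \<Rightarrow> 'c::euclidean_space"
  assumes T: "bounded_linear T" and u: "torus_cont u"
  shows "gauss_avg \<sigma> (\<lambda>x. T (u x)) x = T (gauss_avg \<sigma> u x)"
proof -
  interpret T: bounded_linear T by fact
  show ?thesis
    unfolding gauss_avg_def by (subst integral_bounded_linear[OF T gauss_avg_integrable[OF u], symmetric]) (simp add: T.scaleR)
qed

lemma gauss_avg_add:
  fixes u v :: "real^'m::finite \<Rightarrow> 'b::euclidean_space"
  assumes "torus_cont u" "torus_cont v"
  shows "gauss_avg \<sigma> (\<lambda>x. u x + v x) x = gauss_avg \<sigma> u x + gauss_avg \<sigma> v x"
  unfolding gauss_avg_def using gauss_avg_integrable[OF assms(1)] gauss_avg_integrable[OF assms(2)]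
  by (simp add: scaleR_add_right)

lemma set_integral_cbox:
  fixes f :: "'a::euclidean_space \<Rightarrow> 'b::euclidean_space"
  assumes "continuous_on (cbox a b) f"
  shows "integrable lborel (\<lambda>x. indicator (cbox a b) x *\<^sub>R f x)"
    and "integral (cbox a b) f = (LINT x|lborel. indicator (cbox a b) x *\<^sub>R f x)"
proof -
  show int: "integrable lborel (\<lambda>x. indicator (cbox a b) x *\<^sub>R f x)"
    by (rule borel_integrable_compact) (use assms in auto)
  show "integral (cbox a b) f = (LINT x|lborel. indicator (cbox a b) x *\<^sub>R f x)"
    using set_borel_integral_eq_integral(2)[of "cbox a b" f] int
    by (simp add: set_integrable_def set_lebesgue_integral_def)
qed

lemma continuous_on_slice:
  assumes "continuous_on (A \<times> B) (\<lambda>(x, y). f x y)"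
  shows "x \<in> A \<Longrightarrow> continuous_on B (f x)" and "y \<in> B \<Longrightarrow> continuous_on A (\<lambda>x. f x y)"
proof -
  show "continuous_on B (f x)" if "x \<in> A"
  proof -
    have "continuous_on B (\<lambda>y. case (x, y) of (x, y) \<Rightarrow> f x y)"
      by (rule continuous_on_compose2[OF assms]) (use that in \<open>auto intro!: continuous_intros\<close>)
    then show ?thesis by simp
  qed
  show "continuous_on A (\<lambda>x. f x y)" if "y \<in> B"
  proof -
    have "continuous_on A (\<lambda>x. case (x, y) of (x, y) \<Rightarrow> f x y)"
      by (rule continuous_on_compose2[OF assms]) (use that in \<open>auto intro!: continuous_intros\<close>)
    then show ?thesis by simp
  qed
qed

text \<open>
  Used for \<open>Omega\<close>, to move averages across the \<open>L\<^sup>2\<close> pairing, and for time intervals, to move them across Duhamel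
  integrals.
\<close>

lemma std_gauss_fubini:
  fixes g :: "'a::euclidean_space \<Rightarrow> 'c::euclidean_space \<Rightarrow> 'b::euclidean_space"
  assumes g: "continuous_on (UNIV \<times> cbox a b) (\<lambda>(z, x). g z x)"
    and C: "\<And>z x. x \<in> cbox a b \<Longrightarrow> norm (g z x) \<le> C"
  shows "integral (cbox a b) (\<lambda>x. LINT z|lborel. std_gauss z *\<^sub>R g z x) = (LINT z|lborel. std_gauss z *\<^sub>R integral (cbox a b) (g z))"
proof (cases "cbox a b = {}")
  case False
  then have C0: "0 \<le> C" using C order_trans[OF norm_ge_zero] by blast
  let ?I = "indicator (cbox a b) :: 'c \<Rightarrow> real"
  define h where "h z x = std_gauss z *\<^sub>R (?I x *\<^sub>R g z x)" for z x
  have gz: "continuous_on (cbox a b) (g z)" for z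
    by (rule continuous_on_slice(1)[OF g]) simp
  have gx: "continuous_on UNIV (\<lambda>z. g z x)" if "x \<in> cbox a b" for x
    by (rule continuous_on_slice(2)[OF g that])
  have "(\<lambda>p. indicator (UNIV \<times> cbox a b) p *\<^sub>R (case p of (z, x) \<Rightarrow> g z x)) \<in> borel_measurable borel"
    by (rule borel_measurable_continuous_on_indicator[OF _ g]) (auto intro!: borel_closed closed_Times)
  then have m0: "(\<lambda>p. indicator (UNIV \<times> cbox a b) p *\<^sub>R (case p of (z, x) \<Rightarrow> g z x)) \<in> borel_measurable (lborel \<Otimes>\<^sub>M lborel)"
    by (simp add: lborel_prod)
  have "(\<lambda>p. std_gauss (fst p)) \<in> borel_measurable (lborel \<Otimes>\<^sub>M lborel)" by simp
  from borel_measurable_scaleR[OF this m0]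
  have meas: "(\<lambda>(z, x). h z x) \<in> borel_measurable (lborel \<Otimes>\<^sub>M lborel)"
    by (rule measurable_cong[THEN iffD1, rotated]) (auto simp: h_def indicator_def)
  have intI: "integrable lborel (\<lambda>x. ?I x * C)"
    using set_integral_cbox(1)[of a b "\<lambda>_. C"] by simp
  have bd: "norm (h z x) \<le> std_gauss z * (?I x * C)" for z x
    using C[of x z] C0 by (auto simp: h_def indicator_def intro!: mult_left_mono)
  have hz: "integrable lborel (h z)" for z
    unfolding h_def by (intro integrable_scaleR_right set_integral_cbox gz)
  have hx: "integrable lborel (\<lambda>z. h z x)" for x
  proof (cases "x \<in> cbox a b")
    case True
    then show ?thesis using std_gauss_scale_integrable[OF gx[OF True] C[OF True]] by (simp add: h_def)
  qed (simp add: h_def)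
  have int: "integrable (lborel \<Otimes>\<^sub>M lborel) (\<lambda>(z, x). h z x)"
  proof (rule lborel_pair.Fubini_integrable[OF meas])
    show "integrable lborel (\<lambda>z. LINT x|lborel. norm (case (z, x) of (z, x) \<Rightarrow> h z x))"
    proof (rule lb_integrable_bound)
      show "integrable lborel (\<lambda>z::'a. std_gauss z * (LINT x|lborel. ?I x * C))" by (intro integrable_mult_left std_gauss_integrable)
      show "(\<lambda>z. LINT x|lborel. norm (case (z, x) of (z, x) \<Rightarrow> h z x)) \<in> borel_measurable lborel"
        using meas by measurable
      show "AE z in lborel. norm (LINT x|lborel. norm (case (z, x) of (z, x) \<Rightarrow> h z x)) \<le> norm (std_gauss z * (LINT x|lborel. ?I x * C))"
      proof (rule AE_I2)
        fix z
        have "(LINT x|lborel. norm (h z x)) \<le> (LINT x|lborel. std_gauss z * (?I x * C))"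
          using bd hz intI by (intro Bochner_Integration.integral_mono integrable_norm integrable_mult_right) auto
        then have "(LINT x|lborel. norm (h z x)) \<le> std_gauss z * (LINT x|lborel. ?I x * C)" by simp
        then show "norm (LINT x|lborel. norm (case (z, x) of (z, x) \<Rightarrow> h z x)) \<le> norm (std_gauss z * (LINT x|lborel. ?I x * C))"
          by (simp add: order_trans[OF _ abs_ge_self])
      qed
    qed
    show "AE z in lborel. integrable lborel (\<lambda>x. case (z, x) of (z, x) \<Rightarrow> h z x)"
      using hz by simp
  qed
  have "integral (cbox a b) (\<lambda>x. LINT z|lborel. std_gauss z *\<^sub>R g z x) = (LINT x|lborel. LINT z|lborel. h z x)"
  proof -
    have "continuous_on (cbox a b) (\<lambda>x. LINT z|lborel. std_gauss z *\<^sub>R g z x)"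
    proof (rule continuous_on_integral_dominated[where B = "\<lambda>z::'a. std_gauss z * C"])
      show "integrable lborel (\<lambda>z::'a. std_gauss z * C)" by (intro integrable_mult_left std_gauss_integrable)
      show "(\<lambda>z. std_gauss z *\<^sub>R g z x) \<in> borel_measurable lborel" if "x \<in> cbox a b" for x
        by (rule borel_measurable_integrable[OF std_gauss_scale_integrable[OF gx[OF that] C[OF that]]])
      show "continuous_on (cbox a b) (\<lambda>x. std_gauss z *\<^sub>R g z x)" for z by (intro continuous_intros gz)
      show "norm (std_gauss z *\<^sub>R g z x) \<le> std_gauss z * C" if "x \<in> cbox a b" for z x
        using C[OF that] by (auto intro!: mult_left_mono)
    qed
    from set_integral_cbox(2)[OF this]
    have "integral (cbox a b) (\<lambda>x. LINT z|lborel. std_gauss z *\<^sub>R g z x)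
        = (LINT x|lborel. ?I x *\<^sub>R (LINT z|lborel. std_gauss z *\<^sub>R g z x))" .
    also have "\<dots> = (LINT x|lborel. LINT z|lborel. h z x)"
      by (rule lb_integral_cong) (auto simp: h_def indicator_def)
    finally show ?thesis .
  qed
  also have "\<dots> = (LINT z|lborel. LINT x|lborel. h z x)"
    by (rule lborel_pair.Fubini_integral[OF int])
  also have "\<dots> = (LINT z|lborel. std_gauss z *\<^sub>R integral (cbox a b) (g z))"
    by (rule lb_integral_cong) (simp_all add: h_def set_integral_cbox(2)[OF gz] del: scaleR_scaleR)
  finally show ?thesis .
qed simp

section \<open>Continuously differentiable periodic fields\<close>

text \<open>
  The derivative is carried along as a function, because the semigroup acts on it separately for each direction \<open>h\<close>.
\<close>

definition torus_C1 :: "(real^'m::finite \<Rightarrow> 'b::euclidean_space) \<Rightarrow> (real^'m \<Rightarrow> real^'m \<Rightarrow> 'b) \<Rightarrow> bool" where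
  "torus_C1 u D \<longleftrightarrow> torus_cont u \<and> (\<forall>x. (u has_derivative D x) (at x)) \<and> (\<forall>h. continuous_on UNIV (\<lambda>x. D x h))"

lemma torus_C1D:
  assumes "torus_C1 u D"
  shows "torus_cont u" "(u has_derivative D x) (at x)" "torus_cont (\<lambda>x. D x h)"
proof -
  show u: "torus_cont u" and D: "(u has_derivative D x) (at x)" for x using assms by (auto simp: torus_C1_def)
  have "D (x + axis k 1) = D x" for x k
  proof -
    have "((\<lambda>x. u (x + axis k 1)) has_derivative D (x + axis k 1)) (at x)"
      by (rule has_derivative_compose[of "\<lambda>x. x + axis k 1" "\<lambda>h. h" x UNIV u]) (auto intro!: derivative_eq_intros D)
    then have "(u has_derivative D (x + axis k 1)) (at x)" by (simp add: torus_contD(2)[OF u])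
    then show ?thesis using D has_derivative_unique by blast
  qed
  then show "torus_cont (\<lambda>x. D x h)" using assms by (simp add: torus_cont_def torus_C1_def)
qed

lemma torus_C1_bound:
  fixes u :: "real^'m::finite \<Rightarrow> 'b::euclidean_space"
  assumes "torus_C1 u D"
  obtains L where "0 \<le> L" "\<And>x h. norm (D x h) \<le> L * norm h" "\<And>x y. norm (u x - u y) \<le> L * norm (x - y)"
proof -
  have "\<exists>C\<ge>0. \<forall>x. norm (D x (axis k 1)) \<le> C" for k
    using torus_cont_bounded[OF torus_C1D(3)[OF assms]] by metis
  then obtain C where C: "\<And>k. 0 \<le> C k" "\<And>k x. norm (D x (axis k 1)) \<le> C k" by metis
  define L where "L = (\<Sum>k\<in>UNIV. C k)"
  have L: "norm (D x h) \<le> L * norm h" for x h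
  proof -
    interpret D: bounded_linear "D x" using torus_C1D(2)[OF assms] by (rule has_derivative_bounded_linear)
    have "h = (\<Sum>k\<in>UNIV. h $ k *\<^sub>R axis k 1)" using basis_expansion[of h] by (simp add: scalar_mult_eq_scaleR)
    then have "D x h = (\<Sum>k\<in>UNIV. h $ k *\<^sub>R D x (axis k 1))" by (metis (no_types, lifting) D.sum D.scaleR sum.cong)
    then have "norm (D x h) \<le> (\<Sum>k\<in>UNIV. \<bar>h $ k\<bar> * norm (D x (axis k 1)))" by (simp add: order_trans[OF norm_sum])
    also have "\<dots> \<le> (\<Sum>k\<in>UNIV. norm h * C k)"
      by (intro sum_mono mult_mono component_le_norm_cart C) auto
    also have "\<dots> = L * norm h" by (simp add: L_def sum_distrib_left mult.commute)
    finally show ?thesis .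
  qed
  have L0: "0 \<le> L" unfolding L_def by (intro sum_nonneg C)
  moreover have "norm (u x - u y) \<le> L * norm (x - y)" for x y
  proof (rule differentiable_bound[where S = UNIV and f' = D])
    show "(u has_derivative D x) (at x within UNIV)" for x by (rule torus_C1D(2)[OF assms])
    fix x
    show "onorm (D x) \<le> L" by (rule onorm_bound) (fact L0, fact L)
  qed simp_all
  ultimately show thesis using L that by blast
qed

text \<open>
  Averages commute with derivatives: the bound on the derivative dominates the differentiated integrand.
\<close>

lemma torus_C1_gauss_avg:
  fixes u :: "real^'m::finite \<Rightarrow> 'b::euclidean_space"
  assumes u: "torus_C1 u D"
  shows "torus_C1 (gauss_avg \<sigma> u) (\<lambda>x h. gauss_avg \<sigma> (\<lambda>y. D y h) x)"
proof -
  obtain L where "0 \<le> L" and L: "\<And>x h. norm (D x h) \<le> L * norm h"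
    and "\<And>x y. norm (u x - u y) \<le> L * norm (x - y)" by (rule torus_C1_bound[OF u], rule that)
  note uc = torus_C1D(1)[OF u] and Dc = torus_C1D(3)[OF u]
  have "((\<lambda>x. LINT z|lborel. std_gauss z *\<^sub>R u (x + \<sigma> *\<^sub>R z)) has_derivative
      (\<lambda>h. LINT z|lborel. std_gauss z *\<^sub>R D (x + \<sigma> *\<^sub>R z) h)) (at x)" for x
  proof (rule has_derivative_integral_dominated[where r = 1 and B = "\<lambda>z::real^'m. std_gauss z * L" and f' = "\<lambda>x z h. std_gauss z *\<^sub>R D (x + \<sigma> *\<^sub>R z) h"])
    show "integrable lborel (\<lambda>z::real^'m. std_gauss z * L)" by (intro integrable_mult_left std_gauss_integrable)
    show "integrable lborel (\<lambda>z. std_gauss z *\<^sub>R u (x + \<sigma> *\<^sub>R z))" for x by (rule gauss_avg_integrable[OF uc])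
    show "(\<lambda>z. std_gauss z *\<^sub>R D (x + \<sigma> *\<^sub>R z) h) \<in> borel_measurable lborel" for h
      by (rule borel_measurable_integrable[OF gauss_avg_integrable[OF Dc]])
    show "norm (std_gauss z *\<^sub>R D (x + \<sigma> *\<^sub>R z) h) \<le> std_gauss z * L * norm h" for x z h
      using L by (simp add: mult.assoc mult_left_mono)
    show "((\<lambda>x. std_gauss z *\<^sub>R u (x + \<sigma> *\<^sub>R z)) has_derivative (\<lambda>h. std_gauss z *\<^sub>R D (x + \<sigma> *\<^sub>R z) h)) (at x)" for x z
      by (intro has_derivative_scaleR_right has_derivative_compose[of "\<lambda>x. x + \<sigma> *\<^sub>R z" "\<lambda>h. h" x UNIV u])
        (auto intro!: derivative_eq_intros torus_C1D(2)[OF u])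
  qed simp
  then show ?thesis
    using gauss_avg_torus_cont[OF uc] gauss_avg_torus_cont[OF Dc] by (auto simp: torus_C1_def gauss_avg_def[abs_def] torus_cont_def)
qed

lemma torus_C1_integral:
  fixes F :: "real \<Rightarrow> real^'m::finite \<Rightarrow> 'b::euclidean_space"
  assumes F: "\<And>s. s \<in> {0..T} \<Longrightarrow> torus_C1 (F s) (D s)"
    and Fc: "continuous_on (UNIV \<times> {0..T}) (\<lambda>(x, s). F s x)"
    and Dc: "\<And>h. continuous_on (UNIV \<times> {0..T}) (\<lambda>(x, s). D s x h)"
    and L: "\<And>s x h. s \<in> {0..T} \<Longrightarrow> norm (D s x h) \<le> L * norm h"
  shows "torus_C1 (\<lambda>x. integral {0..T} (\<lambda>s. F s x)) (\<lambda>x h. integral {0..T} (\<lambda>s. D s x h))"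
proof -
  have c1: "continuous_on UNIV (\<lambda>x. integral {0..T} (\<lambda>s. F s x))"
    using integral_continuous_on_param[of UNIV 0 T "\<lambda>x s. F s x"] Fc by (simp add: cbox_interval)
  have c2: "continuous_on UNIV (\<lambda>x. integral {0..T} (\<lambda>s. D s x h))" for h
    using integral_continuous_on_param[of UNIV 0 T "\<lambda>x s. D s x h"] Dc by (simp add: cbox_interval)
  have Fs: "continuous_on {0..T} (\<lambda>s. F s x)" for x
    by (rule continuous_on_slice(1)[OF Fc]) simp
  have Ds: "continuous_on {0..T} (\<lambda>s. D s x h)" for x h
    by (rule continuous_on_slice(1)[OF Dc]) simp
  have eqF: "integral {0..T} (\<lambda>s. F s x) = (LINT s|lborel. indicator {0..T} s *\<^sub>R F s x)" for x
    using set_integral_cbox(2)[of 0 T "\<lambda>s. F s x"] Fs by (simp add: cbox_interval)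
  have eqD: "integral {0..T} (\<lambda>s. D s x h) = (LINT s|lborel. indicator {0..T} s *\<^sub>R D s x h)" for x h
    using set_integral_cbox(2)[of 0 T "\<lambda>s. D s x h"] Ds by (simp add: cbox_interval)
  have "((\<lambda>x. LINT s|lborel. indicator {0..T} s *\<^sub>R F s x) has_derivative
      (\<lambda>h. LINT s|lborel. indicator {0..T} s *\<^sub>R D s x h)) (at x)" for x
  proof (rule has_derivative_integral_dominated[where r = 1 and B = "\<lambda>s. indicator {0..T} s *\<^sub>R L"
        and f' = "\<lambda>x s h. indicator {0..T} s *\<^sub>R D s x h"])
    show "integrable lborel (\<lambda>s. indicator {0..T} s *\<^sub>R L)"
      using set_integral_cbox(1)[of 0 T "\<lambda>_. L"] by (simp add: cbox_interval)
    show "integrable lborel (\<lambda>s. indicator {0..T} s *\<^sub>R F s x)" for x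
      using set_integral_cbox(1)[of 0 T "\<lambda>s. F s x"] Fs by (simp add: cbox_interval)
    have "integrable lborel (\<lambda>s. indicator {0..T} s *\<^sub>R D s x h)" for h
      using set_integral_cbox(1)[of 0 T "\<lambda>s. D s x h"] Ds by (simp add: cbox_interval)
    then show "(\<lambda>s. indicator {0..T} s *\<^sub>R D s x h) \<in> borel_measurable lborel" for h
      by (rule borel_measurable_integrable)
    show "((\<lambda>x. indicator {0..T} s *\<^sub>R F s x) has_derivative (\<lambda>h. indicator {0..T} s *\<^sub>R D s x h)) (at x)" for x s
      by (cases "s \<in> {0..T}") (auto intro!: has_derivative_scaleR_right torus_C1D(2)[OF F])
    show "norm (indicator {0..T} s *\<^sub>R D s x h) \<le> indicator {0..T} s *\<^sub>R L * norm h" for x s h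
      by (cases "s \<in> {0..T}") (auto simp: L)
  qed simp
  moreover have "integral {0..T} (\<lambda>s. F s (x + axis k 1)) = integral {0..T} (\<lambda>s. F s x)" for x k
    by (rule hk_integral_cong) (rule torus_contD(2)[OF torus_C1D(1)[OF F]])
  ultimately show ?thesis
    unfolding torus_C1_def torus_cont_def using c1 c2 by (simp add: eqF[symmetric] eqD[symmetric])
qed

section \<open>The heat equation\<close>

lemma has_derivative_matrix_componentwise:
  fixes f :: "'a::real_normed_vector \<Rightarrow> real^'n::finite^'k::finite"
  assumes "\<And>i j. ((\<lambda>x. f x $ i $ j) has_derivative (\<lambda>h. f' h $ i $ j)) (at x)"
  shows "(f has_derivative f') (at x)"
proof (subst has_derivative_componentwise_within, intro ballI)
  fix b :: "real^'n^'k" assume "b \<in> Basis"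
  then obtain i j where b: "b = axis i (axis j 1)" by (auto simp: Basis_vec_def)
  show "((\<lambda>x. f x \<bullet> b) has_derivative (\<lambda>h. f' h \<bullet> b)) (at x)"
    using assms[of i j] by (simp add: b inner_axis)
qed

lemma bounded_linear_entry: "bounded_linear (\<lambda>A::real^'n::finite^'k::finite. A $ i $ j)"
  by (intro bounded_linear_compose[OF bounded_linear_vec_nth] bounded_linear_vec_nth)

lemma partial_has_derivative:
  assumes "(u has_derivative D) (at x)" shows "partial k u x = D (axis k 1)"
proof -
  have "((\<lambda>h. u (x + h *\<^sub>R axis k 1)) has_derivative (\<lambda>h. D (h *\<^sub>R axis k 1))) (at 0)"
    by (rule has_derivative_compose[of "\<lambda>h. x + h *\<^sub>R axis k 1" "\<lambda>h. h *\<^sub>R axis k 1" 0 UNIV u])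
      (use assms in \<open>auto intro!: derivative_eq_intros\<close>)
  moreover have "(\<lambda>h. D (h *\<^sub>R axis k 1)) = (*) (D (axis k 1))"
    using has_derivative_bounded_linear[OF assms] by (auto simp: linear_simps fun_eq_iff)
  ultimately have "((\<lambda>h. u (x + h *\<^sub>R axis k 1)) has_real_derivative D (axis k 1)) (at 0)"
    by (simp add: has_field_derivative_def)
  then show ?thesis unfolding partial_def by (rule DERIV_imp_deriv)
qed

lemma C2_from_derivatives:
  fixes u :: "real^'m::finite \<Rightarrow> real"
  assumes D: "\<And>x. (u has_derivative D x) (at x)"
    and DD: "\<And>k x. ((\<lambda>x. D x (axis k 1)) has_derivative DD k x) (at x)"
    and c: "\<And>k j. continuous_on UNIV (\<lambda>x. DD k x (axis j 1))"
  shows "C2 u" and "laplacian u x = (\<Sum>k\<in>UNIV. DD k x (axis k 1))"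
proof -
  have p: "partial k u = (\<lambda>x. D x (axis k 1))" for k by (rule ext) (rule partial_has_derivative[OF D])
  have pp: "partial j (partial k u) = (\<lambda>x. DD k x (axis j 1))" for j k
    unfolding p by (rule ext) (rule partial_has_derivative[OF DD])
  have "continuous_on UNIV (\<lambda>x. D x (axis k 1))" for k
    by (rule has_derivative_continuous_on[of _ _ "DD k"]) (rule has_derivative_at_withinI[OF DD])
  then show "C2 u"
    unfolding C2_def C1_def pp using c differentiableI[OF D] differentiableI[OF DD] by (auto simp: p)
  show "laplacian u x = (\<Sum>k\<in>UNIV. DD k x (axis k 1))" by (simp add: laplacian_def pp)
qed

locale heat_semigroup =
  fixes \<epsilon> \<kappa> :: real
  assumes eps: "0 < \<epsilon>" and kap: "0 < \<kappa>"
begin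

text \<open>
  The closed form of the solution operator. At \<open>s = 0\<close> the average is over a point mass, so the initial value needs no
  separate case.
\<close>

definition heat :: "real \<Rightarrow> (real^'m::finite \<Rightarrow> 'b::euclidean_space) \<Rightarrow> real^'m \<Rightarrow> 'b" where
  "heat s u x = exp (- \<kappa> * s) *\<^sub>R gauss_avg (\<epsilon> * sqrt s) u x"

lemma heat_0: "heat 0 u = u" by (simp add: heat_def gauss_avg_0 fun_eq_iff)

lemma heat_torus_cont: "torus_cont u \<Longrightarrow> torus_cont (heat s u)"
  unfolding heat_def by (intro torus_cont_intros gauss_avg_torus_cont)

lemma heat_torus_C1: "torus_C1 u D \<Longrightarrow> torus_C1 (heat s u) (\<lambda>x h. heat s (\<lambda>y. D y h) x)"
  using torus_C1_gauss_avg[of u D "\<epsilon> * sqrt s"] torus_cont_intros(4)[of "gauss_avg (\<epsilon> * sqrt s) u"]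
  unfolding torus_C1_def heat_def by (auto intro!: continuous_intros has_derivative_scaleR_right)

lemma norm_heat_le:
  assumes "torus_cont u" "\<And>x. norm (u x) \<le> C"
  shows "norm (heat s u x) \<le> exp (- \<kappa> * s) * C"
  unfolding heat_def using norm_gauss_avg_le[OF assms] by (simp add: mult_left_mono)

lemma heat_continuous: "torus_cont u \<Longrightarrow> continuous_on UNIV (\<lambda>(s, x). heat s u x)"
proof -
  assume u: "torus_cont u"
  have "continuous_on UNIV (\<lambda>p. case (\<epsilon> * sqrt (fst p), snd p) of (\<sigma>, x) \<Rightarrow> gauss_avg \<sigma> u x)"
    by (rule continuous_on_compose2[OF gauss_avg_continuous[OF u]]) (auto intro!: continuous_intros)
  then show ?thesis unfolding heat_def case_prod_unfold by (auto intro!: continuous_intros)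
qed

lemma heat_linear:
  fixes u :: "real^'m::finite \<Rightarrow> 'b::euclidean_space" and T :: "'b \<Rightarrow> 'c::euclidean_space"
  assumes "bounded_linear T" "torus_cont u"
  shows "heat s (\<lambda>x. T (u x)) x = T (heat s u x)"
  unfolding heat_def gauss_avg_linear[OF assms] by (simp add: linear_scale[OF bounded_linear.linear[OF assms(1)]])

lemma heat_add:
  "torus_cont u \<Longrightarrow> torus_cont v \<Longrightarrow> heat s (\<lambda>x. u x + v x) x = heat s u x + heat s v x"
  unfolding heat_def by (simp add: gauss_avg_add scaleR_add_right)

text \<open>
  The substitution \<open>y = x + \<epsilon> \<surd>s z\<close> moves the dependence on \<open>x\<close> and \<open>s\<close> from the field, which is only continuous,
  to the smooth kernel.
\<close>

lemma heat_kernel: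
  fixes v :: "real^'m::finite \<Rightarrow> real"
  assumes v: "torus_cont v" and s: "0 < s"
  shows "heat s v x = exp (- \<kappa> * s - real CARD('m) / 2 * ln s)
     / (\<epsilon> ^ CARD('m) * (LINT y::real^'m|lborel. gauss (1/4) y))
     * (LINT y|lborel. gauss (1 / (4 * \<epsilon>\<^sup>2 * s)) (y - x) * v y)"
proof -
  define Z where "Z = (LINT y::real^'m|lborel. gauss (1/4) y)"
  define \<sigma> where "\<sigma> = \<epsilon> * sqrt s"
  define a where "a = 1 / (4 * \<epsilon>\<^sup>2 * s)"
  have Z: "0 < Z" unfolding Z_def by (rule gauss_mass_pos)
  have sg: "0 < \<sigma>" "\<sigma>\<^sup>2 = \<epsilon>\<^sup>2 * s" using eps s by (auto simp: \<sigma>_def power_mult_distrib)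
  have as: "a * \<sigma>\<^sup>2 = 1/4" using eps s unfolding sg a_def by simp
  have "v \<in> borel_measurable borel" by (rule borel_measurable_continuous_onI[OF torus_contD(1)[OF v]])
  then have "(\<lambda>y. gauss a (y - x) * v y) \<in> borel_measurable borel" by simp
  from lborel_integral_affine[OF this, of \<sigma> x]
  have "(LINT y|lborel. gauss a (y - x) * v y)
      = \<sigma> ^ CARD('m) * (LINT z|lborel. gauss a (\<sigma> *\<^sub>R z) * v (x + \<sigma> *\<^sub>R z))"
    using sg by simp
  also have "(\<lambda>z. gauss a (\<sigma> *\<^sub>R z) * v (x + \<sigma> *\<^sub>R z)) = (\<lambda>z. Z * (std_gauss z *\<^sub>R v (x + \<sigma> *\<^sub>R z)))"
  proof
    fix z :: "real^'m"
    have "- a * (norm (\<sigma> *\<^sub>R z))\<^sup>2 = - (a * \<sigma>\<^sup>2) * (norm z)\<^sup>2" by (simp add: power_mult_distrib)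
    then show "gauss a (\<sigma> *\<^sub>R z) * v (x + \<sigma> *\<^sub>R z) = Z * (std_gauss z *\<^sub>R v (x + \<sigma> *\<^sub>R z))"
      using Z unfolding as std_gauss_def Z_def[symmetric] by simp
  qed
  also have "\<sigma> ^ CARD('m) * (LINT z|lborel. Z * (std_gauss z *\<^sub>R v (x + \<sigma> *\<^sub>R z))) = \<sigma> ^ CARD('m) * Z * gauss_avg \<sigma> v x"
    by (simp add: gauss_avg_def)
  finally have 1: "(LINT y|lborel. gauss a (y - x) * v y) = \<sigma> ^ CARD('m) * Z * gauss_avg \<sigma> v x" .
  have "sqrt s ^ CARD('m) = exp (real CARD('m) / 2 * ln s)"
  proof -
    have "sqrt s ^ CARD('m) = exp (ln (sqrt s)) ^ CARD('m)" using s by simp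
    also have "\<dots> = exp (real CARD('m) * ln (sqrt s))" by (rule exp_of_nat_mult[symmetric])
    finally show ?thesis using s by (simp add: ln_sqrt)
  qed
  then have 2: "\<sigma> ^ CARD('m) = \<epsilon> ^ CARD('m) * exp (real CARD('m) / 2 * ln s)"
    by (simp add: \<sigma>_def power_mult_distrib)
  show ?thesis
    unfolding a_def[symmetric] Z_def[symmetric] 1 2 heat_def \<sigma>_def[symmetric] exp_diff
    using eps Z by (simp add: field_simps)
qed

text \<open>
  With \<open>a = 1/(4 \<epsilon>\<^sup>2 s)\<close>, the Laplacian brings down \<open>4 a\<^sup>2 \<bar>y - x\<bar>\<^sup>2 - 2 a m\<close> under the integral; the time derivative
  produces the same two terms, one from the exponent and one from the power of \<open>s\<close> in the normalisation, together with
  \<open>- \<kappa>\<close>.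
\<close>

lemma heat_equation_scalar:
  fixes v :: "real^'m::finite \<Rightarrow> real"
  assumes v: "torus_cont v" and s: "0 < s"
  shows "C2 (heat s v)"
    and "((\<lambda>r. heat r v x) has_real_derivative - \<kappa> * heat s v x + \<epsilon>\<^sup>2 * laplacian (heat s v) x) (at s)"
proof -
  obtain B where "0 \<le> B" and B: "\<And>y. \<bar>v y\<bar> \<le> B" using torus_cont_bounded[OF v] by auto
  note vc = torus_contD(1)[OF v, of UNIV]
  define Z where "Z = (LINT y::real^'m|lborel. gauss (1/4) y)"
  define m where "m = real CARD('m)"
  define \<alpha> where "\<alpha> r = 1 / (4 * \<epsilon>\<^sup>2 * r)" for r
  define c where "c r = exp (- \<kappa> * r - m / 2 * ln r) / (\<epsilon> ^ CARD('m) * Z)" for r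
  define \<Phi> where "\<Phi> a x = (LINT y|lborel. gauss a (y - x) * v y)" for a x
  define M2 where "M2 a x = (LINT y|lborel. (norm (y - x))\<^sup>2 * gauss a (y - x) * v y)" for a x
  define H where "H a k x h = (LINT y|lborel. (2 * a * ((y - x) \<bullet> h) * ((y - x) \<bullet> axis k 1) - h \<bullet> axis k 1) * gauss a (y - x) * v y)"
    for a k and x h :: "real^'m"
  define a where "a = \<alpha> s"
  have a: "0 < a" using eps s by (simp add: a_def \<alpha>_def)
  have Z: "0 < Z" unfolding Z_def by (rule gauss_mass_pos)
  have hk: "heat r v x = c r * \<Phi> (\<alpha> r) x" if "0 < r" for r x
    unfolding heat_kernel[OF v that] c_def \<Phi>_def \<alpha>_def m_def Z_def ..
  have hs: "heat s v = (\<lambda>x. c s * \<Phi> a x)" using hk[OF s] by (simp add: fun_eq_iff a_def)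
  have e: "norm (axis k 1 :: real^'m) = 1" for k by (simp add: norm_eq_1 inner_axis_axis)
  have D: "(heat s v has_derivative (\<lambda>h. c s * (2 * a * (LINT y|lborel. ((y - x) \<bullet> h) * gauss a (y - x) * v y)))) (at x)" for x
    unfolding hs \<Phi>_def by (intro has_derivative_mult_right gauss_convolution_D1[OF a vc B])
  have DD: "((\<lambda>x. c s * (2 * a * (LINT y|lborel. ((y - x) \<bullet> axis k 1) * gauss a (y - x) * v y))) has_derivative
      (\<lambda>h. c s * (2 * a * H a k x h))) (at x)" for x k
    unfolding H_def by (intro has_derivative_mult_right gauss_convolution_D2(1)[OF a e vc B])
  have cont: "continuous_on UNIV (\<lambda>x. c s * (2 * a * H a k x (axis j 1)))" for k j
    unfolding H_def by (intro continuous_on_mult_left gauss_convolution_D2(2)[OF a e vc B])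
  show "C2 (heat s v)" by (rule C2_from_derivatives(1)[OF D DD cont])
  have "laplacian (heat s v) x = (\<Sum>k\<in>UNIV. c s * (2 * a * H a k x (axis k 1)))"
    by (rule C2_from_derivatives(2)[OF D DD cont])
  also have "\<dots> = c s * (2 * a * (\<Sum>k\<in>UNIV. H a k x (axis k 1)))" by (simp add: sum_distrib_left)
  also have "(\<Sum>k\<in>UNIV. H a k x (axis k 1)) = 2 * a * M2 a x - m * \<Phi> a x"
  proof -
    have i1: "integrable lborel (\<lambda>y. ((y - x) $ k)\<^sup>2 * gauss a (y - x) * v y)" for k
    proof -
      have "\<bar>(z $ k)\<^sup>2\<bar> \<le> 1 * (1 + (norm z)\<^sup>2)" for z :: "real^'m"
        using power_mono[OF component_le_norm_cart[of z k], of 2] by simp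
      then have "gauss_dominated a 1 (\<lambda>z::real^'m. (z $ k)\<^sup>2 * gauss a z)"
        by (intro gauss_dominated_mult) (auto intro!: continuous_intros)
      from gauss_dominated_integrable[OF this a vc B] show ?thesis .
    qed
    have i0: "integrable lborel (\<lambda>y. gauss a (y - x) * v y)"
      by (rule gauss_dominated_integrable[OF gauss_dominated_gauss a vc B])
    have "H a k x (axis k 1) = 2 * a * (LINT y|lborel. ((y - x) $ k)\<^sup>2 * gauss a (y - x) * v y) - \<Phi> a x" for k
    proof -
      have "H a k x (axis k 1) = (LINT y|lborel. 2 * a * (((y - x) $ k)\<^sup>2 * gauss a (y - x) * v y) - gauss a (y - x) * v y)"
        unfolding H_def
        by (rule lb_integral_cong) (simp_all add: inner_axis inner_axis_axis power2_eq_square left_diff_distrib mult.assoc)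
      also have "\<dots> = 2 * a * (LINT y|lborel. ((y - x) $ k)\<^sup>2 * gauss a (y - x) * v y) - \<Phi> a x"
        unfolding \<Phi>_def by (subst Bochner_Integration.integral_diff[OF integrable_mult_right[OF i1] i0]) simp
      finally show ?thesis .
    qed
    then have "(\<Sum>k\<in>UNIV. H a k x (axis k 1)) = 2 * a * (\<Sum>k\<in>UNIV. LINT y|lborel. ((y - x) $ k)\<^sup>2 * gauss a (y - x) * v y) - m * \<Phi> a x"
      by (simp add: sum_subtractf sum_distrib_left m_def)
    also have "(\<Sum>k\<in>UNIV. LINT y|lborel. ((y - x) $ k)\<^sup>2 * gauss a (y - x) * v y) = M2 a x"
    proof -
      have "(norm z)\<^sup>2 = (\<Sum>k\<in>UNIV. (z $ k)\<^sup>2)" for z :: "real^'m"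
        unfolding power2_norm_eq_inner by (simp add: inner_vec_def power2_eq_square)
      then have "M2 a x = (LINT y|lborel. (\<Sum>k\<in>UNIV. ((y - x) $ k)\<^sup>2 * gauss a (y - x) * v y))"
        unfolding M2_def by (simp only: sum_distrib_right)
      then show ?thesis using i1 by (simp only: Bochner_Integration.integral_sum)
    qed
    finally show ?thesis .
  qed
  finally have lap: "laplacian (heat s v) x = c s * (2 * a * (2 * a * M2 a x - m * \<Phi> a x))" .
  have dc: "(c has_real_derivative c s * (- \<kappa> - m / (2 * s))) (at s)"
    unfolding c_def using s Z eps by (auto intro!: derivative_eq_intros simp: field_simps)
  have d\<alpha>: "(\<alpha> has_real_derivative - 1 / (4 * \<epsilon>\<^sup>2 * s\<^sup>2)) (at s)"
    unfolding \<alpha>_def using s eps by (auto intro!: derivative_eq_intros simp: power2_eq_square field_simps)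
  have d\<Phi>: "((\<lambda>a. \<Phi> a x) has_real_derivative - M2 (\<alpha> s) x) (at (\<alpha> s))"
    unfolding \<Phi>_def M2_def by (rule gauss_convolution_Da[OF _ vc B]) (use a in \<open>simp add: a_def\<close>)
  have "((\<lambda>r. c r * \<Phi> (\<alpha> r) x) has_real_derivative
      c s * (- \<kappa> - m / (2 * s)) * \<Phi> (\<alpha> s) x + (- M2 (\<alpha> s) x) * (- 1 / (4 * \<epsilon>\<^sup>2 * s\<^sup>2)) * c s) (at s)"
    by (rule DERIV_mult[OF dc DERIV_chain2[OF d\<Phi> d\<alpha>]])
  also have "c s * (- \<kappa> - m / (2 * s)) * \<Phi> (\<alpha> s) x + (- M2 (\<alpha> s) x) * (- 1 / (4 * \<epsilon>\<^sup>2 * s\<^sup>2)) * c s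
      = - \<kappa> * heat s v x + \<epsilon>\<^sup>2 * laplacian (heat s v) x"
  proof -
    have e1: "\<epsilon>\<^sup>2 * (2 * a) = 1 / (2 * s)" and e2: "\<epsilon>\<^sup>2 * (2 * a * (2 * a)) = 1 / (4 * \<epsilon>\<^sup>2 * s\<^sup>2)"
      using eps s by (simp_all add: a_def \<alpha>_def field_simps power2_eq_square)
    have "\<epsilon>\<^sup>2 * (c s * (2 * a * (2 * a * M2 a x - m * \<Phi> a x)))
        = c s * ((\<epsilon>\<^sup>2 * (2 * a * (2 * a))) * M2 a x - (\<epsilon>\<^sup>2 * (2 * a)) * (m * \<Phi> a x))"
      by (simp add: algebra_simps)
    also have "\<dots> = c s * (1 / (4 * \<epsilon>\<^sup>2 * s\<^sup>2) * M2 a x - 1 / (2 * s) * (m * \<Phi> a x))"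
      unfolding e1 e2 ..
    finally have "\<epsilon>\<^sup>2 * (c s * (2 * a * (2 * a * M2 a x - m * \<Phi> a x)))
        = c s * (1 / (4 * \<epsilon>\<^sup>2 * s\<^sup>2) * M2 a x - 1 / (2 * s) * (m * \<Phi> a x))" .
    then show ?thesis unfolding lap hk[OF s] a_def by (simp add: algebra_simps)
  qed
  finally show "((\<lambda>r. heat r v x) has_real_derivative - \<kappa> * heat s v x + \<epsilon>\<^sup>2 * laplacian (heat s v) x) (at s)"
  proof (rule has_field_derivative_transform_within_open[of _ _ _ "{0<..}"])
    show "c r * \<Phi> (\<alpha> r) x = heat r v x" if "r \<in> {0<..}" for r using hk[of r] that by simp
  qed (use s in auto)
qed

lemma linear_solution_heat:
  fixes V :: "'m::finite field"
  assumes V: "torus_cont V"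
  shows "linear_solution \<epsilon> \<kappa> V (\<lambda>s. heat s V)"
  unfolding linear_solution_def
proof (intro conjI allI impI)
  have Vc: "torus_cont (\<lambda>x. V x $ i $ j)" for i j
    by (rule torus_cont_compose[OF V]) (intro continuous_intros)
  have comp: "heat s V x $ i $ j = heat s (\<lambda>x. V x $ i $ j) x" for s x i j
    by (rule heat_linear[OF bounded_linear_entry V, symmetric])
  show "heat 0 V = V" by (rule heat_0)
  show "continuous_on ({0..} \<times> UNIV) (\<lambda>(s, x). heat s V x)"
    by (rule continuous_on_subset[OF heat_continuous[OF V]]) simp
  show "periodic (heat s V)" for s
    using heat_torus_cont[OF V, of s] by (simp add: torus_cont_def periodic_def)
  show "C2_field (heat s V)" if "0 < s" for s
    unfolding C2_field_def comp using heat_equation_scalar(1)[OF Vc that] by blast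
  show "((\<lambda>r. heat r V x) has_vector_derivative - lin_op \<epsilon> \<kappa> (heat s V) x) (at s)" if s: "0 < s" for s x
    unfolding has_vector_derivative_def
  proof (rule has_derivative_matrix_componentwise)
    fix i j
    have "((\<lambda>r. heat r V x $ i $ j) has_real_derivative (- lin_op \<epsilon> \<kappa> (heat s V) x) $ i $ j) (at s)"
      using heat_equation_scalar(2)[OF Vc s, of i j x]
      by (simp add: comp lin_op_def Laplacian_def)
    then show "((\<lambda>r. heat r V x $ i $ j) has_derivative (\<lambda>h. (h *\<^sub>R - lin_op \<epsilon> \<kappa> (heat s V) x) $ i $ j)) (at s)"
      unfolding has_field_derivative_def by (rule has_derivative_eq_rhs) (simp add: fun_eq_iff)
  qed
qed

end

section \<open>Uniqueness by the maximum principle\<close>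

lemma second_derivative_at_max:
  fixes g g' :: "real \<Rightarrow> real"
  assumes g: "\<And>h. (g has_real_derivative g' h) (at h)" and g': "(g' has_real_derivative c) (at 0)"
    and max: "\<And>h. g h \<le> g 0"
  shows "c \<le> 0"
proof (rule ccontr)
  assume "\<not> c \<le> 0"
  then obtain d where d: "0 < d" "\<And>h. 0 < h \<Longrightarrow> h < d \<Longrightarrow> g' 0 < g' (0 + h)"
    using DERIV_pos_inc_right[OF g'] by auto
  have g0: "g' 0 = 0" by (rule DERIV_local_max[OF g[of 0] zero_less_one]) (use max in simp)
  have "g 0 < g (d / 2)"
  proof (rule DERIV_pos_imp_increasing_open[of 0 "d / 2" g])
    show "\<exists>y. (g has_real_derivative y) (at x) \<and> 0 < y" if "0 < x" "x < d / 2" for x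
      using d(2)[of x] that g g0 d(1) by auto
    show "continuous_on {0..d / 2} g" by (meson DERIV_continuous_on has_field_derivative_at_within g)
  qed (use d in simp)
  then show False using max[of "d / 2"] by simp
qed

lemma partial_along_axis:
  assumes "u differentiable (at (x + h *\<^sub>R axis k 1))"
  shows "((\<lambda>h. u (x + h *\<^sub>R axis k 1)) has_real_derivative partial k u (x + h *\<^sub>R axis k 1)) (at h)"
proof -
  obtain D where D: "(u has_derivative D) (at (x + h *\<^sub>R axis k 1))" using assms by (auto simp: differentiable_def)
  have "((\<lambda>h. u (x + h *\<^sub>R axis k 1)) has_derivative (\<lambda>t. D (t *\<^sub>R axis k 1))) (at h)"
    by (rule has_derivative_compose[of "\<lambda>h. x + h *\<^sub>R axis k 1" "\<lambda>h. h *\<^sub>R axis k 1" h UNIV u])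
      (use D in \<open>auto intro!: derivative_eq_intros\<close>)
  moreover have "(\<lambda>t. D (t *\<^sub>R axis k 1)) = (*) (D (axis k 1))"
    using has_derivative_bounded_linear[OF D] by (auto simp: linear_simps fun_eq_iff)
  ultimately show ?thesis by (simp add: has_field_derivative_def partial_has_derivative[OF D])
qed

text \<open>
  Stated for a difference of two functions, so that the Laplacian of a difference is never needed.
\<close>

lemma laplacian_le_at_max:
  fixes u v :: "real^'m::finite \<Rightarrow> real"
  assumes u: "C2 u" and v: "C2 v" and max: "\<And>x. u x - v x \<le> u x0 - v x0"
  shows "laplacian u x0 \<le> laplacian v x0"
proof -
  have "partial k (partial k u) x0 \<le> partial k (partial k v) x0" for k
  proof -
    have d: "u differentiable (at x)" "v differentiable (at x)" "partial k u differentiable (at x)" "partial k v differentiable (at x)" for x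
      using u v by (auto simp: C2_def C1_def)
    have "partial k (partial k u) x0 - partial k (partial k v) x0 \<le> 0"
    proof (rule second_derivative_at_max)
      show "((\<lambda>h. u (x0 + h *\<^sub>R axis k 1) - v (x0 + h *\<^sub>R axis k 1)) has_real_derivative
          partial k u (x0 + h *\<^sub>R axis k 1) - partial k v (x0 + h *\<^sub>R axis k 1)) (at h)" for h
        by (intro DERIV_diff partial_along_axis d)
      show "((\<lambda>h. partial k u (x0 + h *\<^sub>R axis k 1) - partial k v (x0 + h *\<^sub>R axis k 1)) has_real_derivative
          partial k (partial k u) x0 - partial k (partial k v) x0) (at 0)"
        using DERIV_diff[OF partial_along_axis[where x = x0 and h = 0 and k = k, OF d(3)]
            partial_along_axis[where x = x0 and h = 0 and k = k, OF d(4)]] by simp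
    qed (use max in simp)
    then show ?thesis by simp
  qed
  then show ?thesis unfolding laplacian_def by (intro sum_mono)
qed

context heat_semigroup
begin

text \<open>
  Maximum principle. At a positive maximum of the difference over \<open>[0,T]\<close> and all of space, the Laplacians are ordered, so
  the time derivative is at most \<open>- \<kappa>\<close> times the maximum; but then the difference was larger shortly before.
\<close>

lemma linear_solution_le:
  fixes V :: "'m::finite field"
  assumes W1: "linear_solution \<epsilon> \<kappa> V W1" and W2: "linear_solution \<epsilon> \<kappa> V W2" and T: "0 \<le> T"
  shows "W1 T x $ i $ j \<le> W2 T x $ i $ j"
proof (rule ccontr)
  define w where "w s x = W1 s x $ i $ j - W2 s x $ i $ j" for s x
  assume "\<not> W1 T x $ i $ j \<le> W2 T x $ i $ j"
  then have pos: "0 < w T x" by (simp add: w_def)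
  note W1' = W1[unfolded linear_solution_def] and W2' = W2[unfolded linear_solution_def]
  have cmp: "compact ({0..T} \<times> (Omega :: (real^'m) set))"
    by (intro compact_Times) (auto simp: Omega_def)
  have c1: "continuous_on ({0..T} \<times> Omega) (\<lambda>p. W1 (fst p) (snd p))"
    using W1' by (auto simp: case_prod_unfold elim!: continuous_on_subset)
  have c2: "continuous_on ({0..T} \<times> Omega) (\<lambda>p. W2 (fst p) (snd p))"
    using W2' by (auto simp: case_prod_unfold elim!: continuous_on_subset)
  have "continuous_on ({0..T} \<times> Omega) (\<lambda>p. w (fst p) (snd p))"
    unfolding w_def by (intro continuous_intros c1 c2)
  moreover have "{0..T} \<times> (Omega :: (real^'m) set) \<noteq> {}"
  proof -
    have "(0, 0) \<in> {0..T} \<times> (Omega :: (real^'m) set)"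
      using T by (simp add: Omega_def mem_box_cart)
    then show ?thesis by blast
  qed
  ultimately obtain p where p: "p \<in> {0..T} \<times> Omega" "\<And>q. q \<in> {0..T} \<times> Omega \<Longrightarrow> w (fst q) (snd q) \<le> w (fst p) (snd p)"
    using continuous_attains_sup[OF cmp] by blast
  obtain s0 x0 where [simp]: "p = (s0, x0)" by (cases p)
  have s0: "0 \<le> s0" "s0 \<le> T" using p(1) by auto
  have max: "w s y \<le> w s0 x0" if s: "0 \<le> s" "s \<le> T" for s y
  proof (rule periodic_representative[of y])
    fix y' :: "real^'m"
    assume y': "y' \<in> Omega" "\<And>u::real^'m \<Rightarrow> real. (\<And>x k. u (x + axis k 1) = u x) \<Longrightarrow> u y = u y'"
    have "w s y = w s y'"
      by (rule y'(2)) (use W1' W2' s in \<open>simp add: w_def periodic_def\<close>)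
    then show ?thesis using p(2)[of "(s, y')"] y'(1) s by simp
  qed
  have w0: "0 < w s0 x0" using pos max[OF T order_refl, of x] by simp
  have "w 0 x0 = 0" using W1' W2' by (simp add: w_def)
  with w0 s0 have s0': "0 < s0" by (cases "s0 = 0") auto
  have lap: "laplacian (\<lambda>y. W1 s0 y $ i $ j) x0 \<le> laplacian (\<lambda>y. W2 s0 y $ i $ j) x0"
  proof (rule laplacian_le_at_max)
    show "C2 (\<lambda>y. W1 s0 y $ i $ j)" "C2 (\<lambda>y. W2 s0 y $ i $ j)"
      using W1' W2' s0' by (auto simp: C2_field_def)
    show "W1 s0 y $ i $ j - W2 s0 y $ i $ j \<le> W1 s0 x0 $ i $ j - W2 s0 x0 $ i $ j" for y
      using max[OF s0, of y] by (simp add: w_def)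
  qed
  have "((\<lambda>r. W1 r x0) has_vector_derivative - lin_op \<epsilon> \<kappa> (W1 s0) x0) (at s0)"
    "((\<lambda>r. W2 r x0) has_vector_derivative - lin_op \<epsilon> \<kappa> (W2 s0) x0) (at s0)"
    using W1' W2' s0' by auto
  from this[THEN bounded_linear.has_vector_derivative[OF bounded_linear_entry]]
  have "((\<lambda>r. w r x0) has_real_derivative (- lin_op \<epsilon> \<kappa> (W1 s0) x0) $ i $ j - (- lin_op \<epsilon> \<kappa> (W2 s0) x0) $ i $ j) (at s0)"
    unfolding w_def has_real_derivative_iff_has_vector_derivative by (rule has_vector_derivative_diff)
  moreover have "(- lin_op \<epsilon> \<kappa> (W1 s0) x0) $ i $ j - (- lin_op \<epsilon> \<kappa> (W2 s0) x0) $ i $ j < 0"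
  proof -
    have "(- lin_op \<epsilon> \<kappa> (W1 s0) x0) $ i $ j - (- lin_op \<epsilon> \<kappa> (W2 s0) x0) $ i $ j
      = - \<kappa> * w s0 x0 + \<epsilon>\<^sup>2 * (laplacian (\<lambda>y. W1 s0 y $ i $ j) x0 - laplacian (\<lambda>y. W2 s0 y $ i $ j) x0)"
      by (simp add: lin_op_def Laplacian_def w_def algebra_simps)
    also have "\<dots> < 0"
      using lap kap w0 by (intro add_neg_nonpos mult_nonneg_nonpos) (auto simp: mult_neg_pos)
    finally show ?thesis .
  qed
  ultimately obtain d where d: "0 < d" "\<And>h. 0 < h \<Longrightarrow> h < d \<Longrightarrow> w s0 x0 < w (s0 - h) x0"
    using DERIV_neg_dec_left by blast
  have "w s0 x0 < w (s0 - min (d / 2) s0) x0" using d(1) s0' by (intro d(2)) auto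
  moreover have "0 \<le> s0 - min (d / 2) s0" "s0 - min (d / 2) s0 \<le> T" using s0 d(1) by linarith+
  ultimately show False using max[of "s0 - min (d / 2) s0" x0] by linarith
qed

lemma linear_solution_unique:
  fixes V :: "'m::finite field"
  assumes W1: "linear_solution \<epsilon> \<kappa> V W1" and W2: "linear_solution \<epsilon> \<kappa> V W2" and T: "0 \<le> T"
  shows "W1 T = W2 T"
  using linear_solution_le[OF W1 W2 T] linear_solution_le[OF W2 W1 T]
  by (auto simp: fun_eq_iff vec_eq_iff intro: antisym)

text \<open>
  Existence and uniqueness together identify the value selected by the definition of the solution operator.
\<close>

lemma exp_L_eq_heat:
  fixes V :: "'m::finite field"
  assumes V: "torus_cont V" and t: "0 \<le> t"
  shows "exp_L \<epsilon> \<kappa> t V = heat t V"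
  unfolding exp_L_def
proof (rule the_equality)
  show "\<exists>W. linear_solution \<epsilon> \<kappa> V W \<and> heat t V = W t"
    using linear_solution_heat[OF V] by (intro exI[of _ "\<lambda>s. heat s V"]) simp
  show "Z = heat t V" if "\<exists>W. linear_solution \<epsilon> \<kappa> V W \<and> Z = W t" for Z
    using that linear_solution_unique[OF _ linear_solution_heat[OF V] t] by auto
qed

lemma linear_solution_restart:
  fixes V :: "'m::finite field"
  assumes W: "linear_solution \<epsilon> \<kappa> V W" and b: "0 \<le> b"
  shows "linear_solution \<epsilon> \<kappa> (W b) (\<lambda>r. W (r + b))"
  unfolding linear_solution_def
proof (intro conjI allI impI)
  note W' = W[unfolded linear_solution_def]
  show "W (0 + b) = W b" by simp
  have c: "continuous_on ({0..} \<times> UNIV) (\<lambda>(s, x). W s x)" using W' by blast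
  have "continuous_on ({0..} \<times> UNIV) (\<lambda>p. case (fst p + b, snd p) of (s, x) \<Rightarrow> W s x)"
    by (rule continuous_on_compose2[OF c]) (use b in \<open>auto intro!: continuous_intros\<close>)
  then show "continuous_on ({0..} \<times> UNIV) (\<lambda>(r, x). W (r + b) x)" by (simp add: case_prod_unfold)
  show "periodic (W (r + b))" if "0 \<le> r" for r using W' b that by simp
  show "C2_field (W (r + b))" if "0 < r" for r using W' b that by simp
  show "((\<lambda>r. W (r + b) x) has_vector_derivative - lin_op \<epsilon> \<kappa> (W (s + b)) x) (at s)" if "0 < s" for s x
  proof -
    have "((\<lambda>r. W r x) has_vector_derivative - lin_op \<epsilon> \<kappa> (W (s + b)) x) (at (s + b))"
      using W' b that by simp
    moreover have "((\<lambda>r. r + b) has_vector_derivative 1) (at s)"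
      by (auto intro!: derivative_eq_intros)
    ultimately show ?thesis
      using vector_diff_chain_at[of "\<lambda>r. r + b" 1 s "\<lambda>r. W r x"] by (simp add: o_def)
  qed
qed

text \<open>
  By uniqueness: both sides continue the solution started from \<open>heat b V\<close>.
\<close>

lemma heat_heat:
  fixes V :: "'m::finite field"
  assumes V: "torus_cont V" and a: "0 \<le> a" and b: "0 \<le> b"
  shows "heat a (heat b V) = heat (a + b) V"
  using linear_solution_unique[OF linear_solution_heat[OF heat_torus_cont[OF V]]
      linear_solution_restart[OF linear_solution_heat[OF V] b] a] .

end

section \<open>The pairing of square-integrable fields and the Dirichlet form\<close>

definition torus_ip :: "(real^'m::finite \<Rightarrow> 'b::real_inner) \<Rightarrow> (real^'m \<Rightarrow> 'b) \<Rightarrow> real" where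
  "torus_ip u v = integral Omega (\<lambda>x. u x \<bullet> v x)"

lemma torus_ip_commute: "torus_ip u v = torus_ip v u" by (simp add: torus_ip_def inner_commute)

lemma torus_ip_integrable:
  "torus_cont u \<Longrightarrow> torus_cont v \<Longrightarrow> (\<lambda>x. u x \<bullet> v x) integrable_on Omega"
  by (intro Omega_integrable torus_cont_inner)

lemma torus_ip_add_left: "torus_cont u \<Longrightarrow> torus_cont v \<Longrightarrow> torus_cont w \<Longrightarrow> torus_ip (\<lambda>x. u x + v x) w = torus_ip u w + torus_ip v w"
  by (simp add: torus_ip_def inner_add_left Henstock_Kurzweil_Integration.integral_add torus_ip_integrable)

lemma torus_ip_diff_left: "torus_cont u \<Longrightarrow> torus_cont v \<Longrightarrow> torus_cont w \<Longrightarrow> torus_ip (\<lambda>x. u x - v x) w = torus_ip u w - torus_ip v w"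
  by (simp add: torus_ip_def inner_diff_left hk_integral_diff torus_ip_integrable)

lemma torus_ip_scale_left: "torus_ip (\<lambda>x. r *\<^sub>R u x) w = r * torus_ip u w"
  by (simp add: torus_ip_def)

lemma torus_ip_add_right: "torus_cont u \<Longrightarrow> torus_cont v \<Longrightarrow> torus_cont w \<Longrightarrow> torus_ip w (\<lambda>x. u x + v x) = torus_ip w u + torus_ip w v"
  unfolding torus_ip_commute[of w] by (rule torus_ip_add_left)

lemma torus_ip_diff_right: "torus_cont u \<Longrightarrow> torus_cont v \<Longrightarrow> torus_cont w \<Longrightarrow> torus_ip w (\<lambda>x. u x - v x) = torus_ip w u - torus_ip w v"
  unfolding torus_ip_commute[of w] by (rule torus_ip_diff_left)

lemma torus_ip_scale_right: "torus_ip w (\<lambda>x. r *\<^sub>R u x) = r * torus_ip w u"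
  unfolding torus_ip_commute[of w] by (rule torus_ip_scale_left)

lemma torus_ip_self_nonneg: "torus_cont u \<Longrightarrow> 0 \<le> torus_ip u u"
  unfolding torus_ip_def by (intro hk_integral_nonneg torus_ip_integrable) auto

lemma torus_ip_sum_left:
  "finite A \<Longrightarrow> (\<And>j. j \<in> A \<Longrightarrow> torus_cont (u j)) \<Longrightarrow> torus_cont w \<Longrightarrow> torus_ip (\<lambda>x. \<Sum>j\<in>A. u j x) w = (\<Sum>j\<in>A. torus_ip (u j) w)"
  by (simp add: torus_ip_def inner_sum_left Henstock_Kurzweil_Integration.integral_sum torus_ip_integrable)

lemma correlation_continuous:
  fixes u v :: "real^'m::finite \<Rightarrow> 'b::euclidean_space"
  assumes u: "torus_cont u" and v: "torus_cont v"
  shows "continuous_on UNIV (\<lambda>z. integral Omega (\<lambda>x. u (x + \<sigma> *\<^sub>R z) \<bullet> v x))"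
proof -
  have "continuous_on (UNIV \<times> Omega) (\<lambda>p. u (snd p + \<sigma> *\<^sub>R fst p) \<bullet> v (snd p))"
    by (intro continuous_intros continuous_on_compose2[OF torus_contD(1)[OF u, of UNIV]] continuous_on_compose2[OF torus_contD(1)[OF v, of UNIV]]) auto
  then show ?thesis unfolding Omega_def
    by (intro integral_continuous_on_param) (simp add: case_prod_unfold)
qed

lemma correlation_bounded:
  fixes u v :: "real^'m::finite \<Rightarrow> 'b::euclidean_space"
  assumes u: "torus_cont u" and v: "torus_cont v"
  shows "\<exists>B. \<forall>z. norm (integral Omega (\<lambda>x. u (x + \<sigma> *\<^sub>R z) \<bullet> v x)) \<le> B"
proof -
  obtain C where C: "0 \<le> C" "\<And>x. norm (u x) \<le> C" using torus_cont_bounded[OF u] by blast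
  obtain C' where C': "0 \<le> C'" "\<And>x. norm (v x) \<le> C'" using torus_cont_bounded[OF v] by blast
  have "norm (integral Omega (\<lambda>x. u (x + \<sigma> *\<^sub>R z) \<bullet> v x)) \<le> integral Omega (\<lambda>x::real^'m. C * C')" for z
  proof (rule Henstock_Kurzweil_Integration.integral_norm_bound_integral)
    show "(\<lambda>x. u (x + \<sigma> *\<^sub>R z) \<bullet> v x) integrable_on Omega" by (rule torus_ip_integrable[OF torus_cont_shift[OF u] v])
    show "(\<lambda>x::real^'m. C * C') integrable_on Omega" by (rule Omega_integrable[OF torus_cont_intros(1)])
    show "norm (u (x + \<sigma> *\<^sub>R z) \<bullet> v x) \<le> C * C'" for x
      unfolding real_norm_def by (rule order_trans[OF Cauchy_Schwarz_ineq2 mult_mono]) (use C C' in auto)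
  qed
  then show ?thesis by blast
qed

lemma torus_ip_gauss_avg:
  fixes u v :: "real^'m::finite \<Rightarrow> 'b::euclidean_space"
  assumes u: "torus_cont u" and v: "torus_cont v"
  shows "torus_ip (gauss_avg \<sigma> u) v = (LINT z|lborel. std_gauss z * integral Omega (\<lambda>x. u (x + \<sigma> *\<^sub>R z) \<bullet> v x))"
    and "integrable lborel (\<lambda>z. std_gauss z * integral Omega (\<lambda>x. u (x + \<sigma> *\<^sub>R z) \<bullet> v x))"
proof -
  obtain C where C: "0 \<le> C" "\<And>x. norm (u x) \<le> C" using torus_cont_bounded[OF u] by blast
  obtain C' where C': "0 \<le> C'" "\<And>x. norm (v x) \<le> C'" using torus_cont_bounded[OF v] by blast
  have "gauss_avg \<sigma> u x \<bullet> v x = (LINT z|lborel. std_gauss z *\<^sub>R (u (x + \<sigma> *\<^sub>R z) \<bullet> v x))" for x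
    unfolding gauss_avg_def using gauss_avg_integrable[OF u] by (subst integral_inner_left[symmetric]) auto
  then have "torus_ip (gauss_avg \<sigma> u) v = integral Omega (\<lambda>x. LINT z|lborel. std_gauss z *\<^sub>R (u (x + \<sigma> *\<^sub>R z) \<bullet> v x))"
    by (simp add: torus_ip_def)
  also have "\<dots> = (LINT z|lborel. std_gauss z *\<^sub>R integral Omega (\<lambda>x. u (x + \<sigma> *\<^sub>R z) \<bullet> v x))"
    unfolding Omega_def
  proof (rule std_gauss_fubini)
    show "continuous_on (UNIV \<times> cbox (\<chi> i. - 1 / 2) (\<chi> i. 1 / 2)) (\<lambda>(z, x). u (x + \<sigma> *\<^sub>R z) \<bullet> v x)"
      unfolding case_prod_unfold
      by (intro continuous_intros continuous_on_compose2[OF torus_contD(1)[OF u, of UNIV]] continuous_on_compose2[OF torus_contD(1)[OF v, of UNIV]]) auto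
    show "norm (u (x + \<sigma> *\<^sub>R z) \<bullet> v x) \<le> C * C'" for x z
      unfolding real_norm_def by (rule order_trans[OF Cauchy_Schwarz_ineq2 mult_mono]) (use C C' in auto)
  qed
  finally show "torus_ip (gauss_avg \<sigma> u) v = (LINT z|lborel. std_gauss z * integral Omega (\<lambda>x. u (x + \<sigma> *\<^sub>R z) \<bullet> v x))" by simp
  obtain B where "\<And>z. norm (integral Omega (\<lambda>x. u (x + \<sigma> *\<^sub>R z) \<bullet> v x)) \<le> B" using correlation_bounded[OF u v] by blast
  from std_gauss_scale_integrable[OF correlation_continuous[OF u v] this]
  show "integrable lborel (\<lambda>z. std_gauss z * integral Omega (\<lambda>x. u (x + \<sigma> *\<^sub>R z) \<bullet> v x))" by simp
qed

text \<open>
  Translation invariance moves the shift to the other factor with the opposite sign, and the Gaussian weight is even.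
\<close>

lemma torus_ip_gauss_avg_symmetric:
  fixes u v :: "real^'m::finite \<Rightarrow> 'b::euclidean_space"
  assumes u: "torus_cont u" and v: "torus_cont v"
  shows "torus_ip (gauss_avg \<sigma> u) v = torus_ip u (gauss_avg \<sigma> v)"
proof -
  let ?J = "\<lambda>z. integral Omega (\<lambda>x. v (x + \<sigma> *\<^sub>R z) \<bullet> u x)"
  have "integral Omega (\<lambda>x. u (x + \<sigma> *\<^sub>R z) \<bullet> v x) = ?J (- z)" for z
    using integral_Omega_shift[OF torus_cont_inner[OF torus_cont_shift[OF u, of "\<sigma> *\<^sub>R z"] v], of "- \<sigma> *\<^sub>R z"]
    by (simp add: inner_commute)
  then have "torus_ip (gauss_avg \<sigma> u) v = (LINT z|lborel. std_gauss (- z) * ?J (- z))"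
    by (simp add: torus_ip_gauss_avg[OF u v])
  also have "\<dots> = (LINT z|lborel. std_gauss z * ?J z)"
    by (rule lborel_integral_minus[OF borel_measurable_continuous_onI])
      (intro continuous_on_mult std_gauss_continuous correlation_continuous u v)
  also have "\<dots> = torus_ip u (gauss_avg \<sigma> v)" by (simp add: torus_ip_gauss_avg[OF v u] torus_ip_commute[of u])
  finally show ?thesis .
qed

text \<open>
  This identity makes the averages contractive in \<open>L\<^sup>2\<close> and, divided by \<open>\<sigma>\<^sup>2\<close>, shows the Dirichlet form as a limit of
  squared difference quotients.
\<close>

lemma torus_ip_gauss_avg_deficit:
  fixes u :: "real^'m::finite \<Rightarrow> 'b::euclidean_space"
  assumes u: "torus_cont u"
  shows "torus_ip u u - torus_ip (gauss_avg \<sigma> u) u = (LINT z|lborel. std_gauss z * integral Omega (\<lambda>x. (norm (u (x + \<sigma> *\<^sub>R z) - u x))\<^sup>2)) / 2"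
proof -
  have eq: "integral Omega (\<lambda>x. (norm (u (x + \<sigma> *\<^sub>R z) - u x))\<^sup>2) = 2 * torus_ip u u - 2 * integral Omega (\<lambda>x. u (x + \<sigma> *\<^sub>R z) \<bullet> u x)" for z
  proof -
    note us = torus_cont_shift[OF u, of "\<sigma> *\<^sub>R z"]
    have "integral Omega (\<lambda>x. u (x + \<sigma> *\<^sub>R z) \<bullet> u (x + \<sigma> *\<^sub>R z)) = torus_ip u u"
      unfolding torus_ip_def by (rule integral_Omega_shift[OF torus_cont_inner[OF u u]])
    then have s: "torus_ip (\<lambda>x. u (x + \<sigma> *\<^sub>R z)) (\<lambda>x. u (x + \<sigma> *\<^sub>R z)) = torus_ip u u" by (simp add: torus_ip_def)
    have "integral Omega (\<lambda>x. (norm (u (x + \<sigma> *\<^sub>R z) - u x))\<^sup>2) = torus_ip (\<lambda>x. u (x + \<sigma> *\<^sub>R z) - u x) (\<lambda>x. u (x + \<sigma> *\<^sub>R z) - u x)"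
      by (simp add: torus_ip_def power2_norm_eq_inner)
    also have "\<dots> = 2 * torus_ip u u - 2 * torus_ip (\<lambda>x. u (x + \<sigma> *\<^sub>R z)) u"
      using u us by (simp add: torus_ip_diff_left torus_ip_diff_right torus_cont_intros s torus_ip_commute[of u "\<lambda>x. u (x + \<sigma> *\<^sub>R z)"])
    finally show ?thesis by (simp add: torus_ip_def)
  qed
  have "(LINT z|lborel. std_gauss z * integral Omega (\<lambda>x. (norm (u (x + \<sigma> *\<^sub>R z) - u x))\<^sup>2))
      = (LINT z::real^'m|lborel. std_gauss z * (2 * torus_ip u u) - 2 * (std_gauss z * integral Omega (\<lambda>x. u (x + \<sigma> *\<^sub>R z) \<bullet> u x)))"
    unfolding eq by (simp add: right_diff_distrib mult.left_commute)
  also have "\<dots> = 2 * torus_ip u u - 2 * torus_ip (gauss_avg \<sigma> u) u"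
    using torus_ip_gauss_avg(2)[OF u u, of \<sigma>]
    by (subst Bochner_Integration.integral_diff) (simp_all add: std_gauss_integrable std_gauss_integral torus_ip_gauss_avg(1)[OF u u])
  finally show ?thesis by simp
qed

lemma torus_ip_gauss_avg_le:
  fixes u :: "real^'m::finite \<Rightarrow> 'b::euclidean_space"
  assumes u: "torus_cont u"
  shows "torus_ip (gauss_avg \<sigma> u) u \<le> torus_ip u u"
proof -
  have "0 \<le> integral Omega (\<lambda>x. (norm (u (x + \<sigma> *\<^sub>R z) - u x))\<^sup>2)" for z
    unfolding power2_norm_eq_inner
    by (intro hk_integral_nonneg torus_ip_integrable torus_cont_intros torus_cont_shift u) auto
  then have "0 \<le> (LINT z|lborel. std_gauss z * integral Omega (\<lambda>x. (norm (u (x + \<sigma> *\<^sub>R z) - u x))\<^sup>2))"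
    by (intro Bochner_Integration.integral_nonneg) simp
  then show ?thesis using torus_ip_gauss_avg_deficit[OF u, of \<sigma>] by simp
qed

definition dirichlet :: "(real^'m::finite \<Rightarrow> real^'m \<Rightarrow> 'b::real_inner) \<Rightarrow> real" where
  "dirichlet D = integral Omega (\<lambda>x. \<Sum>k\<in>UNIV. (norm (D x (axis k 1)))\<^sup>2)"

lemma difference_quotient_tendsto:
  fixes u :: "real^'m::finite \<Rightarrow> 'b::euclidean_space"
  assumes u: "torus_C1 u D"
  shows "((\<lambda>\<sigma>. (u (x + \<sigma> *\<^sub>R z) - u x) /\<^sub>R \<sigma>) \<longlongrightarrow> D x z) (at 0)"
proof -
  have "((\<lambda>\<sigma>. u (x + \<sigma> *\<^sub>R z)) has_derivative (\<lambda>h. D x (h *\<^sub>R z))) (at 0)"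
    by (rule has_derivative_compose[of "\<lambda>h. x + h *\<^sub>R z" "\<lambda>h. h *\<^sub>R z" 0 UNIV u])
      (auto intro!: derivative_eq_intros torus_C1D(2)[OF u])
  moreover have "(\<lambda>h. D x (h *\<^sub>R z)) = (\<lambda>h. h *\<^sub>R D x z)"
    using has_derivative_bounded_linear[OF torus_C1D(2)[OF u, of x]] by (auto simp: linear_simps fun_eq_iff)
  ultimately have "((\<lambda>\<sigma>. u (x + \<sigma> *\<^sub>R z)) has_vector_derivative D x z) (at 0)"
    by (simp add: has_vector_derivative_def)
  then have "((\<lambda>\<sigma>. ((u (x + \<sigma> *\<^sub>R z) - u x) - \<sigma> *\<^sub>R D x z) /\<^sub>R norm \<sigma>) \<longlongrightarrow> 0) (at 0)"
    by (simp add: has_vector_derivative_def has_derivative_at_within)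
  moreover have "norm (((u (x + \<sigma> *\<^sub>R z) - u x) - \<sigma> *\<^sub>R D x z) /\<^sub>R norm \<sigma>) = norm ((u (x + \<sigma> *\<^sub>R z) - u x) /\<^sub>R \<sigma> - D x z)"
    if "\<sigma> \<noteq> 0" for \<sigma>
  proof -
    have "(u (x + \<sigma> *\<^sub>R z) - u x) /\<^sub>R \<sigma> - D x z = ((u (x + \<sigma> *\<^sub>R z) - u x) - \<sigma> *\<^sub>R D x z) /\<^sub>R \<sigma>"
      using that by (simp add: scaleR_diff_right)
    then show ?thesis by simp
  qed
  ultimately have "((\<lambda>\<sigma>. norm ((u (x + \<sigma> *\<^sub>R z) - u x) /\<^sub>R \<sigma> - D x z)) \<longlongrightarrow> 0) (at 0)"
    by (subst (asm) tendsto_norm_zero_iff[symmetric]) (erule Lim_transform_eventually, auto simp: eventually_at_filter)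
  then show ?thesis by (rule LIM_zero_cancel[OF tendsto_norm_zero_cancel])
qed

text \<open>
  The integrand is a quadratic form in \<open>z\<close> and the second moments are \<open>2\<close> times the identity, so the average is twice the
  trace.
\<close>

lemma gauss_quadratic_form:
  fixes u :: "real^'m::finite \<Rightarrow> 'b::euclidean_space"
  assumes u: "torus_C1 u D"
  shows "continuous_on UNIV (\<lambda>z. integral Omega (\<lambda>x. (norm (D x z))\<^sup>2))"
    and "(LINT z|lborel. std_gauss z * integral Omega (\<lambda>x. (norm (D x z))\<^sup>2)) = 2 * dirichlet D"
proof -
  note Dc = torus_C1D(3)[OF u]
  define c where "c j k = integral Omega (\<lambda>x. D x (axis j 1) \<bullet> D x (axis k 1))" for j k
  have quad: "integral Omega (\<lambda>x. (norm (D x z))\<^sup>2) = (\<Sum>j\<in>UNIV. \<Sum>k\<in>UNIV. c j k * ((z \<bullet> axis j 1) * (z \<bullet> axis k 1)))" for z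
  proof -
    have "(norm (D x z))\<^sup>2 = (\<Sum>j\<in>UNIV. \<Sum>k\<in>UNIV. (D x (axis j 1) \<bullet> D x (axis k 1)) * ((z \<bullet> axis j 1) * (z \<bullet> axis k 1)))" for x
    proof -
      interpret D: bounded_linear "D x" using torus_C1D(2)[OF u] by (rule has_derivative_bounded_linear)
      have "D x z = D x (\<Sum>k\<in>UNIV. (z \<bullet> axis k 1) *\<^sub>R axis k 1)"
        using basis_expansion[of z] by (simp add: scalar_mult_eq_scaleR inner_axis)
      also have "\<dots> = (\<Sum>k\<in>UNIV. (z \<bullet> axis k 1) *\<^sub>R D x (axis k 1))"
        by (simp add: D.sum D.scaleR)
      finally show ?thesis
        unfolding power2_norm_eq_inner by (simp add: inner_sum_left inner_sum_right mult_ac sum_distrib_left inner_commute)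
    qed
    then show ?thesis
      by (simp add: c_def Henstock_Kurzweil_Integration.integral_sum Dc torus_ip_integrable integrable_sum integrable_on_mult_left)
  qed
  show "continuous_on UNIV (\<lambda>z. integral Omega (\<lambda>x. (norm (D x z))\<^sup>2))"
    unfolding quad by (intro continuous_intros)
  have "(LINT z|lborel. std_gauss z * integral Omega (\<lambda>x. (norm (D x z))\<^sup>2))
      = (LINT z::real^'m|lborel. (\<Sum>j\<in>UNIV. \<Sum>k\<in>UNIV. c j k * (std_gauss z * ((z \<bullet> axis j 1) * (z \<bullet> axis k 1)))))"
    unfolding quad by (simp add: sum_distrib_left mult.left_commute)
  also have "\<dots> = (\<Sum>j\<in>UNIV. \<Sum>k\<in>UNIV. c j k * (2 * ((axis j 1 :: real^'m) \<bullet> axis k 1)))"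
    by (simp add: Bochner_Integration.integral_sum integrable_sum std_gauss_second_moment)
  also have "\<dots> = (\<Sum>j\<in>UNIV. \<Sum>k\<in>UNIV. if j = k then 2 * c j j else 0)"
    by (intro sum.cong refl) (auto simp: inner_axis_axis)
  also have "\<dots> = 2 * (\<Sum>k\<in>UNIV. c k k)" by (simp add: sum_distrib_left)
  also have "(\<Sum>k\<in>UNIV. c k k) = dirichlet D"
    unfolding dirichlet_def c_def power2_norm_eq_inner
    by (subst Henstock_Kurzweil_Integration.integral_sum) (auto intro: torus_ip_integrable Dc)
  finally show "(LINT z|lborel. std_gauss z * integral Omega (\<lambda>x. (norm (D x z))\<^sup>2)) = 2 * dirichlet D" .
qed

text \<open>
  Dominated convergence twice: over \<open>Omega\<close> for fixed \<open>z\<close>, then over \<open>z\<close>. The Lipschitz constant \<open>L\<close> of \<open>u\<close> bounds the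
  squared quotients by \<open>L\<^sup>2 \<bar>z\<bar>\<^sup>2\<close>, which is integrable against the Gaussian.
\<close>

lemma torus_ip_gauss_avg_dirichlet_limit:
  fixes u :: "real^'m::finite \<Rightarrow> 'b::euclidean_space"
  assumes u: "torus_C1 u D"
  shows "((\<lambda>\<sigma>. (torus_ip u u - torus_ip (gauss_avg \<sigma> u) u) / \<sigma>\<^sup>2) \<longlongrightarrow> dirichlet D) (at_right 0)"
proof -
  note uc = torus_C1D(1)[OF u] and Dc = torus_C1D(3)[OF u]
  obtain L where L0: "0 \<le> L" and L: "\<And>x h. norm (D x h) \<le> L * norm h"
    and Lip: "\<And>x y. norm (u x - u y) \<le> L * norm (x - y)"
    by (rule torus_C1_bound[OF u], rule that)
  define vol where "vol = integral Omega (\<lambda>x::real^'m. 1::real)"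
  have vol: "0 \<le> vol" unfolding vol_def
    by (intro hk_integral_nonneg Omega_integrable torus_cont_intros) auto
  define q where "q \<sigma> z x = (norm ((u (x + \<sigma> *\<^sub>R z) - u x) /\<^sub>R \<sigma>))\<^sup>2" for \<sigma> z x
  have qc: "torus_cont (q \<sigma> z)" for \<sigma> z
    unfolding q_def power2_norm_eq_inner by (intro torus_cont_inner torus_cont_intros torus_cont_shift uc)
  have dc: "torus_cont (\<lambda>x. (norm (D x z))\<^sup>2)" for z
    unfolding power2_norm_eq_inner by (intro torus_cont_inner Dc)
  have qb: "q \<sigma> z x \<le> L\<^sup>2 * (norm z)\<^sup>2" if "0 < \<sigma>" for \<sigma> z x
  proof -
    have "norm (u (x + \<sigma> *\<^sub>R z) - u x) \<le> L * (\<sigma> * norm z)"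
      using Lip[of "x + \<sigma> *\<^sub>R z" x] that by simp
    then have "norm ((u (x + \<sigma> *\<^sub>R z) - u x) /\<^sub>R \<sigma>) \<le> L * norm z"
      unfolding norm_scaleR using that by (simp add: field_simps)
    then have "q \<sigma> z x \<le> (L * norm z)\<^sup>2" unfolding q_def by (rule power_mono) simp
    then show ?thesis by (simp add: power_mult_distrib)
  qed
  have toL: "integral Omega w = (LINT x|lborel. indicator Omega x *\<^sub>R w x)"
    "integrable lborel (\<lambda>x. indicator Omega x *\<^sub>R w x)" if "torus_cont w" for w :: "real^'m \<Rightarrow> real"
    unfolding Omega_def by (intro set_integral_cbox torus_contD[OF that])+
  have inner: "((\<lambda>\<sigma>. integral Omega (q \<sigma> z)) \<longlongrightarrow> integral Omega (\<lambda>x. (norm (D x z))\<^sup>2)) (at_right 0)" for z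
    unfolding toL(1)[OF qc] toL(1)[OF dc]
  proof (rule tendsto_integral_dominated[where B = "\<lambda>x::real^'m. indicator Omega x *\<^sub>R (L\<^sup>2 * (norm z)\<^sup>2)"])
    show "integrable lborel (\<lambda>x::real^'m. indicator Omega x *\<^sub>R (L\<^sup>2 * (norm z)\<^sup>2))"
      by (rule toL(2)[OF torus_cont_intros(1)])
    show "norm (indicator Omega x *\<^sub>R q \<sigma> z x) \<le> indicator Omega x *\<^sub>R (L\<^sup>2 * (norm z)\<^sup>2)" if "\<sigma> \<in> {0<..}" for \<sigma> x
      using qb[of \<sigma> z x] that by (auto simp: indicator_def q_def)
    note difference_quotient_tendsto[OF u]
    then show "((\<lambda>\<sigma>. indicator Omega x *\<^sub>R q \<sigma> z x) \<longlongrightarrow> indicator Omega x *\<^sub>R (norm (D x z))\<^sup>2) (at_right 0)" for x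
      unfolding q_def by (intro tendsto_intros) (rule tendsto_within_subset, assumption?, simp)
  qed (rule borel_measurable_integrable[OF toL(2)], rule qc dc)+
  have outer: "((\<lambda>\<sigma>. LINT z|lborel. std_gauss z * integral Omega (q \<sigma> z)) \<longlongrightarrow> (LINT z|lborel. std_gauss z * integral Omega (\<lambda>x. (norm (D x z))\<^sup>2))) (at_right 0)"
  proof (rule tendsto_integral_dominated[where B = "\<lambda>z::real^'m. (std_gauss z * (norm z)\<^sup>2) * (L\<^sup>2 * vol)"])
    show "integrable lborel (\<lambda>z::real^'m. (std_gauss z * (norm z)\<^sup>2) * (L\<^sup>2 * vol))"
      by (intro integrable_mult_left std_gauss_weight_integrable)
    show "((\<lambda>\<sigma>. std_gauss z * integral Omega (q \<sigma> z)) \<longlongrightarrow> std_gauss z * integral Omega (\<lambda>x. (norm (D x z))\<^sup>2)) (at_right 0)" for z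
      by (intro tendsto_intros inner)
    fix \<sigma> :: real and z :: "real^'m" assume s: "\<sigma> \<in> {0<..}"
    have "norm (integral Omega (q \<sigma> z)) \<le> integral Omega (\<lambda>x::real^'m. L\<^sup>2 * (norm z)\<^sup>2)"
      by (rule Henstock_Kurzweil_Integration.integral_norm_bound_integral)
        (use qb[of \<sigma> z] s in \<open>auto intro!: Omega_integrable qc torus_cont_intros simp: q_def\<close>)
    also have "\<dots> = (L\<^sup>2 * (norm z)\<^sup>2) * vol"
      unfolding vol_def by (simp flip: integral_mult_right)
    finally show "norm (std_gauss z * integral Omega (q \<sigma> z)) \<le> (std_gauss z * (norm z)\<^sup>2) * (L\<^sup>2 * vol)"
      using mult_left_mono[of "norm (integral Omega (q \<sigma> z))" "(L\<^sup>2 * (norm z)\<^sup>2) * vol" "std_gauss z"]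
      by (simp add: abs_mult mult_ac)
  next
    fix \<sigma> :: real assume s: "\<sigma> \<in> {0<..}"
    have "continuous_on UNIV (\<lambda>z. integral Omega (q \<sigma> z))"
    proof -
      have "continuous_on (UNIV \<times> Omega) (\<lambda>p. q \<sigma> (fst p) (snd p))" unfolding q_def
        by (intro continuous_intros continuous_on_compose2[OF torus_contD(1)[OF uc, of UNIV]]) auto
      then show ?thesis unfolding Omega_def
        by (intro integral_continuous_on_param) (simp add: case_prod_unfold)
    qed
    then show "(\<lambda>z. std_gauss z * integral Omega (q \<sigma> z)) \<in> borel_measurable lborel"
      using borel_measurable_continuous_onI by (auto intro!: borel_measurable_times)
  next
    note gauss_quadratic_form(1)[OF u]
    then show "(\<lambda>z. std_gauss z * integral Omega (\<lambda>x. (norm (D x z))\<^sup>2)) \<in> borel_measurable lborel"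
      using borel_measurable_continuous_onI by (auto intro!: borel_measurable_times)
  qed
  have lim: "((\<lambda>\<sigma>. (LINT z|lborel. std_gauss z * integral Omega (q \<sigma> z)) / 2) \<longlongrightarrow> dirichlet D) (at_right 0)"
    using tendsto_divide[OF outer tendsto_const[of "2::real"]] gauss_quadratic_form(2)[OF u] by simp
  show ?thesis
  proof (rule Lim_transform_eventually[OF lim])
    show "\<forall>\<^sub>F \<sigma> in at_right 0. (LINT z|lborel. std_gauss z * integral Omega (q \<sigma> z)) / 2 = (torus_ip u u - torus_ip (gauss_avg \<sigma> u) u) / \<sigma>\<^sup>2"
    proof (rule eventually_at_rightI[of 0 1])
      fix \<sigma> :: real assume s: "\<sigma> \<in> {0<..<1}"
      have "q \<sigma> z = (\<lambda>x. (norm (u (x + \<sigma> *\<^sub>R z) - u x))\<^sup>2 / \<sigma>\<^sup>2)" for z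
        unfolding q_def norm_scaleR power_mult_distrib by (simp add: power_inverse divide_inverse mult.commute)
      then have "integral Omega (q \<sigma> z) = integral Omega (\<lambda>x. (norm (u (x + \<sigma> *\<^sub>R z) - u x))\<^sup>2) / \<sigma>\<^sup>2" for z
        by (simp only: Henstock_Kurzweil_Integration.integral_divide)
      then show "(LINT z|lborel. std_gauss z * integral Omega (q \<sigma> z)) / 2 = (torus_ip u u - torus_ip (gauss_avg \<sigma> u) u) / \<sigma>\<^sup>2"
        unfolding torus_ip_gauss_avg_deficit[OF uc] by simp
    qed simp
  qed
qed

section \<open>Positivity of the semigroup and Duhamel integrals\<close>

lemma integral_reflect_interval:
  fixes f :: "real \<Rightarrow> 'b::euclidean_space"
  shows "integral {0..T} (\<lambda>s. f (T - s)) = integral {0..T} f"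
proof -
  have "integral {0..T} (\<lambda>s. f (T - s)) = integral {0..T} ((\<lambda>y. f (- y)) \<circ> ((+) (- T)))"
    by (simp add: o_def)
  also have "\<dots> = integral {- T..- 0} (\<lambda>y. f (- y))"
    by (subst integral_shift_Icc_real) simp
  also have "\<dots> = integral {0..T} f"
    unfolding integral_def integrable_on_def has_integral_reflect_real ..
  finally show ?thesis .
qed

text \<open>
  Shifting the argument of \<open>G\<close> back by \<open>t\<close> compares the decreasing weight with an earlier, larger value of it; what is left
  over is the integral of the weighted \<open>G\<close> over \<open>[0,t]\<close>.
\<close>

lemma integral_weight_shift_le:
  fixes G :: "real \<Rightarrow> real"
  assumes c: "continuous_on {0..} G" and anti: "\<And>a b. 0 \<le> a \<Longrightarrow> a \<le> b \<Longrightarrow> G b \<le> G a"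
    and nn: "\<And>a. 0 \<le> a \<Longrightarrow> 0 \<le> G a" and t: "0 < t" "t \<le> T"
  shows "integral {0..T} (\<lambda>r. (T - r) / T * (G r - G (r + t))) \<le> t * G 0"
proof -
  let ?w = "\<lambda>r. (T - r) / T"
  have T: "0 < T" using t by linarith
  have i1: "(\<lambda>r. ?w r * G r) integrable_on {a..b}" if "0 \<le> a" for a b
    using that T by (intro integrable_continuous_real continuous_intros continuous_on_subset[OF c]) auto
  have i2: "(\<lambda>r. ?w r * G (r + t)) integrable_on {a..b}" if "0 \<le> a" for a b
    using that T t by (intro integrable_continuous_real continuous_intros continuous_on_compose2[OF c]) auto
  have i3: "(\<lambda>r. ?w (r - t) * G r) integrable_on {t..T}"
    using T t by (intro integrable_continuous_real continuous_intros continuous_on_subset[OF c]) auto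
  have "integral {0..T} (\<lambda>r. ?w r * G r) = integral {0..t} (\<lambda>r. ?w r * G r) + integral {t..T} (\<lambda>r. ?w r * G r)"
    by (rule Henstock_Kurzweil_Integration.integral_combine[symmetric]) (use t i1[of 0 T] in auto)
  moreover have "integral {0..T} (\<lambda>r. ?w r * G (r + t))
      = integral {0..T - t} (\<lambda>r. ?w r * G (r + t)) + integral {T - t..T} (\<lambda>r. ?w r * G (r + t))"
    by (rule Henstock_Kurzweil_Integration.integral_combine[symmetric]) (use t i2[of 0 T] in auto)
  moreover have "0 \<le> integral {T - t..T} (\<lambda>r. ?w r * G (r + t))"
    using t T by (intro hk_integral_nonneg i2 mult_nonneg_nonneg nn) auto
  moreover have "integral {0..T - t} (\<lambda>r. ?w r * G (r + t)) = integral {t..T} (\<lambda>r. ?w (r - t) * G r)"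
    using integral_shift_Icc_real[of 0 "T - t" "\<lambda>r. ?w (r - t) * G r" t] by (simp add: o_def add.commute)
  moreover have "integral {t..T} (\<lambda>r. ?w r * G r) \<le> integral {t..T} (\<lambda>r. ?w (r - t) * G r)"
    using t T by (intro integral_le i1 i3 mult_right_mono nn divide_right_mono) auto
  moreover have "integral {0..t} (\<lambda>r. ?w r * G r) \<le> integral {0..t} (\<lambda>r. G 0)"
  proof (intro integral_le i1)
    fix r assume r: "r \<in> {0..t}"
    have "?w r * G r \<le> 1 * G 0"
      using r t T by (intro mult_mono anti nn) auto
    then show "?w r * G r \<le> G 0" by simp
  qed auto
  moreover have "integral {0..t} (\<lambda>r. G 0) = t * G 0" using t by simp
  moreover have "integral {0..T} (\<lambda>r. ?w r * (G r - G (r + t)))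
      = integral {0..T} (\<lambda>r. ?w r * G r) - integral {0..T} (\<lambda>r. ?w r * G (r + t))"
    unfolding right_diff_distrib by (rule hk_integral_diff[OF i1 i2]) simp_all
  ultimately show ?thesis by linarith
qed

context heat_semigroup
begin

lemma torus_ip_heat_symmetric:
  fixes u v :: "real^'m::finite \<Rightarrow> 'b::euclidean_space"
  shows "torus_cont u \<Longrightarrow> torus_cont v \<Longrightarrow> torus_ip (heat s u) v = torus_ip u (heat s v)"
  unfolding heat_def by (simp add: torus_ip_scale_left torus_ip_scale_right torus_ip_gauss_avg_symmetric)

lemma torus_ip_heat_le:
  fixes u :: "real^'m::finite \<Rightarrow> 'b::euclidean_space"
  assumes u: "torus_cont u" and s: "0 \<le> s" shows "torus_ip (heat s u) u \<le> torus_ip u u"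
proof -
  have "torus_ip (heat s u) u = exp (- \<kappa> * s) * torus_ip (gauss_avg (\<epsilon> * sqrt s) u) u"
    unfolding heat_def by (simp add: torus_ip_scale_left)
  also have "\<dots> \<le> exp (- \<kappa> * s) * torus_ip u u" by (intro mult_left_mono torus_ip_gauss_avg_le u) auto
  also have "\<dots> \<le> 1 * torus_ip u u"
    using kap s by (intro mult_right_mono torus_ip_self_nonneg u) auto
  finally show ?thesis by simp
qed

text \<open>
  The pairing with \<open>L u\<close> in weak form. The factor \<open>e\<^bsup>-\<kappa>t\<^esup>\<close> splits off the term with \<open>\<kappa>\<close>.
\<close>

lemma torus_ip_heat_dirichlet_limit:
  fixes u :: "real^'m::finite \<Rightarrow> 'b::euclidean_space"
  assumes u: "torus_C1 u D"
  shows "((\<lambda>t. (torus_ip u u - torus_ip (heat t u) u) / t) \<longlongrightarrow> \<epsilon>\<^sup>2 * dirichlet D + \<kappa> * torus_ip u u) (at_right 0)"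
proof -
  define Q where "Q \<sigma> = (torus_ip u u - torus_ip (gauss_avg \<sigma> u) u) / \<sigma>\<^sup>2" for \<sigma>
  have Q: "(Q \<longlongrightarrow> dirichlet D) (at_right 0)" unfolding Q_def by (rule torus_ip_gauss_avg_dirichlet_limit[OF u])
  have "filterlim (\<lambda>t. \<epsilon> * sqrt t) (at_right 0) (at_right 0)"
    unfolding filterlim_at
  proof
    show "\<forall>\<^sub>F t in at_right 0. \<epsilon> * sqrt t \<in> {0<..} \<and> \<epsilon> * sqrt t \<noteq> 0"
      using eps by (intro eventually_at_rightI[of 0 1]) auto
    have "((\<lambda>t. \<epsilon> * sqrt t) \<longlongrightarrow> \<epsilon> * sqrt 0) (at_right 0)" by (intro tendsto_intros)
    then show "((\<lambda>t. \<epsilon> * sqrt t) \<longlongrightarrow> 0) (at_right 0)" by simp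
  qed
  then have QQ: "((\<lambda>t. Q (\<epsilon> * sqrt t)) \<longlongrightarrow> dirichlet D) (at_right 0)" by (rule filterlim_compose[OF Q])
  have "((\<lambda>t. exp (- \<kappa> * t)) has_real_derivative - \<kappa>) (at 0 within {0<..})"
    by (auto intro!: derivative_eq_intros)
  then have ex: "((\<lambda>t. (exp (- \<kappa> * t) - 1) / t) \<longlongrightarrow> - \<kappa>) (at_right 0)"
    by (simp add: has_field_derivative_iff)
  have ex1: "((\<lambda>t. exp (- \<kappa> * t)) \<longlongrightarrow> exp (- \<kappa> * 0)) (at_right 0)" by (intro tendsto_intros)
  have "((\<lambda>t. \<epsilon>\<^sup>2 * (exp (- \<kappa> * t) * Q (\<epsilon> * sqrt t)) - (exp (- \<kappa> * t) - 1) / t * torus_ip u u)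
      \<longlongrightarrow> \<epsilon>\<^sup>2 * (exp (- \<kappa> * 0) * dirichlet D) - (- \<kappa>) * torus_ip u u) (at_right 0)"
    by (intro tendsto_intros QQ ex ex1)
  then have lim: "((\<lambda>t. \<epsilon>\<^sup>2 * (exp (- \<kappa> * t) * Q (\<epsilon> * sqrt t)) - (exp (- \<kappa> * t) - 1) / t * torus_ip u u)
      \<longlongrightarrow> \<epsilon>\<^sup>2 * dirichlet D + \<kappa> * torus_ip u u) (at_right 0)" by simp
  show ?thesis
  proof (rule Lim_transform_eventually[OF lim], rule eventually_at_rightI[of 0 1])
    fix t :: real assume t: "t \<in> {0<..<1}"
    have "Q (\<epsilon> * sqrt t) = (torus_ip u u - torus_ip (gauss_avg (\<epsilon> * sqrt t) u) u) / (\<epsilon>\<^sup>2 * t)"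
      using t by (simp add: Q_def power_mult_distrib)
    then have "torus_ip (gauss_avg (\<epsilon> * sqrt t) u) u = torus_ip u u - t * (\<epsilon>\<^sup>2 * Q (\<epsilon> * sqrt t))"
      using t eps by (simp add: field_simps)
    note A = this
    show "\<epsilon>\<^sup>2 * (exp (- \<kappa> * t) * Q (\<epsilon> * sqrt t)) - (exp (- \<kappa> * t) - 1) / t * torus_ip u u = (torus_ip u u - torus_ip (heat t u) u) / t"
      using t unfolding heat_def torus_ip_scale_left A by (simp add: field_simps)
  qed simp
qed

lemma torus_ip_heat_continuous:
  fixes u v :: "real^'m::finite \<Rightarrow> 'b::euclidean_space"
  assumes u: "torus_cont u" and v: "torus_cont v"
  shows "continuous_on UNIV (\<lambda>a. torus_ip (heat a u) v)"
proof -
  have h: "continuous_on (UNIV \<times> Omega) (\<lambda>p::real \<times> (real^'m). heat (fst p) u (snd p))"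
    using continuous_on_subset[OF heat_continuous[OF u]] by (auto simp: case_prod_unfold)
  have "continuous_on (UNIV \<times> Omega) (\<lambda>p::real \<times> (real^'m). heat (fst p) u (snd p) \<bullet> v (snd p))"
    by (intro continuous_intros h continuous_on_compose2[OF torus_contD(1)[OF v, of UNIV]]) auto
  then show ?thesis unfolding torus_ip_def Omega_def
    by (intro integral_continuous_on_param) (simp add: case_prod_unfold)
qed

text \<open>
  Splitting the time into halves exhibits the value as a squared norm.
\<close>

lemma torus_ip_heat_self_nonneg:
  fixes u :: "'m::finite field"
  assumes u: "torus_cont u" and a: "0 \<le> a"
  shows "0 \<le> torus_ip (heat a u) u"
proof -
  have "torus_ip (heat a u) u = torus_ip (heat (a/2) (heat (a/2) u)) u" using a by (simp add: heat_heat[OF u])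
  also have "\<dots> = torus_ip (heat (a/2) u) (heat (a/2) u)" by (intro torus_ip_heat_symmetric heat_torus_cont u)
  finally show ?thesis using torus_ip_self_nonneg[OF heat_torus_cont[OF u]] by simp
qed

text \<open>
  With half of the time \<open>a\<close> on each side, the remaining time \<open>b - a\<close> acts as a contraction in the middle.
\<close>

lemma torus_ip_heat_self_antimono:
  fixes u :: "'m::finite field"
  assumes u: "torus_cont u" and a: "0 \<le> a" "a \<le> b"
  shows "torus_ip (heat b u) u \<le> torus_ip (heat a u) u"
proof -
  define g where "g = heat (a/2) u"
  have g: "torus_cont g" unfolding g_def by (rule heat_torus_cont[OF u])
  have "heat b u = heat (a/2) (heat (b - a) g)"
    using a by (simp add: g_def heat_heat heat_torus_cont u)
  then have "torus_ip (heat b u) u = torus_ip (heat (b - a) g) g"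
    by (simp add: torus_ip_heat_symmetric heat_torus_cont u g g_def[symmetric])
  also have "\<dots> \<le> torus_ip g g" using a by (intro torus_ip_heat_le g) simp
  also have "\<dots> = torus_ip (heat a u) u"
    using a by (simp add: g_def torus_ip_heat_symmetric[symmetric] heat_heat heat_torus_cont u)
  finally show ?thesis .
qed

text \<open>
  The time variable is reversed against the integral form of the schemes, so that \<open>r\<close> is the age of the source. The
  weight \<open>c\<close> is \<open>1\<close> in the first stage and \<open>(T - r) / T\<close> in the correction of the second stage.
\<close>

definition duhamel :: "(real \<Rightarrow> real) \<Rightarrow> real \<Rightarrow> (real^'m::finite \<Rightarrow> 'b::euclidean_space) \<Rightarrow> real^'m \<Rightarrow> 'b" where
  "duhamel c T N x = integral {0..T} (\<lambda>r. c r *\<^sub>R heat r N x)"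

lemma duhamel_integrand_continuous:
  fixes N :: "real^'m::finite \<Rightarrow> 'b::euclidean_space"
  assumes N: "torus_cont N" and c: "continuous_on {0..T} c"
  shows "continuous_on (UNIV \<times> {0..T}) (\<lambda>(x, r). c r *\<^sub>R heat r N x)"
proof -
  have h: "continuous_on (UNIV \<times> {0..T}) (\<lambda>p. case (snd p, fst p) of (r, x) \<Rightarrow> heat r N x)"
    by (rule continuous_on_compose2[OF heat_continuous[OF N]]) (auto intro!: continuous_intros)
  then show ?thesis unfolding case_prod_unfold
    by (intro continuous_intros continuous_on_compose2[OF c]) auto
qed

lemma duhamel_torus_cont:
  fixes N :: "real^'m::finite \<Rightarrow> 'b::euclidean_space"
  assumes N: "torus_cont N" and c: "continuous_on {0..T} c"
  shows "torus_cont (duhamel c T N)"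
proof -
  have "continuous_on UNIV (duhamel c T N)"
    using integral_continuous_on_param[of UNIV 0 T "\<lambda>x r. c r *\<^sub>R heat r N x"] duhamel_integrand_continuous[OF N c]
    by (simp add: cbox_interval duhamel_def[abs_def])
  then show ?thesis
    using torus_contD(2)[OF heat_torus_cont[OF N]] by (simp add: torus_cont_def duhamel_def)
qed

lemma torus_C1_duhamel:
  fixes N :: "real^'m::finite \<Rightarrow> 'b::euclidean_space"
  assumes N: "torus_C1 N D" and c: "continuous_on {0..T} c"
  shows "\<exists>D'. torus_C1 (duhamel c T N) D'"
proof -
  note Nc = torus_C1D(1)[OF N] and Dc = torus_C1D(3)[OF N]
  obtain L where L0: "0 \<le> L" and L: "\<And>x h. norm (D x h) \<le> L * norm h"
    and "\<And>x y. norm (N x - N y) \<le> L * norm (x - y)"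
    by (rule torus_C1_bound[OF N], rule that)
  have "bounded (c ` {0..T})" by (intro compact_imp_bounded compact_continuous_image c) simp
  then obtain B where B: "\<forall>r\<in>{0..T}. \<bar>c r\<bar> \<le> B" by (auto simp: bounded_iff)
  have "torus_C1 (\<lambda>x. integral {0..T} (\<lambda>r. c r *\<^sub>R heat r N x))
      (\<lambda>x h. integral {0..T} (\<lambda>r. c r *\<^sub>R heat r (\<lambda>y. D y h) x))"
  proof (rule torus_C1_integral[where L = "B * L"])
    show "torus_C1 (\<lambda>x. c r *\<^sub>R heat r N x) (\<lambda>x h. c r *\<^sub>R heat r (\<lambda>y. D y h) x)" for r
      using heat_torus_C1[OF N, of r] torus_cont_intros(4)[OF heat_torus_cont[OF Nc, of r]]
      unfolding torus_C1_def by (auto intro!: continuous_intros has_derivative_scaleR_right)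
    show "continuous_on (UNIV \<times> {0..T}) (\<lambda>(x, r). c r *\<^sub>R heat r N x)" by (rule duhamel_integrand_continuous[OF Nc c])
    show "continuous_on (UNIV \<times> {0..T}) (\<lambda>(x, r). c r *\<^sub>R heat r (\<lambda>y. D y h) x)" for h
      by (rule duhamel_integrand_continuous[OF Dc c])
    fix r x h assume r: "r \<in> {0..T}"
    have "norm (heat r (\<lambda>y. D y h) x) \<le> exp (- \<kappa> * r) * (L * norm h)"
      by (rule norm_heat_le[OF Dc L])
    also have "\<dots> \<le> 1 * (L * norm h)"
      using kap r L0 by (intro mult_right_mono) auto
    finally have "\<bar>c r\<bar> * norm (heat r (\<lambda>y. D y h) x) \<le> B * (L * norm h)"
      using bspec[OF B r] by (intro mult_mono) auto
    then show "norm (c r *\<^sub>R heat r (\<lambda>y. D y h) x) \<le> B * L * norm h" by (simp add: mult.assoc)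
  qed
  then show ?thesis unfolding duhamel_def[abs_def] by blast
qed

lemma torus_ip_duhamel:
  fixes N v :: "real^'m::finite \<Rightarrow> 'b::euclidean_space"
  assumes N: "torus_cont N" and v: "torus_cont v" and c: "continuous_on {0..T} c"
  shows "torus_ip (duhamel c T N) v = integral {0..T} (\<lambda>r. c r * torus_ip (heat r N) v)"
proof -
  have ic: "continuous_on {0..T} (\<lambda>r. c r *\<^sub>R heat r N x)" for x
    by (rule continuous_on_slice(1)[OF duhamel_integrand_continuous[OF N c]]) simp
  have "duhamel c T N x \<bullet> v x = integral {0..T} (\<lambda>r. c r * (heat r N x \<bullet> v x))" for x
    using integral_linear[OF integrable_continuous_real[OF ic] bounded_linear_inner_left[of "v x"], of x]
    by (simp add: duhamel_def o_def)
  then have "torus_ip (duhamel c T N) v = integral Omega (\<lambda>x. integral (cbox 0 T) (\<lambda>r. c r * (heat r N x \<bullet> v x)))"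
    by (simp add: torus_ip_def cbox_interval)
  also have "\<dots> = integral (cbox 0 T) (\<lambda>r. integral Omega (\<lambda>x. c r * (heat r N x \<bullet> v x)))"
    unfolding Omega_def
  proof (rule integral_swap_continuous)
    let ?O = "cbox (\<chi> i. - 1 / 2) (\<chi> i. 1 / 2) :: (real^'m) set"
    have h: "continuous_on (?O \<times> cbox 0 T) (\<lambda>p. case p of (x, r) \<Rightarrow> c r *\<^sub>R heat r N x)"
      by (rule continuous_on_subset[OF duhamel_integrand_continuous[OF N c]]) (auto simp: cbox_interval)
    then have "continuous_on (?O \<times> cbox 0 T) (\<lambda>p. (case p of (x, r) \<Rightarrow> c r *\<^sub>R heat r N x) \<bullet> v (fst p))"
      by (intro continuous_intros continuous_on_compose2[OF torus_contD(1)[OF v, of UNIV]]) auto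
    then show "continuous_on (cbox (\<chi> i. - 1 / 2, 0) (\<chi> i. 1 / 2, T)) (\<lambda>(x, r). c r * (heat r N x \<bullet> v x))"
      unfolding cbox_Pair_eq by (simp add: case_prod_unfold)
  qed
  finally show ?thesis by (simp add: torus_ip_def cbox_interval)
qed

lemma heat_duhamel:
  fixes N :: "'m::finite field"
  assumes N: "torus_cont N" and c: "continuous_on {0..T} c" and a: "0 \<le> a"
  shows "heat a (duhamel c T N) x = integral {0..T} (\<lambda>r. c r *\<^sub>R heat (a + r) N x)"
proof -
  define \<sigma> where "\<sigma> = \<epsilon> * sqrt a"
  obtain C where C: "0 \<le> C" "\<And>x. norm (N x) \<le> C" using torus_cont_bounded[OF N] by blast
  have "bounded (c ` {0..T})" by (intro compact_imp_bounded compact_continuous_image c) simp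
  then obtain B where B: "\<forall>r\<in>{0..T}. \<bar>c r\<bar> \<le> B" by (auto simp: bounded_iff)
  have gauss_avg: "gauss_avg \<sigma> (duhamel c T N) x = integral {0..T} (\<lambda>r. c r *\<^sub>R gauss_avg \<sigma> (heat r N) x)"
  proof -
    have "gauss_avg \<sigma> (duhamel c T N) x = (LINT z|lborel. std_gauss z *\<^sub>R integral (cbox 0 T) (\<lambda>r. c r *\<^sub>R heat r N (x + \<sigma> *\<^sub>R z)))"
      by (simp add: gauss_avg_def duhamel_def cbox_interval)
    also have "\<dots> = integral (cbox 0 T) (\<lambda>r. LINT z|lborel. std_gauss z *\<^sub>R (c r *\<^sub>R heat r N (x + \<sigma> *\<^sub>R z)))"
    proof (rule std_gauss_fubini[symmetric])
      have "continuous_on (UNIV \<times> cbox 0 T) (\<lambda>p. case (x + \<sigma> *\<^sub>R fst p, snd p) of (x, r) \<Rightarrow> c r *\<^sub>R heat r N x)"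
        by (rule continuous_on_compose2[OF duhamel_integrand_continuous[OF N c]]) (auto simp: cbox_interval intro!: continuous_intros)
      then show "continuous_on (UNIV \<times> cbox 0 T) (\<lambda>(z, r). c r *\<^sub>R heat r N (x + \<sigma> *\<^sub>R z))"
        by (simp add: case_prod_unfold)
      fix z r assume "r \<in> cbox 0 T"
      then have r: "r \<in> {0..T}" by (simp add: cbox_interval)
      have "norm (heat r N (x + \<sigma> *\<^sub>R z)) \<le> exp (- \<kappa> * r) * C" by (rule norm_heat_le[OF N C(2)])
      also have "\<dots> \<le> 1 * C" using kap r C by (intro mult_right_mono) auto
      finally have "\<bar>c r\<bar> * norm (heat r N (x + \<sigma> *\<^sub>R z)) \<le> B * C"
        using bspec[OF B r] by (intro mult_mono) auto
      then show "norm (c r *\<^sub>R heat r N (x + \<sigma> *\<^sub>R z)) \<le> B * C" by simp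
    qed
    also have "\<dots> = integral {0..T} (\<lambda>r. c r *\<^sub>R gauss_avg \<sigma> (heat r N) x)"
      by (simp add: cbox_interval gauss_avg_def scaleR_left_commute[of "std_gauss _"] del: scaleR_scaleR)
    finally show ?thesis .
  qed
  have "heat a (duhamel c T N) x = integral {0..T} (\<lambda>r. exp (- \<kappa> * a) *\<^sub>R (c r *\<^sub>R gauss_avg \<sigma> (heat r N) x))"
    unfolding heat_def[of a] \<sigma>_def[symmetric] gauss_avg by (rule integral_cmul[symmetric])
  also have "\<dots> = integral {0..T} (\<lambda>r. c r *\<^sub>R heat (a + r) N x)"
  proof (rule hk_integral_cong)
    fix r assume "r \<in> {0..T}"
    then have "heat (a + r) N = heat a (heat r N)" using a by (simp add: heat_heat[OF N])
    then show "exp (- \<kappa> * a) *\<^sub>R (c r *\<^sub>R gauss_avg \<sigma> (heat r N) x) = c r *\<^sub>R heat (a + r) N x"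
      by (simp add: heat_def[of a] \<sigma>_def scaleR_left_commute mult.commute)
  qed
  finally show ?thesis .
qed

end

section \<open>The exponential integrators as discrete gradient flows\<close>

context heat_semigroup
begin

text \<open>
  The mild solution at time \<open>a\<close> of \<open>W' = - L W + N\<close> with \<open>W 0 = u\<close> and a source \<open>N\<close> that does not depend on time.
\<close>

definition etd_path :: "'m::finite field \<Rightarrow> 'm field \<Rightarrow> real \<Rightarrow> 'm field" where
  "etd_path u N a x = heat a u x + duhamel (\<lambda>_. 1) a N x"

lemma etd_path_torus_cont: "torus_cont u \<Longrightarrow> torus_cont N \<Longrightarrow> torus_cont (etd_path u N a)"
  unfolding etd_path_def by (intro torus_cont_intros heat_torus_cont duhamel_torus_cont continuous_intros)

lemma etd_path_add:
  assumes u: "torus_cont u" and N: "torus_cont N" and a: "0 \<le> a" and b: "0 \<le> b"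
  shows "etd_path u N (a + b) x = heat a (etd_path u N b) x + duhamel (\<lambda>_. 1) a N x"
proof -
  have cont: "continuous_on S (\<lambda>r. heat r N x)" for S
    using continuous_on_slice(2)[of UNIV UNIV "\<lambda>s x. heat s N x" x] heat_continuous[OF N]
    by (auto intro: continuous_on_subset)
  have "heat a (duhamel (\<lambda>_. 1) b N) x = integral {0..b} ((\<lambda>r. heat r N x) \<circ> ((+) a))"
    by (simp add: heat_duhamel[OF N _ a] o_def)
  also have "\<dots> = integral {a..a + b} (\<lambda>r. heat r N x)"
    by (subst integral_shift_Icc_real) (simp add: add.commute)
  finally have 1: "heat a (duhamel (\<lambda>_. 1) b N) x = integral {a..a + b} (\<lambda>r. heat r N x)" .
  have 2: "integral {0..a} (\<lambda>r. heat r N x) + integral {a..a + b} (\<lambda>r. heat r N x) = integral {0..a + b} (\<lambda>r. heat r N x)"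
    by (rule Henstock_Kurzweil_Integration.integral_combine) (use a b in \<open>auto intro!: integrable_continuous_real cont\<close>)
  have "heat a (etd_path u N b) x = heat a (heat b u) x + heat a (duhamel (\<lambda>_. 1) b N) x"
    unfolding etd_path_def by (intro heat_add heat_torus_cont u duhamel_torus_cont N continuous_intros)
  then show ?thesis
    unfolding 1 etd_path_def[of u N "a + b"] duhamel_def using 2 by (simp add: heat_heat[OF u a b] add.commute)
qed

lemma etd_path_0: "etd_path u N 0 = u"
  by (simp add: etd_path_def[abs_def] duhamel_def heat_0)

text \<open>
  The bounded substitute for \<open>\<langle>L u, v\<rangle>\<close>, defined for fields that are only continuous.
\<close>

definition heat_form :: "real \<Rightarrow> 'm::finite field \<Rightarrow> 'm field \<Rightarrow> real" where
  "heat_form t u v = (torus_ip u v - torus_ip (heat t u) v) / t"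

lemma heat_diff:
  fixes u v :: "real^'m::finite \<Rightarrow> 'b::euclidean_space"
  assumes "torus_cont u" "torus_cont v"
  shows "heat s (\<lambda>x. u x - v x) x = heat s u x - heat s v x"
proof -
  have "heat s (\<lambda>x. u x - v x + v x) x = heat s (\<lambda>x. u x - v x) x + heat s v x"
    by (rule heat_add) (intro torus_cont_intros assms)+
  then show ?thesis by simp
qed

lemma heat_form_add:
  assumes u: "torus_cont u" and v: "torus_cont v"
  shows "heat_form t (\<lambda>x. u x + v x) (\<lambda>x. u x + v x) = heat_form t u u + 2 * heat_form t u v + heat_form t v v"
proof -
  note h = heat_torus_cont[OF u, of t] heat_torus_cont[OF v, of t]
  have "torus_ip (heat t v) u = torus_ip (heat t u) v"
    by (metis torus_ip_commute torus_ip_heat_symmetric u v)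
  moreover have "heat t (\<lambda>x. u x + v x) = (\<lambda>x. heat t u x + heat t v x)"
    using heat_add[OF u v] by (simp add: fun_eq_iff)
  moreover have "torus_ip v u = torus_ip u v" by (rule torus_ip_commute)
  ultimately have "torus_ip (\<lambda>x. u x + v x) (\<lambda>x. u x + v x) - torus_ip (heat t (\<lambda>x. u x + v x)) (\<lambda>x. u x + v x)
      = (torus_ip u u - torus_ip (heat t u) u) + 2 * (torus_ip u v - torus_ip (heat t u) v) + (torus_ip v v - torus_ip (heat t v) v)"
    using u v h by (simp add: torus_ip_add_left torus_ip_add_right torus_cont_intros)
  then show ?thesis unfolding heat_form_def by (simp add: add_divide_distrib)
qed

lemma torus_ip_duhamel_average_limit:
  fixes N v :: "'m::finite field"
  assumes N: "torus_cont N" and v: "torus_cont v"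
  shows "((\<lambda>t. torus_ip (duhamel (\<lambda>_. 1) t N) v / t) \<longlongrightarrow> torus_ip N v) (at_right 0)"
proof -
  let ?f = "\<lambda>r. torus_ip (heat r N) v"
  have c: "continuous_on S ?f" for S by (rule continuous_on_subset[OF torus_ip_heat_continuous[OF N v]]) simp
  have "((\<lambda>t. integral {0..t} ?f) has_real_derivative ?f 0) (at 0 within {0..1})"
    by (rule integral_has_real_derivative) (auto intro: c)
  then have "((\<lambda>t. (integral {0..t} ?f - integral {0..0} ?f) / (t - 0)) \<longlongrightarrow> ?f 0) (at 0 within {0..1})"
    unfolding has_field_derivative_iff .
  then have "((\<lambda>t. integral {0..t} ?f / t) \<longlongrightarrow> torus_ip N v) (at 0 within {0..1})"
    by (simp add: heat_0)
  moreover have "at 0 within {0..1} = at_right (0::real)" by (rule at_within_Icc_at_right) simp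
  ultimately show ?thesis by (simp add: torus_ip_duhamel[OF N v])
qed

text \<open>
  The pairings are weighted integrals, single or double, of \<open>q a = \<langle>S a h, h\<rangle>\<close> at sums of ages; \<open>q\<close> is nonnegative and
  decreasing. Collecting one of the integrals in \<open>G a = \<langle>S a h, e\<rangle>\<close> keeps these two properties, so the third estimate is
  \<open>integral_weight_shift_le\<close>, and the second holds since the weight is at most \<open>1\<close>.
\<close>

lemma duhamel_weight_estimates:
  fixes h :: "'m::finite field"
  assumes h: "torus_cont h" and T: "0 < T"
  defines "e \<equiv> duhamel (\<lambda>r. (T - r) / T) T h"
  shows "0 \<le> torus_ip h e" and "torus_ip e e \<le> T * torus_ip h e"
    and "\<And>t. 0 < t \<Longrightarrow> t \<le> T \<Longrightarrow> heat_form t e e \<le> torus_ip h e"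
proof -
  let ?w = "\<lambda>r. (T - r) / T"
  have wc: "continuous_on S ?w" for S using T by (intro continuous_intros) auto
  have w01: "0 \<le> ?w r" "?w r \<le> 1" if "r \<in> {0..T}" for r using that T by auto
  have e: "torus_cont e" unfolding e_def by (rule duhamel_torus_cont[OF h wc])
  define q where "q a = torus_ip (heat a h) h" for a
  define G where "G a = torus_ip (heat a h) e" for a
  have qc: "continuous_on S q" for S unfolding q_def by (rule continuous_on_subset[OF torus_ip_heat_continuous[OF h h]]) simp
  have Gc: "continuous_on S G" for S unfolding G_def by (rule continuous_on_subset[OF torus_ip_heat_continuous[OF h e]]) simp
  have q0: "0 \<le> q a" if "0 \<le> a" for a unfolding q_def by (rule torus_ip_heat_self_nonneg[OF h that])
  have qm: "q b \<le> q a" if "0 \<le> a" "a \<le> b" for a b unfolding q_def by (rule torus_ip_heat_self_antimono[OF h that])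
  have heat_e: "heat t e x = integral {0..T} (\<lambda>r. ?w r *\<^sub>R heat r (heat t h) x)" if "0 \<le> t" for t x
    unfolding e_def heat_duhamel[OF h wc that]
    by (rule hk_integral_cong) (use that in \<open>simp add: heat_heat[OF h] add.commute\<close>)
  then have heat_e': "heat t e = duhamel ?w T (heat t h)" if "0 \<le> t" for t
    using that by (simp add: fun_eq_iff duhamel_def)
  have pair: "torus_ip (heat t e) v = integral {0..T} (\<lambda>r. ?w r * torus_ip (heat (r + t) h) v)" if "0 \<le> t" and v: "torus_cont v" for t v
    unfolding heat_e'[OF that(1)] torus_ip_duhamel[OF heat_torus_cont[OF h] v wc]
    by (rule hk_integral_cong) (use that in \<open>simp add: heat_heat[OF h]\<close>)
  have Gq: "G a = integral {0..T} (\<lambda>r. ?w r * q (r + a))" if "0 \<le> a" for a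
  proof -
    have "G a = torus_ip (heat a e) h" unfolding G_def by (metis torus_ip_commute torus_ip_heat_symmetric h e)
    then show ?thesis unfolding q_def using pair[OF that h] by simp
  qed
  have wq: "(\<lambda>r. ?w r * q (r + a)) integrable_on {0..T}" for a
    using T by (intro integrable_continuous_real continuous_intros continuous_on_compose2[OF qc[of UNIV]]) auto
  have G0: "0 \<le> G a" if "0 \<le> a" for a
    unfolding Gq[OF that] using that w01
    by (intro hk_integral_nonneg wq mult_nonneg_nonneg q0) auto
  have Gm: "G b \<le> G a" if ab: "0 \<le> a" "a \<le> b" for a b
  proof -
    have "0 \<le> b" using ab by simp
    show ?thesis unfolding Gq[OF ab(1)] Gq[OF \<open>0 \<le> b\<close>]
      using ab w01 by (intro integral_le wq mult_left_mono qm) auto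
  qed
  have G_0: "G 0 = torus_ip h e" by (simp add: G_def heat_0)
  show "0 \<le> torus_ip h e" using G0[of 0] G_0 by simp
  have pe: "torus_ip (heat t e) e = integral {0..T} (\<lambda>r. ?w r * G (r + t))" if "0 \<le> t" for t
    using pair[OF that e] by (simp add: G_def)
  have wG: "(\<lambda>r. ?w r * G (r + a)) integrable_on {0..T}" for a
    using T by (intro integrable_continuous_real continuous_intros continuous_on_compose2[OF Gc[of UNIV]]) auto
  have "torus_ip e e = integral {0..T} (\<lambda>r. ?w r * G (r + 0))" using pe[of 0] by (simp add: heat_0)
  also have "\<dots> \<le> integral {0..T} (\<lambda>r. G 0)"
  proof (intro integral_le wG)
    fix r assume r: "r \<in> {0..T}"
    have "?w r * G (r + 0) \<le> 1 * G 0"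
      using w01[OF r] r by (intro mult_mono Gm G0) auto
    then show "?w r * G (r + 0) \<le> G 0" by simp
  qed auto
  also have "\<dots> = T * torus_ip h e" using T by (simp add: G_0)
  finally show "torus_ip e e \<le> T * torus_ip h e" .
  fix t assume t: "0 < t" "t \<le> T"
  have "torus_ip e e - torus_ip (heat t e) e = integral {0..T} (\<lambda>r. ?w r * (G r - G (r + t)))"
  proof -
    have "torus_ip e e - torus_ip (heat t e) e = integral {0..T} (\<lambda>r. ?w r * G (r + 0)) - integral {0..T} (\<lambda>r. ?w r * G (r + t))"
      using pe[of 0] pe[of t] t by (simp add: heat_0)
    also have "\<dots> = integral {0..T} (\<lambda>r. ?w r * G (r + 0) - ?w r * G (r + t))"
      by (rule hk_integral_diff[OF wG wG, symmetric])
    finally show ?thesis by (simp add: right_diff_distrib)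
  qed
  also have "\<dots> \<le> t * G 0"
    by (rule integral_weight_shift_le[OF Gc Gm G0 t])
  finally show "heat_form t e e \<le> torus_ip h e" using t by (simp add: heat_form_def G_0 divide_le_eq mult.commute)
qed

text \<open>
  Energy balance for \<open>n\<close> steps of length \<open>t\<close>. The right-hand side measures the error of replacing \<open>N\<close> by the
  mean of \<open>S r N\<close> over \<open>0 \<le> r \<le> t\<close>; it vanishes in the limit.
\<close>

lemma etd_discrete_inequality:
  fixes u N h :: "'m::finite field"
  assumes u: "torus_cont u" and N: "torus_cont N" and h: "torus_cont h" and T: "0 < T" and n: "0 < n"
  defines "w \<equiv> etd_path u N T" and "e \<equiv> duhamel (\<lambda>r. (T - r) / T) T h" and "t \<equiv> T / real n"
  defines "d \<equiv> \<lambda>x. w x - u x"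
  shows "heat_form t (\<lambda>x. w x + e x) (\<lambda>x. w x + e x) / 2 - heat_form t u u / 2 - torus_ip N d - torus_ip (\<lambda>x. N x + h x) e
    \<le> (torus_ip (duhamel (\<lambda>_. 1) t N) d / t - torus_ip N d) + (torus_ip (duhamel (\<lambda>_. 1) t N) e / t - torus_ip N e)"
proof -
  have t: "0 < t" "t \<le> T" "real n * t = T"
    using T n by (auto simp: t_def divide_le_eq mult_le_cancel_left1 Suc_le_eq)
  have wc: "torus_cont w" unfolding w_def by (rule etd_path_torus_cont[OF u N])
  have ec: "torus_cont e" unfolding e_def using T by (intro duhamel_torus_cont h continuous_intros) auto
  have dc: "torus_cont d" unfolding d_def by (intro torus_cont_intros wc u)
  have Dc: "torus_cont (duhamel (\<lambda>_. 1) t N)" by (intro duhamel_torus_cont N continuous_intros)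
  define p where "p x = (etd_path u N t x - u x) /\<^sub>R t" for x
  have pc: "torus_cont p" unfolding p_def by (intro torus_cont_intros etd_path_torus_cont u N)
  \<comment> \<open>The source cancels in the increment over one step, wherever the step starts.\<close>
  have step: "etd_path u N (a + t) x - etd_path u N a x = t *\<^sub>R heat a p x" if a: "0 \<le> a" for a x
  proof -
    have "etd_path u N (a + t) x - etd_path u N (a + 0) x = heat a (etd_path u N t) x - heat a (etd_path u N 0) x"
      using etd_path_add[OF u N a, of t x] etd_path_add[OF u N a, of 0 x] t by simp
    also have "\<dots> = heat a (\<lambda>x. etd_path u N t x - u x) x"
      unfolding etd_path_0 by (rule heat_diff[symmetric, OF etd_path_torus_cont[OF u N] u])
    also have "(\<lambda>x. etd_path u N t x - u x) = (\<lambda>x. t *\<^sub>R p x)" using t by (simp add: p_def fun_eq_iff)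
    also have "heat a (\<lambda>x. t *\<^sub>R p x) x = t *\<^sub>R heat a p x"
      by (rule heat_linear[OF bounded_linear_scaleR_right pc])
    finally show ?thesis by simp
  qed
  define g where "g = heat T p"
  have gc: "torus_cont g" unfolding g_def by (rule heat_torus_cont[OF pc])
  \<comment> \<open>The equation \<open>L w - N = - S T p\<close> at the end point, tested with \<open>v\<close> where \<open>L\<close> is
    \<open>(1 - S t)/t\<close> and \<open>N\<close> is averaged along the semigroup over \<open>[0,t]\<close>.\<close>
  have res: "heat_form t w v = torus_ip (duhamel (\<lambda>_. 1) t N) v / t - torus_ip g v" if v: "torus_cont v" for v
  proof -
    have "w x - heat t w x = duhamel (\<lambda>_. 1) t N x - t *\<^sub>R g x" for x
      using etd_path_add[OF u N, of t T x] step[of T x] t T by (simp add: w_def g_def add.commute algebra_simps)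
    then have "torus_ip (\<lambda>x. w x - heat t w x) v = torus_ip (\<lambda>x. duhamel (\<lambda>_. 1) t N x - t *\<^sub>R g x) v" by simp
    then have "torus_ip w v - torus_ip (heat t w) v = torus_ip (duhamel (\<lambda>_. 1) t N) v - t * torus_ip g v"
      using wc v gc Dc heat_torus_cont[OF wc] by (simp add: torus_ip_diff_left torus_ip_scale_left torus_cont_intros)
    then show ?thesis using t by (simp add: heat_form_def diff_divide_distrib)
  qed
  have bnn: "0 \<le> heat_form t v v" if "torus_cont v" for v
    unfolding heat_form_def using torus_ip_heat_le[OF that, of t] t by simp
  have d_sum: "d x = (\<Sum>j<n. t *\<^sub>R heat (real j * t) p x)" for x
  proof -
    have "(\<Sum>j<n. t *\<^sub>R heat (real j * t) p x) = (\<Sum>j<n. etd_path u N (real (Suc j) * t) x - etd_path u N (real j * t) x)"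
      using step[of "real j * t" for j] t by (intro sum.cong refl) (simp add: algebra_simps)
    also have "\<dots> = etd_path u N (real n * t) x - etd_path u N (real 0 * t) x"
      by (rule sum_lessThan_telescope)
    finally show ?thesis using t by (simp add: d_def w_def etd_path_0)
  qed
  \<comment> \<open>Every summand pairs \<open>p\<close> with its evolution over a time of at most \<open>2T\<close>, and \<open>\<langle>S a p, p\<rangle>\<close> decreases in \<open>a\<close>.\<close>
  have gd: "T * torus_ip g g \<le> torus_ip g d"
  proof -
    have "torus_ip g d = (\<Sum>j<n. t * torus_ip g (heat (real j * t) p))"
      unfolding d_sum[abs_def] using gc heat_torus_cont[OF pc]
      by (subst torus_ip_commute, subst torus_ip_sum_left) (auto intro: torus_cont_intros simp: torus_ip_scale_left torus_ip_commute)
    also have "\<dots> \<ge> (\<Sum>j<n. t * torus_ip g g)"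
    proof (intro sum_mono mult_left_mono)
      fix j assume "j \<in> {..<n}"
      then have "real j * t \<le> real n * t" using t(1) by (intro mult_right_mono) auto
      then have j: "0 \<le> real j * t" "real j * t \<le> T" using t(1,3) by auto
      have "torus_ip g g = torus_ip (heat (T + T) p) p"
        unfolding g_def using T by (simp add: torus_ip_heat_symmetric[symmetric] heat_heat heat_torus_cont pc)
      also have "\<dots> \<le> torus_ip (heat (real j * t + T) p) p"
        by (rule torus_ip_heat_self_antimono[OF pc]) (use j T in auto)
      also have "\<dots> = torus_ip g (heat (real j * t) p)"
        unfolding g_def using T j by (simp add: torus_ip_heat_symmetric[symmetric] heat_heat heat_torus_cont pc)
      finally show "torus_ip g g \<le> torus_ip g (heat (real j * t) p)" .
    qed (use t in simp)
    finally have "(real n * t) * torus_ip g g \<le> torus_ip g d" by (simp add: mult.assoc)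
    then show ?thesis unfolding t(3) .
  qed
  have "heat_form t u u + 2 * heat_form t u d + heat_form t d d = heat_form t w w"
    using heat_form_add[OF u dc, of t] by (simp add: d_def)
  moreover have "heat_form t w d = heat_form t u d + heat_form t d d"
  proof -
    have "heat t w x = heat t u x + heat t d x" for x
      using heat_add[OF u dc, of t x] by (simp add: d_def)
    then have "heat t w = (\<lambda>x. heat t u x + heat t d x)" by (simp add: fun_eq_iff)
    moreover have "w = (\<lambda>x. u x + d x)" by (simp add: d_def)
    then have "torus_ip w d = torus_ip u d + torus_ip d d" using torus_ip_add_left[OF u dc dc] by simp
    ultimately show ?thesis
      unfolding heat_form_def using u dc heat_torus_cont[OF u] heat_torus_cont[OF dc]
      by (simp add: torus_ip_add_left add_divide_distrib diff_divide_distrib)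
  qed
  ultimately have b1: "heat_form t w w / 2 - heat_form t u u / 2 \<le> heat_form t w d"
    using bnn[OF dc] by simp
  have b2: "heat_form t (\<lambda>x. w x + e x) (\<lambda>x. w x + e x) = heat_form t w w + 2 * heat_form t w e + heat_form t e e"
    by (rule heat_form_add[OF wc ec])
  note est = duhamel_weight_estimates[OF h T, folded e_def]
  \<comment> \<open>The completed square: \<open>- T \<bar>g\<bar>\<^sup>2 - \<langle>g,e\<rangle> \<le> \<bar>e\<bar>\<^sup>2 / (4 T)\<close>.\<close>
  have sq: "0 \<le> 4 * T\<^sup>2 * torus_ip g g + 4 * T * torus_ip g e + torus_ip e e"
  proof -
    have "0 \<le> torus_ip (\<lambda>x. (2 * T) *\<^sub>R g x + e x) (\<lambda>x. (2 * T) *\<^sub>R g x + e x)"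
      by (intro torus_ip_self_nonneg torus_cont_intros gc ec)
    also have "\<dots> = 4 * T\<^sup>2 * torus_ip g g + 4 * T * torus_ip g e + torus_ip e e"
      using gc ec by (simp add: torus_ip_add_left torus_ip_add_right torus_cont_intros torus_ip_scale_left torus_ip_scale_right
          torus_ip_commute[of e g] power2_eq_square algebra_simps)
    finally show ?thesis .
  qed
  have "- torus_ip g d - torus_ip g e \<le> torus_ip h e / 4"
  proof -
    have "4 * T * (- T * torus_ip g g - torus_ip g e) \<le> torus_ip e e" using sq by (simp add: power2_eq_square algebra_simps)
    also have "\<dots> \<le> 4 * T * (torus_ip h e / 4)" using est(2) by simp
    finally have "- T * torus_ip g g - torus_ip g e \<le> torus_ip h e / 4" using T by (subst (asm) mult_le_cancel_left_pos) auto
    then show ?thesis using gd by simp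
  qed
  moreover have "torus_ip (\<lambda>x. N x + h x) e = torus_ip N e + torus_ip h e" by (rule torus_ip_add_left[OF N h ec])
  ultimately show ?thesis
    using b1 b2 res[OF dc] res[OF ec] est(1) est(3)[OF t(1,2)] by argo
qed

text \<open>
  The limit of the discrete balance. Continuous differentiability of the first and the last field enters through the
  Dirichlet form.
\<close>

lemma etd_energy_inequality:
  fixes u N h :: "'m::finite field"
  assumes u: "torus_C1 u Du" and N: "torus_cont N" and h: "torus_cont h" and T: "0 < T"
  defines "w \<equiv> etd_path u N T" and "e \<equiv> duhamel (\<lambda>r. (T - r) / T) T h"
  assumes v: "torus_C1 (\<lambda>x. w x + e x) Dv"
  shows "(\<epsilon>\<^sup>2 * dirichlet Dv + \<kappa> * torus_ip (\<lambda>x. w x + e x) (\<lambda>x. w x + e x)) / 2 - (\<epsilon>\<^sup>2 * dirichlet Du + \<kappa> * torus_ip u u) / 2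
      - torus_ip N (\<lambda>x. w x - u x) - torus_ip (\<lambda>x. N x + h x) e \<le> 0"
proof -
  define d where "d = (\<lambda>x. w x - u x)"
  note uc = torus_C1D(1)[OF u]
  have wc: "torus_cont w" unfolding w_def by (rule etd_path_torus_cont[OF uc N])
  have ec: "torus_cont e" unfolding e_def using T by (intro duhamel_torus_cont h continuous_intros) auto
  have dc: "torus_cont d" unfolding d_def by (intro torus_cont_intros wc uc)
  have tl: "filterlim (\<lambda>n. T / real n) (at_right 0) sequentially"
    unfolding filterlim_at
  proof
    show "\<forall>\<^sub>F n in sequentially. T / real n \<in> {0<..} \<and> T / real n \<noteq> 0"
      using eventually_gt_at_top[of 0] by eventually_elim (use T in simp)
    show "(\<lambda>n. T / real n) \<longlonglongrightarrow> 0" by (rule lim_const_over_n)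
  qed
  have L: "(\<lambda>n. heat_form (T / real n) v v) \<longlonglongrightarrow> \<epsilon>\<^sup>2 * dirichlet D + \<kappa> * torus_ip v v" if "torus_C1 v D" for v :: "'m field" and D
    unfolding heat_form_def by (rule filterlim_compose[OF torus_ip_heat_dirichlet_limit[OF that] tl])
  have A: "(\<lambda>n. torus_ip (duhamel (\<lambda>_. 1) (T / real n) N) v / (T / real n)) \<longlonglongrightarrow> torus_ip N v" if "torus_cont v" for v
    by (rule filterlim_compose[OF torus_ip_duhamel_average_limit[OF N that] tl])
  let ?lhs = "\<lambda>n. heat_form (T / real n) (\<lambda>x. w x + e x) (\<lambda>x. w x + e x) / 2 - heat_form (T / real n) u u / 2
      - torus_ip N d - torus_ip (\<lambda>x. N x + h x) e"
  let ?rhs = "\<lambda>n. (torus_ip (duhamel (\<lambda>_. 1) (T / real n) N) d / (T / real n) - torus_ip N d)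
      + (torus_ip (duhamel (\<lambda>_. 1) (T / real n) N) e / (T / real n) - torus_ip N e)"
  have l1: "?lhs \<longlonglongrightarrow> (\<epsilon>\<^sup>2 * dirichlet Dv + \<kappa> * torus_ip (\<lambda>x. w x + e x) (\<lambda>x. w x + e x)) / 2
      - (\<epsilon>\<^sup>2 * dirichlet Du + \<kappa> * torus_ip u u) / 2 - torus_ip N d - torus_ip (\<lambda>x. N x + h x) e"
    by (intro tendsto_diff tendsto_const tendsto_divide L u v) simp_all
  have "?rhs \<longlonglongrightarrow> (torus_ip N d - torus_ip N d) + (torus_ip N e - torus_ip N e)"
    by (intro tendsto_add tendsto_diff tendsto_const A dc ec)
  then have l2: "?rhs \<longlonglongrightarrow> 0" by simp
  have le: "\<forall>\<^sub>F n in sequentially. ?lhs n \<le> ?rhs n"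
    using eventually_gt_at_top[of 0]
    by eventually_elim (unfold w_def e_def d_def, rule etd_discrete_inequality[OF uc N h T])
  have "(\<epsilon>\<^sup>2 * dirichlet Dv + \<kappa> * torus_ip (\<lambda>x. w x + e x) (\<lambda>x. w x + e x)) / 2
      - (\<epsilon>\<^sup>2 * dirichlet Du + \<kappa> * torus_ip u u) / 2 - torus_ip N d - torus_ip (\<lambda>x. N x + h x) e \<le> 0"
    by (rule tendsto_le[OF _ l2 l1 le]) simp
  then show ?thesis by (simp add: d_def)
qed

end

section \<open>Energy decay of the schemes\<close>

lemma torus_C1_of_C1_field:
  fixes U :: "'m::finite field"
  assumes per: "periodic U" and C1: "C1_field U"
  shows "\<exists>D. torus_C1 U D"
proof -
  define P where "P i j k x = partial k (\<lambda>y. U y $ i $ j) x" for i j k x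
  define D where "D x h = (\<chi> i j. \<Sum>k\<in>UNIV. h $ k * P i j k x)" for x h
  have "((\<lambda>y. U y $ i $ j) has_derivative (\<lambda>h. D x h $ i $ j)) (at x)" for i j x
  proof -
    have "(\<lambda>y. U y $ i $ j) differentiable (at x)" using C1 by (simp add: C1_field_def C1_def)
    then obtain G where G: "((\<lambda>y. U y $ i $ j) has_derivative G) (at x)" by (auto simp: differentiable_def)
    interpret G: bounded_linear G using G by (rule has_derivative_bounded_linear)
    have "G h = D x h $ i $ j" for h
    proof -
      have "G h = G (\<Sum>k\<in>UNIV. h $ k *\<^sub>R axis k 1)" using basis_expansion[of h] by (simp add: scalar_mult_eq_scaleR)
      then show ?thesis by (simp add: G.sum G.scaleR D_def P_def partial_has_derivative[OF G])
    qed
    then have "G = (\<lambda>h. D x h $ i $ j)" by (rule ext)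
    with G show ?thesis by simp
  qed
  then have der: "(U has_derivative D x) (at x)" for x
    by (rule has_derivative_matrix_componentwise)
  have "continuous_on UNIV (P i j k)" for i j k
    using C1 by (simp add: C1_field_def C1_def P_def[abs_def])
  then have "continuous_on UNIV (\<lambda>x. D x h)" for h
    unfolding D_def by (intro continuous_on_vec_lambda continuous_intros)
  moreover have "continuous_on UNIV U"
    using der by (meson has_derivative_continuous_on has_derivative_at_withinI)
  ultimately have "torus_C1 U D"
    using der per by (simp add: torus_C1_def torus_cont_def periodic_def)
  then show ?thesis by blast
qed

lemma ac_F_continuous: "continuous_on UNIV (\<lambda>A::real^'m::finite^'m. ac_F A \<bullet> mat 1)"
  unfolding ac_F_trace
  by (intro continuous_intros bounded_bilinear.continuous_on[OF bounded_bilinear_matrix_mult]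
      bounded_linear.continuous_on[OF bounded_linear_transpose]) simp_all

text \<open>
  Summing the squared gradients of the entries and summing the squared norms of the partial derivatives of the matrix
  field are the same triple sum.
\<close>

lemma energy_eq:
  fixes U :: "'m::finite field"
  assumes U: "torus_C1 U D"
  shows "energy \<epsilon> U = \<epsilon>\<^sup>2 / 2 * dirichlet D + integral Omega (\<lambda>x. ac_F (U x) \<bullet> mat 1)"
proof -
  have g: "(\<Sum>i\<in>UNIV. \<Sum>j\<in>UNIV. (norm (grad (\<lambda>y. U y $ i $ j) x))\<^sup>2) = (\<Sum>k\<in>UNIV. (norm (D x (axis k 1)))\<^sup>2)" for x
  proof -
    have p: "partial k (\<lambda>y. U y $ i $ j) x = D x (axis k 1) $ i $ j" for i j k
      by (rule partial_has_derivative) (rule bounded_linear.has_derivative[OF bounded_linear_entry torus_C1D(2)[OF U]])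
    have "(norm (grad (\<lambda>y. U y $ i $ j) x))\<^sup>2 = (\<Sum>k\<in>UNIV. (D x (axis k 1) $ i $ j)\<^sup>2)" for i j
      unfolding power2_norm_eq_inner by (simp add: inner_vec_def grad_def p power2_eq_square)
    then have "(\<Sum>i\<in>UNIV. \<Sum>j\<in>UNIV. (norm (grad (\<lambda>y. U y $ i $ j) x))\<^sup>2)
        = (\<Sum>i\<in>UNIV. \<Sum>j\<in>UNIV. \<Sum>k\<in>UNIV. (D x (axis k 1) $ i $ j)\<^sup>2)" by simp
    also have "\<dots> = (\<Sum>i\<in>UNIV. \<Sum>k\<in>UNIV. \<Sum>j\<in>UNIV. (D x (axis k 1) $ i $ j)\<^sup>2)"
      by (rule sum.cong[OF refl]) (rule sum.swap)
    also have "\<dots> = (\<Sum>k\<in>UNIV. \<Sum>i\<in>UNIV. \<Sum>j\<in>UNIV. (D x (axis k 1) $ i $ j)\<^sup>2)" by (rule sum.swap)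
    finally show ?thesis by (simp add: frob_norm2)
  qed
  have "(\<lambda>x. \<Sum>k\<in>UNIV. (norm (D x (axis k 1)))\<^sup>2) integrable_on Omega"
    unfolding power2_norm_eq_inner by (intro integrable_sum torus_ip_integrable torus_C1D(3)[OF U]) simp
  moreover have "(\<lambda>x. ac_F (U x) \<bullet> mat 1) integrable_on Omega"
    by (rule Omega_integrable[OF torus_cont_compose[OF torus_C1D(1)[OF U] ac_F_continuous]])
  ultimately show ?thesis
    unfolding energy_def g dirichlet_def
    by (subst Henstock_Kurzweil_Integration.integral_add) (simp_all add: integrable_on_mult_right)
qed

lemma torus_C1_add:
  fixes u v :: "real^'m::finite \<Rightarrow> 'b::euclidean_space"
  shows "torus_C1 u D \<Longrightarrow> torus_C1 v D' \<Longrightarrow> torus_C1 (\<lambda>x. u x + v x) (\<lambda>x h. D x h + D' x h)"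
  by (auto simp: torus_C1_def intro!: torus_cont_intros has_derivative_add continuous_intros)

lemma torus_C1_diff:
  fixes u v :: "real^'m::finite \<Rightarrow> 'b::euclidean_space"
  shows "torus_C1 u D \<Longrightarrow> torus_C1 v D' \<Longrightarrow> torus_C1 (\<lambda>x. u x - v x) (\<lambda>x h. D x h - D' x h)"
  by (auto simp: torus_C1_def intro!: torus_cont_intros has_derivative_diff continuous_intros)

lemma ac_f_continuous: "continuous_on UNIV (ac_f :: real^'m::finite^'m \<Rightarrow> _)"
  unfolding ac_f_def
  by (intro continuous_intros bounded_bilinear.continuous_on[OF bounded_bilinear_matrix_mult]
      bounded_linear.continuous_on[OF bounded_linear_transpose])

lemma nonlin_torus_cont: "torus_cont U \<Longrightarrow> torus_cont (nonlin \<kappa> U)" for U :: "'m::finite field"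
  unfolding nonlin_def by (intro torus_cont_intros torus_cont_compose[OF _ ac_f_continuous])

lemma torus_C1_nonlin:
  fixes U :: "'m::finite field"
  assumes U: "torus_C1 U D"
  shows "\<exists>D'. torus_C1 (nonlin \<kappa> U) D'"
proof -
  note c = torus_contD(1)[OF torus_C1D(1)[OF U], of UNIV] torus_contD(1)[OF torus_C1D(3)[OF U], of UNIV]
  note cont = bounded_bilinear.continuous_on[OF bounded_bilinear_matrix_mult]
      bounded_linear.continuous_on[OF bounded_linear_transpose]
  let ?D = "\<lambda>x h. \<kappa> *\<^sub>R D x h + (D x h - ((U x ** transpose (U x)) ** D x h
      + (U x ** transpose (D x h) + D x h ** transpose (U x)) ** U x))"
  have "(nonlin \<kappa> U has_derivative ?D x) (at x)" for x
    unfolding nonlin_def[abs_def] ac_f_def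
    by (intro has_derivative_add has_derivative_diff has_derivative_scaleR_right
        bounded_bilinear.FDERIV[OF bounded_bilinear_matrix_mult]
        bounded_linear.has_derivative[OF bounded_linear_transpose] torus_C1D(2)[OF U])
  moreover have "continuous_on UNIV (\<lambda>x. ?D x h)" for h
    by (intro continuous_intros cont c)
  ultimately have "torus_C1 (nonlin \<kappa> U) ?D"
    using nonlin_torus_cont[OF torus_C1D(1)[OF U]] by (simp add: torus_C1_def)
  then show ?thesis by blast
qed

text \<open>
  The quadratic remainder \<open>\<kappa>/2 \<bar>B - A\<bar>\<^sup>2\<close> is expanded around \<open>A\<close>, so that the bound becomes a difference
  of values at \<open>B\<close> and \<open>A\<close> minus a linear term; in this form two consecutive stages telescope.
\<close>

lemma potential_step:
  fixes A B :: "real^'m::finite^'m"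
  assumes "norm A \<le> sqrt (real CARD('m))" "norm B \<le> sqrt (real CARD('m))" "3 * real CARD('m) - 1 \<le> \<kappa>"
  shows "ac_F B \<bullet> mat 1 - ac_F A \<bullet> mat 1 \<le> \<kappa> / 2 * (B \<bullet> B - A \<bullet> A) - (\<kappa> *\<^sub>R A + ac_f A) \<bullet> (B - A)"
proof -
  have "(norm (B - A))\<^sup>2 = B \<bullet> B - A \<bullet> A - 2 * (A \<bullet> (B - A))"
    by (simp add: power2_norm_eq_inner inner_diff inner_commute)
  then have "\<kappa> / 2 * (norm (B - A))\<^sup>2 = \<kappa> / 2 * (B \<bullet> B - A \<bullet> A) - \<kappa> * (A \<bullet> (B - A))"
    by (simp add: right_diff_distrib)
  then show ?thesis using ac_F_taylor[OF assms] unfolding inner_add_left inner_scaleR_left by linarith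
qed

context heat_semigroup
begin

text \<open>
  The bound \<open>\<kappa> C\<close> of the source balances the decay: \<open>e\<^bsup>-\<kappa>T\<^esup> C\<close> and \<open>\<integral>\<^sub>0\<^sup>T e\<^bsup>-\<kappa>r\<^esup> \<kappa> C dr\<close> add up to \<open>C\<close>.
\<close>

lemma etd_bound:
  fixes u :: "real^'m::finite \<Rightarrow> 'b::euclidean_space" and F :: "real \<Rightarrow> 'b"
  assumes u: "torus_cont u" "\<And>x. norm (u x) \<le> C" and T: "0 \<le> T"
    and F: "continuous_on {0..T} F" "\<And>r. r \<in> {0..T} \<Longrightarrow> norm (F r) \<le> exp (- \<kappa> * r) * (\<kappa> * C)"
  shows "norm (heat T u x + integral {0..T} F) \<le> C"
proof -
  have "((\<lambda>r. exp (- \<kappa> * r) * (\<kappa> * C)) has_integral (- exp (- \<kappa> * T) * C - (- exp (- \<kappa> * 0) * C))) {0..T}"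
    by (rule fundamental_theorem_of_calculus[OF T])
      (auto intro!: derivative_eq_intros simp flip: has_real_derivative_iff_has_vector_derivative)
  then have I: "(\<lambda>r. exp (- \<kappa> * r) * (\<kappa> * C)) integrable_on {0..T}"
    "integral {0..T} (\<lambda>r. exp (- \<kappa> * r) * (\<kappa> * C)) = C - exp (- \<kappa> * T) * C"
    by (auto simp: has_integral_iff)
  have "norm (integral {0..T} F) \<le> integral {0..T} (\<lambda>r. exp (- \<kappa> * r) * (\<kappa> * C))"
    by (rule Henstock_Kurzweil_Integration.integral_norm_bound_integral[OF integrable_continuous_real[OF F(1)] I(1) F(2)])
  then have "norm (integral {0..T} F) \<le> C - exp (- \<kappa> * T) * C" unfolding I(2) .
  moreover have "norm (heat T u x) \<le> exp (- \<kappa> * T) * C" by (rule norm_heat_le[OF u])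
  ultimately show ?thesis using norm_triangle_ineq[of "heat T u x" "integral {0..T} F"] by linarith
qed

lemma phi1_eq_duhamel:
  fixes V :: "'m::finite field"
  assumes V: "torus_cont V" shows "phi1 \<epsilon> \<kappa> T V x = duhamel (\<lambda>_. 1) T V x"
proof -
  have "phi1 \<epsilon> \<kappa> T V x = integral {0..T} (\<lambda>s. heat (T - s) V x)"
    unfolding phi1_def by (rule hk_integral_cong) (simp add: exp_L_eq_heat[OF V])
  also have "\<dots> = duhamel (\<lambda>_. 1) T V x"
    using integral_reflect_interval[of T "\<lambda>r. heat r V x"] by (simp add: duhamel_def)
  finally show ?thesis .
qed

lemma phi2_eq_duhamel:
  fixes V :: "'m::finite field"
  assumes V: "torus_cont V" shows "phi2 \<epsilon> \<kappa> T V x = duhamel (\<lambda>r. (T - r) / T) T V x"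
proof -
  have "phi2 \<epsilon> \<kappa> T V x = integral {0..T} (\<lambda>s. ((T - (T - s)) / T) *\<^sub>R heat (T - s) V x)"
    unfolding phi2_def by (rule hk_integral_cong) (simp add: exp_L_eq_heat[OF V])
  also have "\<dots> = duhamel (\<lambda>r. (T - r) / T) T V x"
    unfolding duhamel_def by (rule integral_reflect_interval[of T "\<lambda>r. ((T - r) / T) *\<^sub>R heat r V x"])
  finally show ?thesis .
qed

lemma heat_minus:
  fixes u :: "real^'m::finite \<Rightarrow> 'b::euclidean_space"
  assumes "torus_cont u" shows "heat s (\<lambda>x. - u x) x = - heat s u x"
  by (rule heat_linear[OF bounded_linear_minus[OF bounded_linear_ident] assms])

lemma ETD1_eq:
  fixes U :: "'m::finite field"
  assumes U: "torus_cont U" and T: "0 \<le> T"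
  shows "ETD1 \<epsilon> \<kappa> T U = etd_path U (nonlin \<kappa> U) T"
  by (simp add: fun_eq_iff ETD1_def etd_path_def exp_L_eq_heat[OF U T] phi1_eq_duhamel[OF nonlin_torus_cont[OF U]])

lemma ETDRK2_eq:
  fixes U :: "'m::finite field"
  assumes U: "torus_cont U" and T: "0 \<le> T"
  defines "V \<equiv> etd_path U (nonlin \<kappa> U) T"
  shows "ETDRK2 \<epsilon> \<kappa> T U = (\<lambda>x. V x + duhamel (\<lambda>r. (T - r) / T) T (\<lambda>y. nonlin \<kappa> V y - nonlin \<kappa> U y) x)"
proof
  fix x
  have V: "torus_cont V" unfolding V_def by (intro etd_path_torus_cont nonlin_torus_cont U)
  have h: "torus_cont (\<lambda>y. nonlin \<kappa> V y - nonlin \<kappa> U y)" by (intro torus_cont_intros nonlin_torus_cont U V)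
  have h': "torus_cont (\<lambda>y. nonlin \<kappa> U y - nonlin \<kappa> V y)" by (intro torus_cont_intros nonlin_torus_cont U V)
  have "duhamel (\<lambda>r. (T - r) / T) T (\<lambda>y. nonlin \<kappa> U y - nonlin \<kappa> V y) x
      = - duhamel (\<lambda>r. (T - r) / T) T (\<lambda>y. nonlin \<kappa> V y - nonlin \<kappa> U y) x"
    unfolding duhamel_def using heat_minus[OF h, of _ x] by simp
  then show "ETDRK2 \<epsilon> \<kappa> T U x = V x + duhamel (\<lambda>r. (T - r) / T) T (\<lambda>y. nonlin \<kappa> V y - nonlin \<kappa> U y) x"
    unfolding ETDRK2_def Let_def ETD1_eq[OF U T] V_def[symmetric] phi2_eq_duhamel[OF h'] by simp
qed

text \<open>
  The invariant of both iterations: regularity for the Dirichlet form, and the ball on which the potential is controlled.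
\<close>

definition admissible :: "'m::finite field \<Rightarrow> bool" where
  "admissible U \<longleftrightarrow> (\<exists>D. torus_C1 U D) \<and> (\<forall>x. norm (U x) \<le> sqrt (real CARD('m)))"

lemma admissibleD:
  fixes U :: "'m::finite field"
  assumes "admissible U"
  shows "torus_cont U" "\<exists>D. torus_C1 U D" "norm (U x) \<le> sqrt (real CARD('m))"
  using assms torus_C1D(1) unfolding admissible_def by blast+

text \<open>
  The pointwise bound of the potential is kept as a hypothesis, so that one lemma serves both schemes: \<open>h = 0\<close>, hence
  \<open>e = 0\<close>, gives the first-order scheme.
\<close>

lemma energy_step:
  fixes u h :: "'m::finite field"
  assumes u: "admissible u" and h: "torus_cont h" and T: "0 < T"
  defines "w \<equiv> etd_path u (nonlin \<kappa> u) T" and "e \<equiv> duhamel (\<lambda>r. (T - r) / T) T h"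
  assumes v: "admissible (\<lambda>x. w x + e x)"
    and pot: "\<And>x. ac_F (w x + e x) \<bullet> mat 1 - ac_F (u x) \<bullet> mat 1
      \<le> \<kappa> / 2 * ((w x + e x) \<bullet> (w x + e x) - u x \<bullet> u x) - nonlin \<kappa> u x \<bullet> (w x - u x) - (nonlin \<kappa> u x + h x) \<bullet> e x"
  shows "energy \<epsilon> (\<lambda>x. w x + e x) \<le> energy \<epsilon> u"
proof -
  obtain Du where Du: "torus_C1 u Du" using admissibleD(2)[OF u] by blast
  obtain Dv where Dv: "torus_C1 (\<lambda>x. w x + e x) Dv" using admissibleD(2)[OF v] by blast
  let ?v = "\<lambda>x. w x + e x"
  note uc = admissibleD(1)[OF u] and vc = admissibleD(1)[OF v]
  have Nc: "torus_cont (nonlin \<kappa> u)" by (rule nonlin_torus_cont[OF uc])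
  have wc: "torus_cont w" unfolding w_def by (rule etd_path_torus_cont[OF uc Nc])
  have ec: "torus_cont e" unfolding e_def using T by (intro duhamel_torus_cont h continuous_intros) auto
  have Fc: "torus_cont (\<lambda>x. ac_F (f x) \<bullet> mat 1)" if "torus_cont f" for f :: "'m field"
    by (rule torus_cont_compose[OF that ac_F_continuous])
  have main: "(\<epsilon>\<^sup>2 * dirichlet Dv + \<kappa> * torus_ip ?v ?v) / 2 - (\<epsilon>\<^sup>2 * dirichlet Du + \<kappa> * torus_ip u u) / 2
      - torus_ip (nonlin \<kappa> u) (\<lambda>x. w x - u x) - torus_ip (\<lambda>x. nonlin \<kappa> u x + h x) e \<le> 0"
    unfolding w_def e_def
    by (rule etd_energy_inequality[OF Du Nc h T Dv[unfolded w_def e_def]])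
  note ii = torus_ip_integrable[OF vc vc] torus_ip_integrable[OF uc uc] torus_ip_integrable[OF Nc torus_cont_intros(3)[OF wc uc]]
    torus_ip_integrable[OF torus_cont_intros(2)[OF Nc h] ec]
  have "integral Omega (\<lambda>x. ac_F (?v x) \<bullet> mat 1) - integral Omega (\<lambda>x. ac_F (u x) \<bullet> mat 1)
      = integral Omega (\<lambda>x. ac_F (?v x) \<bullet> mat 1 - ac_F (u x) \<bullet> mat 1)"
    by (rule hk_integral_diff[symmetric]) (intro Omega_integrable Fc uc vc)+
  also have "\<dots> \<le> integral Omega (\<lambda>x. \<kappa> / 2 * (?v x \<bullet> ?v x - u x \<bullet> u x) - nonlin \<kappa> u x \<bullet> (w x - u x) - (nonlin \<kappa> u x + h x) \<bullet> e x)"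
  proof (rule integral_le[OF _ _ pot])
    show "(\<lambda>x. ac_F (?v x) \<bullet> mat 1 - ac_F (u x) \<bullet> mat 1) integrable_on Omega"
      by (intro integrable_diff Omega_integrable Fc uc vc)
    show "(\<lambda>x. \<kappa> / 2 * (?v x \<bullet> ?v x - u x \<bullet> u x) - nonlin \<kappa> u x \<bullet> (w x - u x) - (nonlin \<kappa> u x + h x) \<bullet> e x) integrable_on Omega"
      by (intro integrable_diff integrable_on_mult_right ii)
  qed
  also have "\<dots> = \<kappa> / 2 * (torus_ip ?v ?v - torus_ip u u) - torus_ip (nonlin \<kappa> u) (\<lambda>x. w x - u x) - torus_ip (\<lambda>x. nonlin \<kappa> u x + h x) e"
    unfolding torus_ip_def
      hk_integral_diff[OF integrable_diff[OF integrable_on_mult_right[OF integrable_diff[OF ii(1,2)]] ii(3)] ii(4)]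
      hk_integral_diff[OF integrable_on_mult_right[OF integrable_diff[OF ii(1,2)]] ii(3)]
      Henstock_Kurzweil_Integration.integral_mult_right
      hk_integral_diff[OF ii(1,2)] ..
  finally have "integral Omega (\<lambda>x. ac_F (?v x) \<bullet> mat 1) - integral Omega (\<lambda>x. ac_F (u x) \<bullet> mat 1)
      \<le> \<kappa> / 2 * (torus_ip ?v ?v - torus_ip u u) - torus_ip (nonlin \<kappa> u) (\<lambda>x. w x - u x) - torus_ip (\<lambda>x. nonlin \<kappa> u x + h x) e" .
  with main show ?thesis
    unfolding energy_eq[OF Du] energy_eq[OF Dv] by (simp add: field_simps)
qed

context
  fixes T :: real
  assumes T: "0 < T"
begin

lemma ETD1_step:
  fixes u :: "'m::finite field"
  assumes u: "admissible u" and k: "3 * real CARD('m) - 1 \<le> \<kappa>"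
  shows "admissible (ETD1 \<epsilon> \<kappa> T u)" and "energy \<epsilon> (ETD1 \<epsilon> \<kappa> T u) \<le> energy \<epsilon> u"
proof -
  let ?N = "nonlin \<kappa> u"
  let ?C = "sqrt (real CARD('m))"
  note uc = admissibleD(1)[OF u]
  obtain Du where Du: "torus_C1 u Du" using admissibleD(2)[OF u] by blast
  obtain DN where DN: "torus_C1 ?N DN" using torus_C1_nonlin[OF Du] by blast
  note Nc = torus_C1D(1)[OF DN]
  have Nb: "norm (?N x) \<le> \<kappa> * ?C" for x
    unfolding nonlin_def by (rule norm_nonlin_le[OF admissibleD(3)[OF u] k])
  have eq: "ETD1 \<epsilon> \<kappa> T u = etd_path u ?N T" using T by (intro ETD1_eq uc) simp
  obtain DJ where DJ: "torus_C1 (duhamel (\<lambda>_. 1) T ?N) DJ" using torus_C1_duhamel[OF DN continuous_on_const] by blast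
  have "\<exists>D. torus_C1 (etd_path u ?N T) D"
    unfolding etd_path_def[abs_def] by (rule exI, rule torus_C1_add[OF heat_torus_C1[OF Du] DJ])
  moreover have "norm (etd_path u ?N T x) \<le> ?C" for x
    unfolding etd_path_def duhamel_def
  proof (rule etd_bound[OF uc admissibleD(3)[OF u]])
    show "continuous_on {0..T} (\<lambda>r. 1 *\<^sub>R heat r ?N x)"
      by (rule continuous_on_slice(1)[OF duhamel_integrand_continuous[OF Nc continuous_on_const]]) simp
    show "norm (1 *\<^sub>R heat r ?N x) \<le> exp (- \<kappa> * r) * (\<kappa> * ?C)" for r
      using norm_heat_le[OF Nc Nb] by simp
  qed (use T in simp)
  ultimately show adm: "admissible (ETD1 \<epsilon> \<kappa> T u)" unfolding eq admissible_def by blast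
  have z: "duhamel (\<lambda>r. (T - r) / T) T (\<lambda>_. 0 :: real^'m^'m) x = 0" for x
    by (simp add: duhamel_def heat_def gauss_avg_def)
  have "energy \<epsilon> (\<lambda>x. etd_path u ?N T x + duhamel (\<lambda>r. (T - r) / T) T (\<lambda>_. 0) x) \<le> energy \<epsilon> u"
  proof (rule energy_step[OF u torus_cont_intros(1) T], unfold z add_0_right)
    show "admissible (etd_path u ?N T)" using adm eq by simp
    then show "ac_F (etd_path u ?N T x) \<bullet> mat 1 - ac_F (u x) \<bullet> mat 1
      \<le> \<kappa> / 2 * (etd_path u ?N T x \<bullet> etd_path u ?N T x - u x \<bullet> u x) - ?N x \<bullet> (etd_path u ?N T x - u x) - ?N x \<bullet> 0" for x
      using potential_step[OF admissibleD(3)[OF u] admissibleD(3) k, of "etd_path u ?N T" x x] by (simp add: nonlin_def)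
  qed
  then show "energy \<epsilon> (ETD1 \<epsilon> \<kappa> T u) \<le> energy \<epsilon> u" by (simp add: z eq)
qed

text \<open>
  The source \<open>N(u) + c (N(w) - N(u))\<close> with \<open>0 \<le> c \<le> 1\<close> is a convex combination of two sources of norm at most
  \<open>\<kappa> \<surd>m\<close>, so the ball is preserved. The potential is expanded at \<open>u\<close> for the passage to the first-stage
  value \<open>w\<close>, and at \<open>w\<close> for the passage to the final value.
\<close>

lemma ETDRK2_step:
  fixes u :: "'m::finite field"
  assumes u: "admissible u" and k: "3 * real CARD('m) - 1 \<le> \<kappa>"
  shows "admissible (ETDRK2 \<epsilon> \<kappa> T u)" and "energy \<epsilon> (ETDRK2 \<epsilon> \<kappa> T u) \<le> energy \<epsilon> u"
proof -
  let ?N = "nonlin \<kappa> u"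
  let ?C = "sqrt (real CARD('m))"
  let ?c = "\<lambda>r. (T - r) / T"
  define w where "w = etd_path u ?N T"
  define h where "h = (\<lambda>y. nonlin \<kappa> w y - ?N y)"
  have c: "continuous_on {0..T} ?c" using T by (intro continuous_intros) auto
  note uc = admissibleD(1)[OF u]
  have w: "admissible w"
    using ETD1_step(1)[OF u k] ETD1_eq[OF uc, of T] T by (simp add: w_def)
  obtain Du where Du: "torus_C1 u Du" using admissibleD(2)[OF u] by blast
  obtain Dw where Dw: "torus_C1 w Dw" using admissibleD(2)[OF w] by blast
  obtain DN where DN: "torus_C1 ?N DN" using torus_C1_nonlin[OF Du] by blast
  obtain DM where DM: "torus_C1 (nonlin \<kappa> w) DM" using torus_C1_nonlin[OF Dw] by blast
  note Nc = torus_C1D(1)[OF DN] and Mc = torus_C1D(1)[OF DM]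
  note Dh = torus_C1_diff[OF DM DN, folded h_def]
  note hc = torus_C1D(1)[OF Dh]
  have Nb: "norm (?N x) \<le> \<kappa> * ?C" and Mb: "norm (nonlin \<kappa> w x) \<le> \<kappa> * ?C" for x
    unfolding nonlin_def by (rule norm_nonlin_le[OF admissibleD(3)[OF u] k] norm_nonlin_le[OF admissibleD(3)[OF w] k])+
  have eq: "ETDRK2 \<epsilon> \<kappa> T u = (\<lambda>x. w x + duhamel ?c T h x)"
    unfolding w_def h_def using T by (intro ETDRK2_eq uc) simp
  obtain DJ where DJ: "torus_C1 (duhamel ?c T h) DJ" using torus_C1_duhamel[OF Dh c] by blast
  have "\<exists>D. torus_C1 (\<lambda>x. w x + duhamel ?c T h x) D"
    by (rule exI, rule torus_C1_add[OF Dw DJ])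
  moreover have "norm (w x + duhamel ?c T h x) \<le> ?C" for x
  proof -
    have i1: "continuous_on {0..T} (\<lambda>r. 1 *\<^sub>R heat r ?N x)"
      by (rule continuous_on_slice(1)[OF duhamel_integrand_continuous[OF Nc continuous_on_const]]) simp
    have i2: "continuous_on {0..T} (\<lambda>r. ?c r *\<^sub>R heat r h x)"
      by (rule continuous_on_slice(1)[OF duhamel_integrand_continuous[OF hc c]]) simp
    have "w x + duhamel ?c T h x = heat T u x + integral {0..T} (\<lambda>r. 1 *\<^sub>R heat r ?N x + ?c r *\<^sub>R heat r h x)"
      unfolding w_def etd_path_def duhamel_def
      by (subst Henstock_Kurzweil_Integration.integral_add) (use i1 i2 in \<open>auto intro!: integrable_continuous_real simp: add.assoc\<close>)
    also have "norm \<dots> \<le> ?C"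
    proof (rule etd_bound[OF uc admissibleD(3)[OF u]])
      show "continuous_on {0..T} (\<lambda>r. 1 *\<^sub>R heat r ?N x + ?c r *\<^sub>R heat r h x)" by (intro continuous_on_add i1 i2)
      fix r assume r: "r \<in> {0..T}"
      have c01: "0 \<le> ?c r" "?c r \<le> 1" using r T by auto
      have hd: "heat r h x = heat r (nonlin \<kappa> w) x - heat r ?N x"
        unfolding h_def by (rule heat_diff[OF Mc Nc])
      have "1 *\<^sub>R heat r ?N x + ?c r *\<^sub>R heat r h x = (1 - ?c r) *\<^sub>R heat r ?N x + ?c r *\<^sub>R heat r (nonlin \<kappa> w) x"
        unfolding hd by (simp add: algebra_simps)
      also have "norm \<dots> \<le> (1 - ?c r) * norm (heat r ?N x) + ?c r * norm (heat r (nonlin \<kappa> w) x)"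
      proof -
        have "norm ((1 - c) *\<^sub>R a + c *\<^sub>R b) \<le> (1 - c) * norm a + c * norm b" if "0 \<le> c" "c \<le> 1" for c and a b :: "real^'m^'m"
          using that by (intro order_trans[OF norm_triangle_ineq]) simp
        then show ?thesis using c01 .
      qed
      also have "\<dots> \<le> (1 - ?c r) * (exp (- \<kappa> * r) * (\<kappa> * ?C)) + ?c r * (exp (- \<kappa> * r) * (\<kappa> * ?C))"
        using c01 by (intro add_mono mult_left_mono norm_heat_le Nc Nb Mc Mb) auto
      also have "\<dots> = exp (- \<kappa> * r) * (\<kappa> * ?C)" by (simp add: left_diff_distrib)
      finally show "norm (1 *\<^sub>R heat r ?N x + ?c r *\<^sub>R heat r h x) \<le> exp (- \<kappa> * r) * (\<kappa> * ?C)" .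
    qed (use T in simp)
    finally show ?thesis .
  qed
  ultimately show adm: "admissible (ETDRK2 \<epsilon> \<kappa> T u)" unfolding eq admissible_def by blast
  show "energy \<epsilon> (ETDRK2 \<epsilon> \<kappa> T u) \<le> energy \<epsilon> u"
    unfolding eq w_def
  proof (rule energy_step[OF u hc T], unfold w_def[symmetric])
    let ?v = "\<lambda>x. w x + duhamel ?c T h x"
    show v: "admissible ?v" using adm eq by simp
    fix x
    have p1: "ac_F (w x) \<bullet> mat 1 - ac_F (u x) \<bullet> mat 1 \<le> \<kappa> / 2 * (w x \<bullet> w x - u x \<bullet> u x) - ?N x \<bullet> (w x - u x)"
      unfolding nonlin_def by (rule potential_step[OF admissibleD(3)[OF u] admissibleD(3)[OF w] k])
    have "ac_F (?v x) \<bullet> mat 1 - ac_F (w x) \<bullet> mat 1 \<le> \<kappa> / 2 * (?v x \<bullet> ?v x - w x \<bullet> w x) - nonlin \<kappa> w x \<bullet> (?v x - w x)"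
      unfolding nonlin_def by (rule potential_step[OF admissibleD(3)[OF w] admissibleD(3)[OF v] k])
    moreover have "?v x - w x = duhamel ?c T h x" by simp
    moreover have "?N x + h x = nonlin \<kappa> w x" by (simp add: h_def)
    ultimately have p2: "ac_F (?v x) \<bullet> mat 1 - ac_F (w x) \<bullet> mat 1
        \<le> \<kappa> / 2 * (?v x \<bullet> ?v x - w x \<bullet> w x) - (?N x + h x) \<bullet> duhamel ?c T h x" by (simp only:)
    have "\<kappa> / 2 * (?v x \<bullet> ?v x - u x \<bullet> u x) = \<kappa> / 2 * (?v x \<bullet> ?v x - w x \<bullet> w x) + \<kappa> / 2 * (w x \<bullet> w x - u x \<bullet> u x)"
      by (simp add: algebra_simps)
    with p1 p2 show "ac_F (?v x) \<bullet> mat 1 - ac_F (u x) \<bullet> mat 1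
      \<le> \<kappa> / 2 * (?v x \<bullet> ?v x - u x \<bullet> u x) - ?N x \<bullet> (w x - u x) - (?N x + h x) \<bullet> duhamel ?c T h x"
      by linarith
  qed
qed

end

end

theorem theorem3p4:
  fixes U0 :: "real^'m::finite \<Rightarrow> real^'m^'m" and \<epsilon> \<kappa> \<tau> :: real
  assumes "2 \<le> CARD('m)"
    and "0 < \<epsilon>" and "0 < \<kappa>" and "0 < \<tau>"
    and "periodic U0" and "C1_field U0"
    and "\<And>x. norm (U0 x) \<le> sqrt (real CARD('m))"
    and "3 * real CARD('m) - 1 \<le> \<kappa>"
  shows "(\<forall>U. U 0 = U0 \<and> (\<forall>n. U (Suc n) = ETD1 \<epsilon> \<kappa> \<tau> (U n)) \<longrightarrow>
            (\<forall>n. energy \<epsilon> (U (Suc n)) \<le> energy \<epsilon> (U n))) \<and>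
         (\<forall>U. U 0 = U0 \<and> (\<forall>n. U (Suc n) = ETDRK2 \<epsilon> \<kappa> \<tau> (U n)) \<longrightarrow>
            (\<forall>n. energy \<epsilon> (U (Suc n)) \<le> energy \<epsilon> (U n)))"
proof -
  interpret heat_semigroup \<epsilon> \<kappa> by standard fact+
  have adm0: "admissible U0"
    using torus_C1_of_C1_field[OF assms(5,6)] assms(7) by (simp add: admissible_def)
  show ?thesis
  proof (intro conjI allI impI; elim conjE)
    fix U n assume U: "U 0 = U0" "\<forall>n. U (Suc n) = ETD1 \<epsilon> \<kappa> \<tau> (U n)"
    have "admissible (U n)" for n
    proof (induction n)
      case (Suc n)
      then show ?case using U(2) ETD1_step(1)[OF \<open>0 < \<tau>\<close> Suc.IH assms(8)] by simp
    qed (use U(1) adm0 in simp)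
    then show "energy \<epsilon> (U (Suc n)) \<le> energy \<epsilon> (U n)"
      using U(2) ETD1_step(2)[OF \<open>0 < \<tau>\<close> _ assms(8)] by simp
  next
    fix U n assume U: "U 0 = U0" "\<forall>n. U (Suc n) = ETDRK2 \<epsilon> \<kappa> \<tau> (U n)"
    have "admissible (U n)" for n
    proof (induction n)
      case (Suc n)
      then show ?case using U(2) ETDRK2_step(1)[OF \<open>0 < \<tau>\<close> Suc.IH assms(8)] by simp
    qed (use U(1) adm0 in simp)
    then show "energy \<epsilon> (U (Suc n)) \<le> energy \<epsilon> (U n)"
      using U(2) ETDRK2_step(2)[OF \<open>0 < \<tau>\<close> _ assms(8)] by simp
  qed
qed

end
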